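(* There exists a constant $c\in(0,\infty)$ depending only on $d$ (possibly different at each occurrence) such that the following holds. Let $L\ge1$, $K\ge0$ be integers, $\gamma>10$, and let $\Lambda$ be either a box $B(x,N)$ with $x\in\mathbb{Z}^d$, $N\ge0$, or $\Lambda=\emptyset$. If $(\log L)^{100\gamma}\le\ell\le L^{\frac1{3d}}$ and $\widetilde{L}=\big\lfloor(\alpha L\,\ell^{(d-2)/2})^{1/d}\big\rfloor$ with $\alpha=(\log L)^{10\gamma}$, then for each choice of points $\{y_{\widetilde{C}}\in\widetilde{C}:\widetilde{C}\in\widetilde{\mathcal{C}}\}$, the set $$\mathcal{O}=\bigcup_{\widetilde{C}\in\widetilde{\mathcal{C}}}B(y_{\widetilde{C}},\ell)\ \ (\subset B_{K+2L})$$ is a $\big(e^{-c(\log L)^\gamma},\,c\,\ell^{(d-2)/2}\big)$-good obstacle set whenever $L\ge L_0(\gamma,d)$.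
   Context: Fix $d\ge 3$. $|\cdot|$ is the $\ell^\infty$-norm on $\mathbb{Z}^d$, $B(x,r)=\{y\in\mathbb{Z}^d:|y-x|\le r\}$, $B_r=B(0,r)$. For $S\subset\mathbb{Z}^d$, $\partial S=\{x\in S:\exists y\notin S,\ y\sim x\}$ ($\sim$: nearest neighbors), $\partial\emptyset=\emptyset$. $P_x$ is the law of the discrete-time lazy simple random walk $X=(X_n)_{n\ge0}$ on $\mathbb{Z}^d$ started at $x$: at each step it stays put with probability $1/2$ and jumps to each of the $2d$ nearest neighbors with probability $1/(4d)$. For $U\subset\mathbb{Z}^d$, $H_U=\inf\{n\ge0:X_n\in U\}$. For $\mu:\mathbb{Z}^d\to\mathbb{R}_+$, $P_\mu=\sum_x\mu(x)P_x$. Cells: $\widetilde{\mathbb{L}}=3\widetilde{L}\mathbb{Z}^d\cap B_{K+3L/2}$, and $\widetilde{\mathcal{C}}$ is the collection of all boxes $\widetilde{C}=B(z,\widetilde{L})$ with $z\in\widetilde{\mathbb{L}}$ such that $B(z,2\widetilde{L})\cap\partial\Lambda=\emptyset$. Good obstacle sets: an obstacle set is a disjoint union $\mathcal{O}=\bigcup_{B\in\mathcal{B}_{\mathcal{O}}}B$ of boxes of equal radius $\ell_{\mathcal{O}}\ge1$ (here $\mathcal{B}_{\mathcal{O}}=\{B(y_{\widetilde{C}},\ell):\widetilde{C}\in\widetilde{\mathcal{C}}\}$, $\ell_{\mathcal{O}}=\ell$). For $\delta_{\mathcal{O}}\in(0,1)$, $M_{\mathcal{O}}\ge1$, an obstacle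 set $\mathcal{O}\subset B_{K+2L}$ is $(\delta_{\mathcal{O}},M_{\mathcal{O}})$-good if: (Visibility) $P_x[H_{\mathcal{O}}>L(\log L)^{-10\gamma}]\le\delta_{\mathcal{O}}$ for all $x\in B_{K+L}$; and (Density) $P_\mu[X_{H_{\mathcal{O}}}\in B,\,H_{\mathcal{O}}<\infty]\ge M_{\mathcal{O}}L$ for all $B\in\mathcal{B}_{\mathcal{O}}$ with $B\cap U_{\mathcal{O}}\ne\emptyset$, where $U_{\mathcal{O}}=B_{K+\sqrt{L}(\log L)^\gamma}$ and $\mu=\alpha^{-1}1_{U_{\mathcal{O}}}$, $\alpha=(\log L)^{10\gamma}$. $L_0(\gamma,d)$ is a finite constant depending only on $\gamma,d$. *)

theory Defs
  imports "HOL-Probability.Probability"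
begin

(* The lattice Z^d is the type int ^ 'd, with d = CARD('d).  Radii of boxes are real numbers,
   since boxes such as B_{K + 3L/2} or B_{K + sqrt L (log L)^gamma} occur. *)

definition linf :: "int ^ 'd \<Rightarrow> int" where
  "linf x = Max (range (\<lambda>i. \<bar>x $ i\<bar>))"

definition zbox :: "int ^ 'd \<Rightarrow> real \<Rightarrow> (int ^ 'd) set" where
  "zbox x r = {y. real_of_int (linf (y - x)) \<le> r}"

definition nearest_neighbor :: "int ^ 'd \<Rightarrow> int ^ 'd \<Rightarrow> bool" where
  "nearest_neighbor x y \<longleftrightarrow> (\<Sum>i\<in>UNIV. \<bar>x $ i - y $ i\<bar>) = 1"

definition inner_boundary :: "(int ^ 'd) set \<Rightarrow> (int ^ 'd) set" where
  "inner_boundary S = {x \<in> S. \<exists>y. y \<notin> S \<and> nearest_neighbor y x}"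

definition lazy_step :: "(int ^ 'd) pmf" where
  "lazy_step = bernoulli_pmf (1/2) \<bind>
     (\<lambda>stay. if stay then return_pmf 0 else pmf_of_set {e. nearest_neighbor 0 e})"

(* P_x, as a measure on the space of all trajectories nat => Z^d: the image of the product
   measure of i.i.d. lazy steps under partial summation started at x. *)
definition walk_law :: "int ^ 'd \<Rightarrow> (nat \<Rightarrow> int ^ 'd) measure" where
  "walk_law x = distr (\<Pi>\<^sub>M n\<in>UNIV. measure_pmf lazy_step)
     (\<Pi>\<^sub>M n\<in>UNIV. count_space UNIV) (\<lambda>\<xi> n. x + (\<Sum>k<n. \<xi> k))"

(* P_mu[E] = sum over x of mu(x) P_x[E] *)
definition walk_measure :: "(int ^ 'd \<Rightarrow> real) \<Rightarrow> (nat \<Rightarrow> int ^ 'd) set \<Rightarrow> real" where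
  "walk_measure \<mu> E = (\<Sum>\<^sub>\<infinity>x\<in>UNIV. \<mu> x * measure (walk_law x) E)"

(* Infimum in enat, so it is \<infinity> if U is never visited. *)
definition hitting_time :: "(int ^ 'd) set \<Rightarrow> (nat \<Rightarrow> int ^ 'd) \<Rightarrow> enat" where
  "hitting_time U X = Inf {enat n | n. X n \<in> U}"

definition alpha :: "real \<Rightarrow> nat \<Rightarrow> real" where
  "alpha \<gamma> L = ln (real L) powr (10 * \<gamma>)"

definition source_set :: "nat \<Rightarrow> nat \<Rightarrow> real \<Rightarrow> (int ^ 'd) set" where
  "source_set K L \<gamma> = zbox 0 (real K + sqrt (real L) * ln (real L) powr \<gamma>)"

definition source_measure :: "nat \<Rightarrow> nat \<Rightarrow> real \<Rightarrow> int ^ 'd \<Rightarrow> real" where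
  "source_measure K L \<gamma> x = inverse (alpha \<gamma> L) * indicator (source_set K L \<gamma>) x"

definition obstacle_set :: "(int ^ 'd) set set \<Rightarrow> real \<Rightarrow> (int ^ 'd) set \<Rightarrow> bool" where
  "obstacle_set \<B> l \<O> \<longleftrightarrow>
     l \<ge> 1 \<and> (\<forall>B\<in>\<B>. \<exists>y. B = zbox y l) \<and> disjoint \<B> \<and> \<O> = \<Union>\<B>"

(* \<O> is (\<delta>, M)-good, where \<B> is the collection of boxes of radius l composing \<O>. *)
definition good_obstacle_set ::
  "nat \<Rightarrow> nat \<Rightarrow> real \<Rightarrow> real \<Rightarrow> real \<Rightarrow> (int ^ 'd) set set \<Rightarrow> real \<Rightarrow> (int ^ 'd) set \<Rightarrow> bool" where
  "good_obstacle_set K L \<gamma> \<delta> M \<B> l \<O> \<longleftrightarrow>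
     0 < \<delta> \<and> \<delta> < 1 \<and> M \<ge> 1 \<and>
     obstacle_set \<B> l \<O> \<and> \<O> \<subseteq> zbox 0 (real K + 2 * real L) \<and>
     (\<forall>x \<in> zbox 0 (real K + real L).
        measure (walk_law x)
          {X. ereal_of_enat (hitting_time \<O> X) > ereal (real L * ln (real L) powr (- 10 * \<gamma>))}
        \<le> \<delta>) \<and>
     (\<forall>B \<in> \<B>. B \<inter> source_set K L \<gamma> \<noteq> {} \<longrightarrow>
        walk_measure (source_measure K L \<gamma>)
          {X. hitting_time \<O> X < \<infinity> \<and> X (the_enat (hitting_time \<O> X)) \<in> B}
        \<ge> M * real L)"

definition cell_centers :: "nat \<Rightarrow> nat \<Rightarrow> int \<Rightarrow> (int ^ 'd) set" where
  "cell_centers K L Lt = {z. \<forall>i. 3 * Lt dvd z $ i} \<inter> zbox 0 (real K + 3 * real L / 2)"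

definition cells :: "nat \<Rightarrow> nat \<Rightarrow> int \<Rightarrow> (int ^ 'd) set \<Rightarrow> (int ^ 'd) set set" where
  "cells K L Lt \<Lambda> = {zbox z (of_int Lt) | z. z \<in> cell_centers K L Lt \<and>
     zbox z (2 * of_int Lt) \<inter> inner_boundary \<Lambda> = {}}"


text \<open>The one-step distribution and the trajectory space are as intended, and the events in
  \<^term>\<open>good_obstacle_set\<close> are measurable (otherwise \<^const>\<open>measure\<close> would return 0).\<close>

lemma nearest_neighbor_0_iff:
  "nearest_neighbor (0 :: int ^ 'd) e \<longleftrightarrow> (\<exists>i. e = axis i 1 \<or> e = axis i (- 1))"
proof
  assume "nearest_neighbor 0 e"
  hence s: "(\<Sum>i\<in>UNIV. \<bar>e $ i\<bar>) = 1" by (simp add: nearest_neighbor_def)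
  then obtain i where i: "e $ i \<noteq> 0"
    by (metis abs_zero sum.neutral zero_neq_one)
  have "(\<Sum>i\<in>UNIV. \<bar>e $ i\<bar>) = \<bar>e $ i\<bar> + (\<Sum>j\<in>UNIV - {i}. \<bar>e $ j\<bar>)"
    by (subst sum.remove[of _ i]) auto
  moreover have "(\<Sum>j\<in>UNIV - {i}. \<bar>e $ j\<bar>) \<ge> 0" by (rule sum_nonneg) auto
  ultimately have *: "\<bar>e $ i\<bar> = 1" "(\<Sum>j\<in>UNIV - {i}. \<bar>e $ j\<bar>) = 0"
    using s i by linarith+
  from *(2) have "\<forall>j\<in>UNIV - {i}. \<bar>e $ j\<bar> = 0"
    by (subst (asm) sum_nonneg_eq_0_iff) auto
  hence "e = axis i (e $ i)" by (auto simp: vec_eq_iff axis_def)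
  with *(1) show "\<exists>i. e = axis i 1 \<or> e = axis i (- 1)"
    by (metis abs_eq_iff' abs_one)
next
  assume "\<exists>i. e = axis i 1 \<or> e = axis i (- 1)"
  then obtain i where "e = axis i 1 \<or> e = axis i (- 1)" by blast
  hence "\<And>j. \<bar>e $ j\<bar> = (if j = i then 1 else 0)" by (auto simp: axis_def)
  thus "nearest_neighbor 0 e" by (simp add: nearest_neighbor_def)
qed

lemma neighbors_0_eq:
  "{e. nearest_neighbor (0 :: int ^ 'd) e} =
     range (\<lambda>i. axis i 1) \<union> range (\<lambda>i. axis i (- 1))"
  by (auto simp: nearest_neighbor_0_iff)

lemma card_neighbors_0: "card {e. nearest_neighbor (0 :: int ^ 'd) e} = 2 * CARD('d)"
proof -
  have "card (range (\<lambda>i. axis i (c::int) :: int ^ 'd)) = CARD('d)" if "c \<noteq> 0" for c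
    using that by (intro card_image) (auto simp: inj_on_def axis_eq_axis)
  moreover have "range (\<lambda>i. axis i 1 :: int ^ 'd) \<inter> range (\<lambda>i. axis i (- 1)) = {}"
    by (auto simp: axis_eq_axis)
  ultimately show ?thesis
    unfolding neighbors_0_eq by (subst card_Un_disjoint) auto
qed

lemma pmf_lazy_step:
  "pmf (lazy_step :: (int ^ 'd) pmf) e =
     (if e = 0 then 1/2 else if nearest_neighbor 0 e then 1 / (4 * real CARD('d)) else 0)"
proof -
  have "finite {e :: int ^ 'd. nearest_neighbor 0 e}"
    by (simp add: neighbors_0_eq)
  moreover have "{e :: int ^ 'd. nearest_neighbor 0 e} \<noteq> {}"
    by (simp add: neighbors_0_eq)
  moreover have "\<not> nearest_neighbor (0 :: int ^ 'd) 0"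
    by (simp add: nearest_neighbor_def)
  ultimately show ?thesis
    by (auto simp: lazy_step_def pmf_bind card_neighbors_0 indicator_def)
qed

lemma walk_map_measurable:
  "(\<lambda>\<xi> n. x + (\<Sum>k<n. \<xi> k)) \<in> (\<Pi>\<^sub>M n\<in>UNIV. measure_pmf lazy_step) \<rightarrow>\<^sub>M
     (\<Pi>\<^sub>M n\<in>(UNIV::nat set). count_space (UNIV :: (int ^ 'd) set))"
proof -
  have c: "(\<lambda>\<xi>. \<xi> k) \<in> (\<Pi>\<^sub>M n\<in>UNIV. measure_pmf lazy_step) \<rightarrow>\<^sub>M
      count_space (UNIV :: (int ^ 'd) set)" for k :: nat
    using measurable_component_singleton[of k UNIV
      "\<lambda>_. measure_pmf (lazy_step :: (int ^ 'd) pmf)"]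
    by (simp cong: measurable_cong_sets)
  have "(\<lambda>\<xi>. x + (\<Sum>k<n. \<xi> k)) \<in> (\<Pi>\<^sub>M n\<in>UNIV. measure_pmf lazy_step) \<rightarrow>\<^sub>M
      count_space (UNIV :: (int ^ 'd) set)" for n :: nat
  proof (induction n)
    case (Suc n)
    have "(\<lambda>\<xi>. (x + (\<Sum>k<n. \<xi> k)) + \<xi> n) \<in>
        (\<Pi>\<^sub>M n\<in>UNIV. measure_pmf lazy_step) \<rightarrow>\<^sub>M count_space (UNIV :: (int ^ 'd) set)"
      by (rule measurable_compose_countable[where f = "\<lambda>a \<xi>. a + \<xi> n", OF _ Suc])
         (rule measurable_compose[OF c], simp)
    thus ?case by (simp add: add.assoc)
  qed simp
  thus ?thesis by (intro measurable_PiM_single') auto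
qed

lemma space_walk_law [simp]: "space (walk_law x) = UNIV"
  by (simp add: walk_law_def space_PiM)

lemma sets_walk_law [measurable_cong]:
  "sets (walk_law x) = sets (\<Pi>\<^sub>M n\<in>UNIV. count_space UNIV)"
  by (simp add: walk_law_def)

lemma prob_space_walk_law: "prob_space (walk_law x)"
proof -
  interpret product_prob_space "\<lambda>_::nat. measure_pmf lazy_step" UNIV
    by unfold_locales
  show ?thesis unfolding walk_law_def
    by (rule prob_space_distr) (rule walk_map_measurable)
qed

lemma hitting_time_measurable:
  "hitting_time U \<in> walk_law x \<rightarrow>\<^sub>M count_space UNIV"
proof -
  have [measurable]: "Measurable.pred (walk_law x) (\<lambda>X. X n \<in> U)" for n
    by measurable
  have "hitting_time U X = (if \<exists>n. X n \<in> U then enat (LEAST n. X n \<in> U) else \<infinity>)" for X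
  proof (cases "\<exists>n. X n \<in> U")
    case True
    have "X (LEAST n. X n \<in> U) \<in> U" using True by (rule LeastI_ex)
    hence "Inf {enat n |n. X n \<in> U} = enat (LEAST n. X n \<in> U)"
      by (intro Inf_eqI) (auto intro: Least_le)
    thus ?thesis using True by (simp add: hitting_time_def)
  qed (auto simp: hitting_time_def top_enat_def)
  hence "hitting_time U = (\<lambda>X. if \<exists>n. X n \<in> U then enat (LEAST n. X n \<in> U) else \<infinity>)"
    by blast
  thus ?thesis by simp
qed

lemma hitting_events_measurable:
  "{X. ereal_of_enat (hitting_time U X) > t} \<in> sets (walk_law x)"
  "{X. hitting_time U X < \<infinity> \<and> X (the_enat (hitting_time U X)) \<in> B} \<in> sets (walk_law x)"
proof -
  note [measurable] = hitting_time_measurable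
  have "Measurable.pred (walk_law x) (\<lambda>X. ereal_of_enat (hitting_time U X) > t)"
    by measurable
  thus "{X. ereal_of_enat (hitting_time U X) > t} \<in> sets (walk_law x)"
    by (simp add: pred_def)
  have *: "Measurable.pred (walk_law x) (\<lambda>X. X n \<in> B)" for n
    by measurable
  have "Measurable.pred (walk_law x)
      (\<lambda>X. hitting_time U X < \<infinity> \<and> (\<exists>n. the_enat (hitting_time U X) = n \<and> X n \<in> B))"
    using * by measurable
  thus "{X. hitting_time U X < \<infinity> \<and> X (the_enat (hitting_time U X)) \<in> B} \<in> sets (walk_law x)"
    by (simp add: pred_def)
qed

end

theory Submission
  imports Defs "HOL-Real_Asymp.Real_Asymp"
begin

text \<open>A step of the walk picks a coordinate uniformly and performs a one-dimensional step with
  weights 1/4, 1/2, 1/4 in it.  Hence the heat kernel is a multinomial mixture of products of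
  unimodal one-dimensional kernels.  Unimodality compares a kernel value with its average over a box
  of side \<open>s\<close> nearer to 0, so that the kernel summed over points with disjoint \<open>s\<close>-boxes is at most
  a constant times \<open>s\<^sup>-\<^sup>d\<close> as soon as the time is at least \<open>s\<^sup>2\<close>.  Together with an exponential bound for
  short times and a local lower bound this controls occupation times of the obstacles.

  Hitting probabilities are ratios of occupation times.  Visibility: within time
  \<open>L / (\<alpha> (log L)\<^sup>\<gamma>)\<close> an obstacle is hit with probability bounded below, and there are about
  \<open>(log L)\<^sup>\<gamma>\<close> such periods up to time \<open>L / \<alpha>\<close>.  Density: up to time \<open>T\<close>, a small multiple of
  \<open>D\<^sup>d / l\<^sup>d\<^sup>-\<^sup>2\<close> with \<open>D\<close> the cell size, the starting points in the source set near a box \<open>B\<close> hit it with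
  total probability of order \<open>T l\<^sup>d\<^sup>-\<^sup>2\<close>, while those visiting another obstacle before \<open>B\<close> contribute
  only \<open>O((T l\<^sup>d\<^sup>-\<^sup>2)\<^sup>2 / D\<^sup>d)\<close>.\<close>

section \<open>The one-dimensional lazy kernel and multinomial weights\<close>

text \<open>All times are finite: occupation times up to a horizon replace Green functions, and
  recursions on the first step replace the strong Markov property. The scales fit as follows. Put u
  = (log L)^\<gamma> and h = l^((d-2)/2), so that D^d is about u^10 L h. A box of radius l is hit at
  rate l^(d-2) = h^2 per unit time and unit density of starting points; with one obstacle per volume
  of order D^d, some obstacle is hit at rate h^2 / D^d, about h / (u^10 L). Over a period L / u^11
  this is of order one as soon as h exceeds u^21, which l >= u^100 guarantees. Density asks for D^d
  / u^10 to be of order h L, and exactly this fixes the cell size. The difficulty is that the points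
  in the cells are arbitrary, so kernel sums must be bounded by using separation alone. The
  resulting estimate loses (log D)^d at times between (D / log D)^2 and D^2; this is harmless
  because the horizons are at least D^2 (log D)^d.\<close>

primrec lazy1 :: "nat \<Rightarrow> int \<Rightarrow> real" where
  "lazy1 0 j = of_bool (j = 0)"
| "lazy1 (Suc k) j = lazy1 k (j - 1) / 4 + lazy1 k j / 2 + lazy1 k (j + 1) / 4"

lemma lazy1_nonneg [simp]: "0 \<le> lazy1 k j"
  by (induction k arbitrary: j) auto

lemma lazy1_minus [simp]: "lazy1 k (- j) = lazy1 k j"
proof (induction k arbitrary: j)
  case (Suc k)
  have "lazy1 k (- j - 1) = lazy1 k (j + 1)" "lazy1 k (- j + 1) = lazy1 k (j - 1)"
    using Suc[of "j + 1"] Suc[of "j - 1"] by simp_all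
  thus ?case using Suc[of j] by simp
qed simp

lemma lazy1_abs: "lazy1 k \<bar>j\<bar> = lazy1 k j"
  by (cases "j \<ge> 0") auto

text \<open>Laziness is essential here, as a walk with parity is not unimodal. With p the kernel at
  time k, the critical comparison is at j = 0: symmetry gives p(-1) = p(1), and p(0)/4 + p(1)/2 +
  p(2)/4 is at most p(0)/2 + p(1)/2. For j > 0 the induction hypothesis applies to each of the three
  terms.\<close>

lemma lazy1_step_decreasing: "0 \<le> j \<Longrightarrow> lazy1 k (j + 1) \<le> lazy1 k j"
proof (induction k arbitrary: j)
  case (Suc k)
  have a: "lazy1 k (j + 1) \<le> lazy1 k j" "lazy1 k (j + 1 + 1) \<le> lazy1 k (j + 1)"
    using Suc by (metis, metis Suc.IH Suc.prems add_increasing2 zero_le_one)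
  show ?case
  proof (cases "j = 0")
    case True
    have "lazy1 k (- 1) = lazy1 k 1" by (rule lazy1_minus)
    thus ?thesis using a True by simp
  next
    case False
    hence "lazy1 k (j - 1 + 1) \<le> lazy1 k (j - 1)" using Suc by (intro Suc.IH) auto
    thus ?thesis using a by simp
  qed
qed simp

lemma lazy1_decreasing:
  assumes "\<bar>i\<bar> \<le> \<bar>j\<bar>" shows "lazy1 k j \<le> lazy1 k i"
proof -
  have *: "lazy1 k (a + int n) \<le> lazy1 k a" if "a \<ge> 0" for a n
  proof (induction n)
    case (Suc n)
    have "lazy1 k (a + int n + 1) \<le> lazy1 k (a + int n)"
      using that by (intro lazy1_step_decreasing) auto
    thus ?case using Suc by (simp add: algebra_simps)
  qed simp
  have "lazy1 k (\<bar>i\<bar> + int (nat (\<bar>j\<bar> - \<bar>i\<bar>))) \<le> lazy1 k \<bar>i\<bar>" by (intro *) auto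
  thus ?thesis using assms by (simp add: lazy1_abs)
qed

lemma sum_lazy1_le_1: "finite S \<Longrightarrow> (\<Sum>j\<in>S. lazy1 k j) \<le> 1"
proof (induction k arbitrary: S)
  case 0
  have "(\<Sum>j\<in>S. lazy1 0 j) = (\<Sum>j\<in>S. if j = 0 then 1 else 0)" by (intro sum.cong) auto
  also have "\<dots> \<le> 1" using 0 by (simp add: sum.delta)
  finally show ?case .
next
  case (Suc k)
  have "(\<Sum>j\<in>S. lazy1 k (j - 1)) = (\<Sum>j\<in>(\<lambda>j. j - 1) ` S. lazy1 k j)"
    by (subst sum.reindex) (simp_all only: inj_on_def o_def diff_eq_eq diff_add_cancel add_right_cancel, simp_all)
  also have "\<dots> \<le> 1" by (rule Suc.IH) (rule finite_imageI, rule Suc.prems)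
  finally have 1: "(\<Sum>j\<in>S. lazy1 k (j - 1)) \<le> 1" .
  have "(\<Sum>j\<in>S. lazy1 k (j + 1)) = (\<Sum>j\<in>(\<lambda>j. j + 1) ` S. lazy1 k j)"
    by (subst sum.reindex) (simp_all only: inj_on_def o_def diff_eq_eq diff_add_cancel add_right_cancel, simp_all)
  also have "\<dots> \<le> 1" by (rule Suc.IH) (rule finite_imageI, rule Suc.prems)
  finally have 2: "(\<Sum>j\<in>S. lazy1 k (j + 1)) \<le> 1" .
  show ?case using 1 2 Suc.IH[OF Suc.prems]
    by (simp add: sum.distrib flip: sum_divide_distrib)
qed

section \<open>Two-sided bounds for the one-dimensional kernel\<close>

text \<open>A lazy step is the sum of two independent steps of size 1/2, so \<open>lazy1 k j\<close>
  is binomial(2k, k+j) / 4^k. This is the quotient of neighbouring binomial coefficients, multiplied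
  out so that it holds for every integer j.\<close>

lemma lazy1_ratio:
  "(real k + 1 + of_int j) * lazy1 k (j + 1) = (real k - of_int j) * lazy1 k j"
proof (induction k arbitrary: j)
  case (Suc k)
  have 1: "(real k + of_int j) * lazy1 k j = (real k - of_int j + 1) * lazy1 k (j - 1)"
    using Suc[of "j - 1"] by (simp add: algebra_simps)
  have 2: "(real k + 2 + of_int j) * lazy1 k (j + 2) = (real k - of_int j - 1) * lazy1 k (j + 1)"
    using Suc[of "j + 1"] by (simp add: algebra_simps)
  have eq: "j + 1 + 1 = j + 2" "j + 1 - 1 = j" by auto
  show ?case unfolding lazy1.simps eq using 1 2 Suc[of j]
    by (simp add: algebra_simps add_divide_distrib diff_divide_distrib)
qed (auto simp: of_bool_def)

lemma lazy1_0_Suc: "lazy1 (Suc k) 0 = lazy1 k 0 * (2 * real k + 1) / (2 * real k + 2)"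
proof -
  have "lazy1 k (- 1) = lazy1 k 1" by (rule lazy1_minus)
  hence "lazy1 (Suc k) 0 = lazy1 k 0 / 2 + lazy1 k 1 / 2" by simp
  moreover have "(real k + 1) * lazy1 k 1 = real k * lazy1 k 0"
    using lazy1_ratio[of k 0] by simp
  hence "lazy1 k 1 = real k * lazy1 k 0 / (real k + 1)" by (simp add: field_simps)
  ultimately show ?thesis by (simp add: field_simps)
qed

text \<open>A Wallis-type monotonicity: the left side decreases in k from its value 1 at k = 0,
  since (2k+1)(2k+3) <= (2k+2)^2.\<close>

lemma lazy1_0_upper: "(lazy1 k 0)\<^sup>2 * (2 * real k + 1) \<le> 1"
proof (induction k)
  case (Suc k)
  have "(lazy1 (Suc k) 0)\<^sup>2 * (2 * real (Suc k) + 1) =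
      (lazy1 k 0)\<^sup>2 * (2 * real k + 1) * ((2 * real k + 1) * (2 * real k + 3) / (2 * real k + 2)\<^sup>2)"
    by (simp only: lazy1_0_Suc) (simp add: power_divide power_mult_distrib power2_eq_square algebra_simps)
  also have "\<dots> \<le> 1 * 1"
  proof (intro mult_mono Suc)
    have "0 < (2 * real k + 2)\<^sup>2" by (intro zero_less_power) simp
    thus "(2 * real k + 1) * (2 * real k + 3) / (2 * real k + 2)\<^sup>2 \<le> 1"
      by (subst divide_le_eq_1_pos) (simp_all add: power2_eq_square algebra_simps)
  qed auto
  finally show ?case by simp
qed simp

lemma lazy1_0_lower: "1 \<le> 4 * (real k + 1) * (lazy1 k 0)\<^sup>2"
proof -
  have gen: "4 * K * a\<^sup>2 * (X\<^sup>2 * (K + 1) / (Y\<^sup>2 * K)) = 4 * (K + 1) * (a * X / Y)\<^sup>2"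
    if "Y \<noteq> 0" "K \<noteq> 0" for a K X Y :: real
    using that by (simp add: power_divide power_mult_distrib)
  \<comment> \<open>The matching monotonicity: 4 n p^2, with p the central value at time n,
    increases from its value 1 at n = 1. Hence the shifted index; time 0 is treated separately at
    the end.\<close>
  have "1 \<le> 4 * (real k + 1) * (lazy1 (Suc k) 0)\<^sup>2" for k
  proof (induction k)
    case (Suc k)
    have "0 < (2 * real k + 4)\<^sup>2 * (real k + 1)" by (intro mult_pos_pos zero_less_power) auto
    hence "1 \<le> (2 * real k + 3)\<^sup>2 * (real k + 2) / ((2 * real k + 4)\<^sup>2 * (real k + 1))"
      by (subst le_divide_eq_1_pos) (simp_all add: power2_eq_square algebra_simps)
    hence "1 * 1 \<le> (4 * (real k + 1) * (lazy1 (Suc k) 0)\<^sup>2) *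
        ((2 * real k + 3)\<^sup>2 * (real k + 2) / ((2 * real k + 4)\<^sup>2 * (real k + 1)))"
      by (intro mult_mono Suc) auto
    also have "\<dots> = 4 * (real (Suc k) + 1) * (lazy1 (Suc k) 0 * (2 * real k + 3) / (2 * real k + 4))\<^sup>2"
      using gen[of "2 * real k + 4" "real k + 1" "2 * real k + 3" "lazy1 (Suc k) 0"] by (simp add: algebra_simps del: lazy1.simps)
    also have "lazy1 (Suc k) 0 * (2 * real k + 3) / (2 * real k + 4) = lazy1 (Suc (Suc k)) 0"
      by (simp only: lazy1_0_Suc[of "Suc k"]) (simp add: algebra_simps del: lazy1.simps)
    finally show ?case by simp
  qed (simp add: lazy1_0_Suc power2_eq_square del: lazy1.simps(2))
  moreover have "4 * (real k + 1) * (lazy1 (Suc k) 0)\<^sup>2 \<le> 4 * (real (Suc k) + 1) * (lazy1 (Suc k) 0)\<^sup>2" for k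
    by (intro mult_right_mono) auto
  ultimately show ?thesis by (cases k) (simp, metis order.trans)
qed

lemma lazy1_le: "lazy1 k j \<le> 1 / sqrt (real k + 1)"
proof -
  have "(lazy1 k 0)\<^sup>2 * (real k + 1) \<le> (lazy1 k 0)\<^sup>2 * (2 * real k + 1)"
    by (intro mult_left_mono) auto
  also have "\<dots> \<le> 1" by (rule lazy1_0_upper)
  finally have "(lazy1 k 0 * sqrt (real k + 1))\<^sup>2 \<le> 1" by (simp add: power_mult_distrib)
  hence "lazy1 k 0 * sqrt (real k + 1) \<le> 1" by (simp add: power_le_one_iff abs_square_le_1)
  moreover have "lazy1 k j \<le> lazy1 k 0" by (rule lazy1_decreasing) simp
  ultimately have "lazy1 k j * sqrt (real k + 1) \<le> 1"
    by (meson dual_order.trans mult_right_mono real_sqrt_ge_zero of_nat_0_le_iff add_nonneg_nonneg zero_le_one)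
  thus ?thesis by (simp add: field_simps)
qed

lemma lazy1_ge:
  assumes "4 * j\<^sup>2 \<le> int k" shows "1 / (4 * sqrt (real k + 1)) \<le> lazy1 k j"
proof -
  define J where "J = nat \<bar>j\<bar>"
  have J: "int J = \<bar>j\<bar>" by (simp add: J_def)
  have J2: "4 * J\<^sup>2 \<le> k"
  proof -
    have "int (4 * J\<^sup>2) = 4 * j\<^sup>2" by (simp add: J)
    thus ?thesis using assms by linarith
  qed
  \<comment> \<open>By \<open>lazy1_ratio\<close>, moving from i to i+1 multiplies the kernel by 1 -
    (2i+1)/(k+1+i), which is at least 1 - u for i < J. The J steps together lose at most the
    fraction J u <= 1/2 of the central value.\<close>
  define u where "u = 2 * real J / (real k + 1)"
  have *: "lazy1 k 0 * (1 - real i * u) \<le> lazy1 k (int i)" if "i \<le> J" for i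
    using that
  proof (induction i)
    case (Suc i)
    have JJ: "J \<le> J^2" by (simp add: power2_eq_square)
    have r: "lazy1 k (int (Suc i)) = lazy1 k (int i) * (1 - (2 * real i + 1) / (real k + 1 + real i))"
      using lazy1_ratio[of k "int i"] by (simp add: field_simps)
    have a: "(2 * real i + 1) / (real k + 1 + real i) \<le> u"
      unfolding u_def using Suc.prems by (intro frac_le) auto
    have "u \<ge> 0" by (simp add: u_def)
    hence "lazy1 k (int i) * u \<le> lazy1 k 0 * u"
      by (intro mult_right_mono lazy1_decreasing) auto
    moreover have "lazy1 k (int i) * ((2 * real i + 1) / (real k + 1 + real i)) \<le> lazy1 k (int i) * u"
      by (intro mult_left_mono a) auto
    moreover have "lazy1 k 0 * (1 - real i * u) \<le> lazy1 k (int i)"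
      using Suc by simp
    ultimately show ?case unfolding r by (simp add: ring_distribs)
  qed simp
  have "real J * u \<le> 1 / 2"
  proof -
    have "real (4 * J\<^sup>2) \<le> real k" using J2 by (simp only: of_nat_le_iff)
    thus ?thesis by (simp add: u_def field_simps power2_eq_square)
  qed
  hence "lazy1 k 0 * (1 / 2) \<le> lazy1 k 0 * (1 - real J * u)"
    by (intro mult_left_mono) auto
  also have "\<dots> \<le> lazy1 k (int J)" using *[of J] by simp
  finally have h: "lazy1 k 0 / 2 \<le> lazy1 k j" by (simp add: J lazy1_abs)
  have "1\<^sup>2 \<le> (2 * sqrt (real k + 1) * lazy1 k 0)\<^sup>2"
    using lazy1_0_lower[of k] by (simp only: power_mult_distrib) simp
  hence "1 \<le> 2 * sqrt (real k + 1) * lazy1 k 0"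
    by (rule power2_le_imp_le) simp
  hence "1 / (2 * sqrt (real k + 1)) \<le> lazy1 k 0" by (simp add: field_simps)
  thus ?thesis using h by simp
qed

section \<open>Averages over the numbers of steps in each coordinate\<close>

text \<open>Expectation of \<open>F\<close> when \<open>m i\<close> counts how often coordinate \<open>i\<close> is chosen in \<open>n\<close> independent
  uniform choices.\<close>

primrec mexp :: "nat \<Rightarrow> (('d::finite \<Rightarrow> nat) \<Rightarrow> real) \<Rightarrow> real" where
  "mexp 0 F = F (\<lambda>_. 0)"
| "mexp (Suc n) F = (\<Sum>i\<in>UNIV. mexp n (\<lambda>m. F (m(i := Suc (m i))))) / real CARD('d)"

lemma mexp_mono:
  "(\<And>m. (\<forall>i. m i \<le> n) \<Longrightarrow> F m \<le> G m) \<Longrightarrow> mexp n F \<le> mexp n G"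
proof (induction n arbitrary: F G)
  case (Suc n)
  have "mexp n (\<lambda>m. F (m(i := Suc (m i)))) \<le> mexp n (\<lambda>m. G (m(i := Suc (m i))))" for i
    by (intro Suc.IH Suc.prems) (auto simp: le_SucI)
  thus ?case by (simp add: divide_right_mono sum_mono)
qed simp

lemma mexp_add: "mexp n (\<lambda>m. F m + G m) = mexp n F + mexp n G"
  by (induction n arbitrary: F G) (simp_all add: sum.distrib add_divide_distrib)

lemma mexp_cmult: "mexp n (\<lambda>m. c * F m) = c * mexp n F"
  by (induction n arbitrary: F) (simp_all flip: sum_distrib_left)

lemma mexp_const [simp]: "mexp n (\<lambda>m :: 'd::finite \<Rightarrow> nat. c) = c"
  by (induction n) simp_all

lemma mexp_diff: "mexp n (\<lambda>m. F m - G m) = mexp n F - mexp n G"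
  using mexp_add[of n F "\<lambda>m. (-1) * G m"] by (simp only: mexp_cmult) simp

lemma mexp_sum: "mexp n (\<lambda>m. \<Sum>a\<in>A. F a m) = (\<Sum>a\<in>A. mexp n (F a))"
  by (induction A rule: infinite_finite_induct) (simp_all add: mexp_add)

text \<open>Size biasing: \<open>m i\<close> is a sum of n+1 indicators of probability 1/d each, and
  given that one of them is 1 the remaining n choices are still independent and uniform. It yields
  inverse moments of the counts directly, so that no concentration estimate is needed.\<close>

lemma mexp_size_bias:
  fixes i :: "'d::finite"
  shows "mexp (Suc n) (\<lambda>m. real (m i) * F m) =
    (real n + 1) / real CARD('d) * mexp n (\<lambda>m. F (m(i := Suc (m i))))"
proof (induction n arbitrary: F)
  case 0
  have "(\<Sum>j\<in>UNIV. real (((\<lambda>_. 0)(j := Suc 0)) i) * F ((\<lambda>_. 0)(j := Suc 0))) =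
      (\<Sum>j\<in>{i}. real (((\<lambda>_. 0)(j := Suc 0)) i) * F ((\<lambda>_. 0)(j := Suc 0)))"
    by (intro sum.mono_neutral_right) auto
  thus ?case by (simp add: fun_upd_def)
next
  case (Suc n)
  let ?d = "real CARD('d)"
  have split: "mexp (Suc n) (\<lambda>m. real ((m(j := Suc (m j))) i) * F (m(j := Suc (m j)))) =
     mexp (Suc n) (\<lambda>m. real (m i) * F (m(j := Suc (m j)))) +
     (if j = i then mexp (Suc n) (\<lambda>m. F (m(i := Suc (m i)))) else 0)" for j
  proof (cases "j = i")
    case True
    have "mexp (Suc n) (\<lambda>m. real ((m(j := Suc (m j))) i) * F (m(j := Suc (m j)))) =
      mexp (Suc n) (\<lambda>m. real (m i) * F (m(j := Suc (m j))) + F (m(i := Suc (m i))))"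
      using True by (simp add: algebra_simps del: mexp.simps)
    thus ?thesis unfolding mexp_add using True by simp
  next
    case False
    thus ?thesis by (simp del: mexp.simps)
  qed
  have comm: "(m(i := Suc (m i)))(j := Suc ((m(i := Suc (m i))) j)) =
     (m(j := Suc (m j)))(i := Suc ((m(j := Suc (m j))) i))" for m :: "'d \<Rightarrow> nat" and j
    by (auto simp: fun_eq_iff)
  have "mexp (Suc (Suc n)) (\<lambda>m. real (m i) * F m) =
     (\<Sum>j\<in>UNIV. mexp (Suc n) (\<lambda>m. real ((m(j := Suc (m j))) i) * F (m(j := Suc (m j))))) / ?d"
    by (rule mexp.simps(2))
  also have "\<dots> = (\<Sum>j\<in>UNIV. mexp (Suc n) (\<lambda>m. real (m i) * F (m(j := Suc (m j))))) / ?d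
     + mexp (Suc n) (\<lambda>m. F (m(i := Suc (m i)))) / ?d"
    unfolding split sum.distrib add_divide_distrib by simp
  also have "(\<Sum>j\<in>UNIV. mexp (Suc n) (\<lambda>m. real (m i) * F (m(j := Suc (m j))))) / ?d =
     (real n + 1) / ?d * mexp (Suc n) (\<lambda>m. F (m(i := Suc (m i))))"
    unfolding Suc mexp.simps(2)[of n "\<lambda>m. F (m(i := Suc (m i)))"] comm
    by (simp add: sum_distrib_left)
  finally show ?case by (simp add: field_simps fun_upd_def del: mexp.simps)
qed

text \<open>Size biasing applied to \<open>F m / m i\<close> turns \<open>m i\<close> in the
  denominator into \<open>m i + 1\<close>; as F ignores coordinate i, the extra choice changes
  nothing else. The price is one more choice on the right-hand side.\<close>

lemma mexp_div_Suc_le: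
  fixes i :: "'d::finite"
  assumes F: "\<And>m. F m \<ge> 0" and indep: "\<And>m a. F (m(i := a)) = F m"
  shows "mexp n (\<lambda>m. F m / (real (m i) + 1)) \<le> real CARD('d) / (real n + 1) * mexp (Suc n) F"
proof -
  let ?d = "real CARD('d)"
  have "(real n + 1) / ?d * mexp n (\<lambda>m. F m / (real (m i) + 1)) =
     mexp (Suc n) (\<lambda>m. real (m i) * (F m / real (m i)))"
    unfolding mexp_size_bias[of n i "\<lambda>m. F m / real (m i)"] by (simp add: indep add.commute)
  \<comment> \<open>This is an equality except where \<open>m i = 0\<close>: there division by zero
    gives 0, which is at most \<open>F m\<close>.\<close>
  also have "\<dots> \<le> mexp (Suc n) F"
    by (intro mexp_mono) (auto simp: F)
  finally have "?d / (real n + 1) * ((real n + 1) / ?d * mexp n (\<lambda>m. F m / (real (m i) + 1)))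
      \<le> ?d / (real n + 1) * mexp (Suc n) F"
    by (intro mult_left_mono) auto
  moreover have "?d / (real n + 1) * ((real n + 1) / ?d * x) = x" for x
    by (simp add: add_eq_0_iff_both_eq_0)
  ultimately show ?thesis by simp
qed

text \<open>The product behaves as if every count were about n/d, although the counts are dependent.
  Factors are removed one at a time; each removal passes from n to n+1 choices, which only improves
  the bound of the induction hypothesis.\<close>

lemma mexp_prod_le:
  fixes I :: "'d::finite set"
  assumes "b \<ge> 0"
  shows "mexp n (\<lambda>m. \<Prod>i\<in>I. 1 + b / (real (m i) + 1)) \<le> (1 + b * real CARD('d) / (real n + 1)) ^ card I"
proof -
  have "finite I" by simp
  thus ?thesis
  proof (induction I arbitrary: n rule: finite_induct)
    case (insert i I)
    let ?d = "real CARD('d)"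
    let ?F = "\<lambda>m :: 'd \<Rightarrow> nat. \<Prod>i\<in>I. 1 + b / (real (m i) + 1)"
    have F0: "?F m \<ge> 0" for m using assms by (intro prod_nonneg) auto
    have Fi: "?F (m(i := a)) = ?F m" for m a
      using insert.hyps(2) by (intro prod.cong) auto
    have "mexp n (\<lambda>m. \<Prod>i\<in>insert i I. 1 + b / (real (m i) + 1)) =
       mexp n (\<lambda>m. ?F m + b * (?F m / (real (m i) + 1)))"
      using insert.hyps by (simp add: algebra_simps)
    also have "\<dots> = mexp n ?F + b * mexp n (\<lambda>m. ?F m / (real (m i) + 1))"
      unfolding mexp_add mexp_cmult ..
    also have "\<dots> \<le> (1 + b * ?d / (real n + 1)) ^ card I +
       b * (?d / (real n + 1) * (1 + b * ?d / (real n + 1)) ^ card I)"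
    proof (intro add_mono insert.IH mult_left_mono assms)
      have "mexp n (\<lambda>m. ?F m / (real (m i) + 1)) \<le> ?d / (real n + 1) * mexp (Suc n) ?F"
        by (intro mexp_div_Suc_le F0 Fi)
      also have "\<dots> \<le> ?d / (real n + 1) * (1 + b * ?d / (real (Suc n) + 1)) ^ card I"
        by (intro mult_left_mono insert.IH) auto
      also have "\<dots> \<le> ?d / (real n + 1) * (1 + b * ?d / (real n + 1)) ^ card I"
        using assms by (intro mult_left_mono power_mono add_left_mono divide_left_mono) auto
      finally show "mexp n (\<lambda>m. ?F m / (real (m i) + 1))
         \<le> ?d / (real n + 1) * (1 + b * ?d / (real n + 1)) ^ card I" .
    qed
    also have "\<dots> = (1 + b * ?d / (real n + 1)) ^ card (insert i I)"
      using insert.hyps by (simp add: algebra_simps)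
    finally show ?case .
  qed simp
qed

lemma mexp_inverse_le:
  fixes i :: "'d::finite"
  shows "mexp n (\<lambda>m. 1 / (real (m i) + 1)) \<le> real CARD('d) / (real n + 1)"
  using mexp_div_Suc_le[of "\<lambda>_. 1" i n] by simp

section \<open>Heat kernel bounds on the lattice\<close>

lemma linf_le_iff: "linf v \<le> r \<longleftrightarrow> (\<forall>i. \<bar>v $ i\<bar> \<le> r)"
  unfolding linf_def by (subst Max_le_iff) auto

lemma linf_ge_iff: "r \<le> linf v \<longleftrightarrow> (\<exists>i. r \<le> \<bar>v $ i\<bar>)"
  unfolding linf_def by (subst Max_ge_iff) auto

lemma abs_le_linf: "\<bar>v $ i\<bar> \<le> linf v"
  using linf_le_iff[of v "linf v"] by simp

lemma linf_nonneg [simp]: "0 \<le> linf v"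
  using abs_le_linf[of v undefined] by linarith

lemma linf_minus: "linf (a - b) = linf (b - a)"
  unfolding linf_def by (simp add: abs_minus_commute)

lemma linf_triangle: "linf (a - c) \<le> linf (a - b) + linf (b - c)"
  unfolding linf_le_iff
proof
  fix i
  show "\<bar>(a - c) $ i\<bar> \<le> linf (a - b) + linf (b - c)"
    using abs_le_linf[of "a - b" i] abs_le_linf[of "b - c" i] by simp
qed

definition avg :: "(int ^ 'd \<Rightarrow> real) \<Rightarrow> int ^ 'd \<Rightarrow> real" where
  "avg f x = (\<Sum>i\<in>UNIV. f x / 2 + f (x + axis i 1) / 4 + f (x - axis i 1) / 4) / real CARD('d)"

lemma avg_mono: "(\<And>y. linf (y - x) \<le> 1 \<Longrightarrow> f y \<le> g y) \<Longrightarrow> avg f x \<le> avg g x"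
  unfolding avg_def
  by (intro divide_right_mono sum_mono add_mono) (auto simp: linf_le_iff axis_def)

lemma avg_add: "avg (\<lambda>x. f x + g x) x = avg f x + avg g x"
  by (simp add: avg_def sum.distrib add_divide_distrib)

lemma avg_cmult: "avg (\<lambda>x. c * f x) x = c * avg f x"
  by (simp add: avg_def sum_distrib_left algebra_simps)

lemma avg_const [simp]: "avg (\<lambda>x :: int ^ 'd. c) x = c"
  by (simp add: avg_def)

lemma avg_diff: "avg (\<lambda>x. f x - g x) x = avg f x - avg g x"
  using avg_add[of f "\<lambda>x. (-1) * g x"] by (simp only: avg_cmult) simp

lemma avg_sum: "avg (\<lambda>x. \<Sum>a\<in>A. F a x) x = (\<Sum>a\<in>A. avg (F a) x)"
  by (induction A rule: infinite_finite_induct) (simp_all add: avg_add)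

lemma avg_reflect: "avg (\<lambda>x. f (c - x)) x = avg f (c - x)"
  by (simp add: avg_def algebra_simps sum.distrib)

primrec kern :: "nat \<Rightarrow> int ^ 'd \<Rightarrow> real" where
  "kern 0 = (\<lambda>v. of_bool (v = 0))"
| "kern (Suc n) = avg (kern n)"

lemma kern_nonneg [simp]: "0 \<le> kern n v"
proof (induction n arbitrary: v)
  case (Suc n)
  have "avg (\<lambda>_. 0) v \<le> avg (kern n) v" by (intro avg_mono Suc)
  thus ?case by simp
qed simp

lemma kern_minus [simp]: "kern n (- v) = kern n v"
proof (induction n arbitrary: v)
  case (Suc n)
  have "avg (\<lambda>v. kern n (0 - v)) v = avg (kern n) (0 - v)" by (rule avg_reflect)
  thus ?case using Suc by simp
qed simp

lemma kern_sym: "kern n (x - y) = kern n (y - x)"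
  using kern_minus[of n "x - y"] by simp

lemma avg_kern: "avg (\<lambda>x. kern n (y - x)) x = kern (Suc n) (y - x)"
  by (simp add: avg_reflect)

lemma kern_eq_mexp: "kern n v = mexp n (\<lambda>m. \<Prod>i\<in>UNIV. lazy1 (m i) (v $ i))"
proof (induction n arbitrary: v)
  case 0
  show ?case by (auto simp: vec_eq_iff of_bool_def)
next
  case (Suc n)
  let ?P = "\<lambda>i m v. \<Prod>j\<in>UNIV - {i}. lazy1 (m j) (v $ j)"
  have split: "(\<Prod>j\<in>UNIV. lazy1 (m j) (w $ j)) = lazy1 (m i) (w $ i) * ?P i m w" for i and m w
    by (subst prod.remove[of _ i]) auto
  have P: "?P i m (v + axis i 1) = ?P i m v" "?P i m (v - axis i 1) = ?P i m v"
     "?P i (m(i := a)) v = ?P i m v" for i and m a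
    by (auto intro!: prod.cong simp: axis_def)
  \<comment> \<open>Raising \<open>m i\<close> by one unfolds the recursion of \<open>lazy1\<close>
    in factor i only, while the other factors do not change under shifts along axis i.\<close>
  have "kern n v / 2 + kern n (v + axis i 1) / 4 + kern n (v - axis i 1) / 4 =
     mexp n (\<lambda>m. \<Prod>j\<in>UNIV. lazy1 ((m(i := Suc (m i))) j) (v $ j))" for i
  proof -
    have "mexp n (\<lambda>m. \<Prod>j\<in>UNIV. lazy1 ((m(i := Suc (m i))) j) (v $ j)) =
      mexp n (\<lambda>m. (1/2) * (\<Prod>j\<in>UNIV. lazy1 (m j) (v $ j)) +
         (1/4) * (\<Prod>j\<in>UNIV. lazy1 (m j) ((v + axis i 1) $ j)) +
         (1/4) * (\<Prod>j\<in>UNIV. lazy1 (m j) ((v - axis i 1) $ j)))"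
      unfolding split[of _ _ i] P by (simp add: algebra_simps axis_def)
    also have "\<dots> = (1/2) * kern n v + (1/4) * kern n (v + axis i 1) + (1/4) * kern n (v - axis i 1)"
      unfolding mexp_add mexp_cmult Suc ..
    finally show ?thesis by simp
  qed
  thus ?case by (simp add: avg_def)
qed

lemma prod_sum_vec:
  fixes f :: "'d::finite \<Rightarrow> int \<Rightarrow> real"
  assumes "\<And>i. finite (W i)"
  shows "(\<Prod>i\<in>UNIV. \<Sum>j\<in>W i. f i j) = (\<Sum>v\<in>{v. \<forall>i. v $ i \<in> W i}. \<Prod>i\<in>UNIV. f i (v $ i))"
proof -
  have "(\<Prod>i\<in>UNIV. \<Sum>j\<in>W i. f i j) = (\<Sum>g\<in>PiE UNIV W. \<Prod>i\<in>UNIV. f i (g i))"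
    using assms by (intro prod_sum_PiE) auto
  also have "\<dots> = (\<Sum>v\<in>{v. \<forall>i. v $ i \<in> W i}. \<Prod>i\<in>UNIV. f i (v $ i))"
    by (intro sum.reindex_bij_witness[of _ vec_nth vec_lambda]) auto
  finally show ?thesis .
qed

lemma finite_vec_box:
  fixes W :: "'d::finite \<Rightarrow> int set"
  assumes "\<And>i. finite (W i)"
  shows "finite {v. \<forall>i. v $ i \<in> W i}" and "card {v. \<forall>i. v $ i \<in> W i} = (\<Prod>i\<in>UNIV. card (W i))"
proof -
  have b: "bij_betw vec_nth {v. \<forall>i. v $ i \<in> W i} (PiE UNIV W)"
    by (intro bij_betwI[of _ _ _ vec_lambda]) auto
  have "finite (PiE UNIV W)" using assms by (intro finite_PiE) auto
  thus "finite {v. \<forall>i. v $ i \<in> W i}" using bij_betw_finite[OF b] by simp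
  show "card {v. \<forall>i. v $ i \<in> W i} = (\<Prod>i\<in>UNIV. card (W i))"
    using bij_betw_same_card[OF b] by (simp add: card_PiE)
qed

text \<open>S is enlarged to the product of its coordinate projections, over which the sum
  factorises.\<close>

lemma sum_prod_vec_le:
  fixes f :: "'d::finite \<Rightarrow> int \<Rightarrow> real"
  assumes "finite S" and nonneg: "\<And>i j. 0 \<le> f i j"
    and le: "\<And>i W. finite W \<Longrightarrow> (\<Sum>j\<in>W. f i j) \<le> H i"
  shows "(\<Sum>v\<in>S. \<Prod>i\<in>UNIV. f i (v $ i)) \<le> (\<Prod>i\<in>UNIV. H i)"
proof -
  define W where "W i = (\<lambda>v. v $ i) ` S" for i
  have fin: "finite (W i)" for i using assms by (simp add: W_def)
  have "(\<Sum>v\<in>S. \<Prod>i\<in>UNIV. f i (v $ i)) \<le> (\<Sum>v\<in>{v. \<forall>i. v $ i \<in> W i}. \<Prod>i\<in>UNIV. f i (v $ i))"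
    by (intro sum_mono2 finite_vec_box fin prod_nonneg) (auto simp: W_def nonneg)
  also have "\<dots> = (\<Prod>i\<in>UNIV. \<Sum>j\<in>W i. f i j)" by (rule prod_sum_vec[symmetric, OF fin])
  also have "\<dots> \<le> (\<Prod>i\<in>UNIV. H i)"
    by (intro prod_mono conjI sum_nonneg le fin nonneg)
  finally show ?thesis .
qed

lemma sum_kern_le_1:
  fixes S :: "(int ^ 'd) set"
  assumes "finite S" shows "(\<Sum>v\<in>S. kern n v) \<le> 1"
proof -
  have "(\<Sum>v\<in>S. \<Prod>i\<in>UNIV. lazy1 (m i) (v $ i)) \<le> (\<Prod>i\<in>(UNIV :: 'd set). 1)" for m
    by (rule sum_prod_vec_le[where f = "\<lambda>i. lazy1 (m i)" and H = "\<lambda>_. 1"])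
       (use assms in \<open>auto intro: sum_lazy1_le_1\<close>)
  note pw = this
  have "(\<Sum>v\<in>S. kern n v) = mexp n (\<lambda>m. \<Sum>v\<in>S. \<Prod>i\<in>UNIV. lazy1 (m i) (v $ i))"
    by (simp add: kern_eq_mexp mexp_sum)
  also have "\<dots> \<le> mexp n (\<lambda>_ :: 'd \<Rightarrow> nat. \<Prod>i\<in>(UNIV :: 'd set). 1)"
    by (rule mexp_mono) (rule pw)
  finally show ?thesis by simp
qed

lemma sum_kern_translate_le_1:
  assumes "finite S" shows "(\<Sum>v\<in>S. kern n (v - x)) \<le> 1"
proof -
  have "(\<Sum>v\<in>S. kern n (v - x)) = (\<Sum>v\<in>(\<lambda>v. v - x) ` S. kern n v)"
    by (subst sum.reindex) (auto simp: inj_on_def)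
  thus ?thesis using sum_kern_le_1 assms by (metis finite_imageI)
qed

lemma kern_eq_0: "int n < linf v \<Longrightarrow> kern n v = 0"
proof (induction n arbitrary: v)
  case 0
  thus ?case by (auto simp: linf_def)
next
  case (Suc n)
  have "kern n y = 0" if "linf (y - v) \<le> 1" for y
  proof (rule Suc.IH)
    have "linf v \<le> linf (v - y) + linf y" using linf_triangle[of v 0 y] by simp
    thus "int n < linf y" using that Suc.prems linf_minus[of v y] by simp
  qed
  hence "avg (kern n) v \<le> avg (\<lambda>_. 0) v" by (intro avg_mono) simp
  thus ?case using kern_nonneg[of "Suc n" v] by simp
qed

section \<open>Exponential upper bound and local lower bound for the kernel\<close>

text \<open>The left side is the moment generating function of a one-dimensional lazy step. The
  bound on exp(-t) comes from (1+t)(1-t+t^2) = 1 + t^3 >= 1.\<close>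

lemma exp_plus_exp_minus_le:
  fixes t :: real assumes "0 \<le> t" "t \<le> 1"
  shows "1 / 2 + exp t / 4 + exp (- t) / 4 \<le> exp (t\<^sup>2)"
proof -
  have "exp t \<le> 1 + t + t\<^sup>2" using assms by (intro exp_bound)
  moreover have "exp (- t) \<le> 1 - t + t\<^sup>2"
  proof -
    have "1 \<le> exp t * (1 - t + t\<^sup>2)"
    proof -
      have "1 + 0 \<le> (1 + t) * (1 - t + t\<^sup>2)"
        using assms by (simp add: algebra_simps power2_eq_square)
      also have "\<dots> \<le> exp t * (1 - t + t\<^sup>2)"
        using assms by (intro mult_right_mono exp_ge_add_one_self) auto
      finally show ?thesis by simp
    qed
    thus ?thesis by (simp add: exp_minus field_simps)
  qed
  moreover have "1 + t\<^sup>2 \<le> exp (t\<^sup>2)" by (rule exp_ge_add_one_self)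
  moreover have "t\<^sup>2 \<ge> 0" by simp
  ultimately show ?thesis by argo
qed

text \<open>A Chernoff bound in differential form: the right side is a supersolution of the
  recursion for \<open>kern\<close>. Averaging along axis j multiplies it by at most exp(t^2), and
  along any other axis it is constant.\<close>

lemma kern_exp_le_aux:
  assumes "0 \<le> t" "t \<le> 1"
  shows "kern n v \<le> exp (real n * t\<^sup>2) * exp (- t * of_int (v $ j))"
proof (induction n arbitrary: v)
  case 0
  show ?case by simp
next
  case (Suc n)
  let ?E = "exp (real n * t\<^sup>2) * exp (- t * of_int (v $ j))"
  have "kern n v / 2 + kern n (v + axis i 1) / 4 + kern n (v - axis i 1) / 4 \<le> exp (t\<^sup>2) * ?E" for i
  proof (cases "i = j")
    case True
    have "kern n (v + axis i 1) \<le> ?E * exp (- t)"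
      using Suc[of "v + axis i 1"] True by (simp add: axis_def algebra_simps flip: exp_add)
    moreover have "kern n (v - axis i 1) \<le> ?E * exp t"
      using Suc[of "v - axis i 1"] True by (simp add: axis_def algebra_simps flip: exp_add)
    ultimately have "kern n v / 2 + kern n (v + axis i 1) / 4 + kern n (v - axis i 1) / 4 \<le>
        ?E / 2 + ?E * exp (- t) / 4 + ?E * exp t / 4"
      using Suc[of v] by (intro add_mono divide_right_mono) auto
    also have "\<dots> = ?E * (1 / 2 + exp t / 4 + exp (- t) / 4)" by (simp add: algebra_simps)
    also have "\<dots> \<le> ?E * exp (t\<^sup>2)"
      using exp_plus_exp_minus_le[OF assms] by (intro mult_left_mono) auto
    finally show ?thesis by (simp only: mult.commute)
  next
    case False
    have "kern n (v + axis i 1) \<le> ?E" "kern n (v - axis i 1) \<le> ?E" "kern n v \<le> ?E"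
      using Suc[of "v + axis i 1"] Suc[of "v - axis i 1"] Suc[of v] False by (simp_all add: axis_def)
    hence "kern n v / 2 + kern n (v + axis i 1) / 4 + kern n (v - axis i 1) / 4 \<le> 1 * ?E" by simp
    also have "\<dots> \<le> exp (t\<^sup>2) * ?E" by (intro mult_right_mono) auto
    finally show ?thesis .
  qed
  hence "kern (Suc n) v \<le> (\<Sum>i\<in>(UNIV::'a set). exp (t\<^sup>2) * ?E) / real CARD('a)"
    by (simp only: kern.simps avg_def) (intro divide_right_mono sum_mono, auto)
  also have "\<dots> = exp (real (Suc n) * t\<^sup>2) * exp (- t * of_int (v $ j))"
    by (simp add: algebra_simps flip: exp_add)
  finally show ?case .
qed

lemma kern_exp_le:
  assumes "0 \<le> t" "t \<le> 1"
  shows "kern n v \<le> exp (real n * t\<^sup>2 - t * of_int (linf v))"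
proof -
  obtain j where "linf v \<le> \<bar>v $ j\<bar>" using linf_ge_iff[of "linf v" v] by auto
  hence j: "linf v = \<bar>v $ j\<bar>" using abs_le_linf[of v j] by simp
  show ?thesis
    using kern_exp_le_aux[OF assms, of n v j] kern_exp_le_aux[OF assms, of n "- v" j]
    by (cases "v $ j \<ge> 0") (simp_all add: j algebra_simps flip: exp_add)
qed

text \<open>If every coordinate receives at least a fixed fraction of the n steps,
  \<open>lazy1_ge\<close> bounds each factor from below. This fails with probability at most 1/2 by
  Markov's inequality for the inverse counts: the indicator of the good counts is at least 1 minus
  the sum of b / (m i + 1).\<close>

lemma kern_ge:
  fixes v :: "int ^ 'd"
  assumes v: "16 * (real CARD('d))\<^sup>2 * (of_int (linf v))\<^sup>2 \<le> real n"
  shows "1 / 2 * (1 / (4 * sqrt (real n + 1))) ^ CARD('d) \<le> kern n v"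
proof -
  let ?d = "real CARD('d)" and ?K = "1 / (4 * sqrt (real n + 1))"
  \<comment> \<open>Chosen so that the d inverse moments, each at most d / (n+1), contribute d * b *
    d / (n+1) = 1/2 in total.\<close>
  define b where "b = (real n + 1) / (2 * ?d\<^sup>2)"
  have d: "?d \<ge> 1" by (simp add: Suc_leI)
  have b0: "b > 0" by (simp add: b_def)
  have "?K ^ CARD('d) * (1 - (\<Sum>i\<in>UNIV. b * (1 / (real (m i) + 1)))) \<le> (\<Prod>i\<in>UNIV. lazy1 (m i) (v $ i))"
    if m: "\<forall>i. m i \<le> n" for m
  proof (cases "\<forall>i. b \<le> real (m i) + 1")
    case True
    have "?K \<le> lazy1 (m i) (v $ i)" for i
    proof -
      have "4 * (v $ i)\<^sup>2 \<le> int (m i)"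
      proof (cases "v $ i = 0")
        case False
        have "(real_of_int \<bar>v $ i\<bar>)\<^sup>2 \<le> (of_int (linf v))\<^sup>2"
          using abs_le_linf[of v i] by (intro power_mono) auto
        hence "16 * ?d\<^sup>2 * (of_int (v $ i))\<^sup>2 \<le> 16 * ?d\<^sup>2 * (of_int (linf v))\<^sup>2"
          by (intro mult_left_mono) auto
        hence "16 * ?d\<^sup>2 * (of_int (v $ i))\<^sup>2 \<le> real n + 1" using v by linarith
        hence "8 * (of_int (v $ i))\<^sup>2 \<le> b"
          by (simp add: b_def field_simps)
        hence "8 * (real_of_int (v $ i))\<^sup>2 \<le> real (m i) + 1" using True order_trans by blast
        hence "real_of_int (8 * (v $ i)\<^sup>2) \<le> real_of_int (int (m i) + 1)" by simp
        hence "8 * (v $ i)\<^sup>2 \<le> int (m i) + 1" by (simp only: of_int_le_iff)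
        moreover have "1 \<le> (v $ i)\<^sup>2" using False by (metis linorder_not_less power2_less_eq_zero_iff int_one_le_iff_zero_less)
        ultimately show ?thesis by linarith
      qed simp
      hence "1 / (4 * sqrt (real (m i) + 1)) \<le> lazy1 (m i) (v $ i)" by (rule lazy1_ge)
      moreover have "?K \<le> 1 / (4 * sqrt (real (m i) + 1))"
        using m by (intro divide_left_mono mult_left_mono real_sqrt_le_mono) auto
      ultimately show ?thesis by linarith
    qed
    hence "(\<Prod>i\<in>(UNIV::'d set). ?K) \<le> (\<Prod>i\<in>UNIV. lazy1 (m i) (v $ i))"
      by (intro prod_mono) auto
    moreover have "?K ^ CARD('d) * (1 - (\<Sum>i\<in>UNIV. b * (1 / (real (m i) + 1)))) \<le> ?K ^ CARD('d) * 1"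
      using b0 by (intro mult_left_mono) (auto intro!: sum_nonneg)
    ultimately show ?thesis by (simp only: prod_constant mult_1_right)
  next
    case False
    then obtain i where i: "real (m i) + 1 < b" by (auto simp: not_le)
    hence "1 \<le> b * (1 / (real (m i) + 1))" by (simp add: field_simps)
    also have "\<dots> \<le> (\<Sum>i\<in>UNIV. b * (1 / (real (m i) + 1)))"
      using b0 by (intro member_le_sum) auto
    finally have "?K ^ CARD('d) * (1 - (\<Sum>i\<in>UNIV. b * (1 / (real (m i) + 1)))) \<le> 0"
      by (intro mult_nonneg_nonpos) auto
    also have "0 \<le> (\<Prod>i\<in>UNIV. lazy1 (m i) (v $ i))" by (intro prod_nonneg) auto
    finally show ?thesis .
  qed
  hence "mexp n (\<lambda>m :: 'd \<Rightarrow> nat. ?K ^ CARD('d) * (1 - (\<Sum>i\<in>UNIV. b * (1 / (real (m i) + 1))))) \<le> kern n v"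
    unfolding kern_eq_mexp by (intro mexp_mono)
  moreover have "mexp n (\<lambda>m :: 'd \<Rightarrow> nat. ?K ^ CARD('d) * (1 - (\<Sum>i\<in>UNIV. b * (1 / (real (m i) + 1))))) =
      ?K ^ CARD('d) * (1 - (\<Sum>i\<in>(UNIV::'d set). b * mexp n (\<lambda>m. 1 / (real (m i) + 1))))"
    unfolding mexp_cmult mexp_diff mexp_sum mexp_const ..
  moreover have "?K ^ CARD('d) * (1 / 2) \<le>
      ?K ^ CARD('d) * (1 - (\<Sum>i\<in>(UNIV::'d set). b * mexp n (\<lambda>m. 1 / (real (m i) + 1))))"
  proof -
    have "(\<Sum>i\<in>(UNIV::'d set). b * mexp n (\<lambda>m. 1 / (real (m i) + 1))) \<le>
       (\<Sum>i\<in>(UNIV::'d set). b * (?d / (real n + 1)))"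
      using b0 by (intro sum_mono mult_left_mono mexp_inverse_le) auto
    also have "\<dots> = 1 / 2"
    proof -
      have "D * (N / (2 * D\<^sup>2) * (D / N)) = 1 / 2" if "N > 0" "D > 0" for N D :: real
        using that by (simp add: power2_eq_square)
      from this[of "real n + 1" ?d] show ?thesis by (simp add: b_def)
    qed
    finally show ?thesis by (intro mult_left_mono) auto
  qed
  ultimately show ?thesis by linarith
qed

section \<open>The kernel summed over separated points\<close>

text \<open>A coordinate at distance at least \<open>s\<close> from 0 is compared with its \<open>s\<close> neighbours closer
  to 0 (unimodality), a smaller one with the maximum of the kernel.\<close>

lemma lazy1_le_local_average:
  assumes "s \<ge> 1"
  shows "lazy1 k j \<le> (\<Sum>i\<in>{j - int s..j + int s}.
    lazy1 k i + (if \<bar>i\<bar> \<le> 2 * int s then 1 / sqrt (real k + 1) else 0)) / real s"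
    (is "_ \<le> (\<Sum>i\<in>_. ?h i) / _")
proof -
  have h0: "?h i \<ge> 0" for i by simp
  obtain A where A: "A \<subseteq> {j - int s..j + int s}" "card A \<ge> s" "\<And>i. i \<in> A \<Longrightarrow> lazy1 k j \<le> ?h i"
  proof (cases "\<bar>j\<bar> < int s")
    case True
    show ?thesis
    proof (rule that[of "{j - int s..j + int s}"])
      fix i assume "i \<in> {j - int s..j + int s}"
      hence "\<bar>i\<bar> \<le> 2 * int s" using True by auto
      moreover have "0 \<le> lazy1 k i" by simp
      ultimately show "lazy1 k j \<le> ?h i" using lazy1_le[of k j] by (simp only: if_True)
    qed auto
  next
    case False
    show ?thesis
    proof (rule that[of "if j \<ge> 0 then {j - int s<..j} else {j..<j + int s}"])
      fix i assume "i \<in> (if j \<ge> 0 then {j - int s<..j} else {j..<j + int s})"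
      hence "\<bar>i\<bar> \<le> \<bar>j\<bar>" using False by (auto split: if_splits)
      hence "lazy1 k j \<le> lazy1 k i" by (rule lazy1_decreasing)
      moreover have "0 \<le> 1 / sqrt (real k + 1)" by simp
      ultimately show "lazy1 k j \<le> ?h i" by (smt (verit))
    qed auto
  qed
  have "real s * lazy1 k j \<le> real (card A) * lazy1 k j"
    using A(2) by (intro mult_right_mono) auto
  also have "\<dots> = (\<Sum>i\<in>A. lazy1 k j)" by simp
  also have "\<dots> \<le> (\<Sum>i\<in>A. ?h i)" by (intro sum_mono A)
  also have "\<dots> \<le> (\<Sum>i\<in>{j - int s..j + int s}. ?h i)"
    by (intro sum_mono2 A h0) auto
  finally show ?thesis using assms by (simp add: field_simps)
qed

text \<open>Replacing each one-dimensional factor by its local average turns the term of y into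
  s^(-d) times a sum over the box of radius s around y. These boxes are disjoint by separation, so
  their sums together are at most the total mass of the product of the functions
  \<open>h m i\<close>. This mass is bounded, after averaging over m, because s^2 <= n + 1.\<close>

lemma sum_kern_separated_aux:
  fixes Y :: "(int ^ 'd) set"
  assumes Y: "finite Y" "\<And>y y'. y \<in> Y \<Longrightarrow> y' \<in> Y \<Longrightarrow> y \<noteq> y' \<Longrightarrow> 2 * int s < linf (y - y')"
    and s: "s \<ge> 1" "s\<^sup>2 \<le> n + 1"
  shows "(\<Sum>y\<in>Y. kern n y) \<le> ((2 + 14 * real CARD('d)) / real s) ^ CARD('d)"
proof -
  let ?d = "real CARD('d)"
  define h where "h m i j = lazy1 (m i) j + (if \<bar>j\<bar> \<le> 2 * int s then 1 / sqrt (real (m i) + 1) else 0)"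
    for m :: "'d \<Rightarrow> nat" and i j
  define bx where "bx y = {w. \<forall>i. w $ i \<in> {y $ i - int s..y $ i + int s}}" for y :: "int ^ 'd"
  have h0: "h m i j \<ge> 0" for m i j by (simp add: h_def)
  have fin: "finite (bx y)" for y unfolding bx_def by (rule finite_vec_box) auto
  have disj: "bx y \<inter> bx y' = {}" if "y \<in> Y" "y' \<in> Y" "y \<noteq> y'" for y y'
  proof (rule ccontr)
    assume "bx y \<inter> bx y' \<noteq> {}"
    then obtain w where w: "w \<in> bx y" "w \<in> bx y'" by auto
    have "linf (y - w) \<le> int s" "linf (w - y') \<le> int s"
      using w by (auto simp: linf_le_iff bx_def abs_le_iff algebra_simps)
    thus False using linf_triangle[of y y' w] Y(2)[OF that] by linarith
  qed
  have pw: "(\<Sum>y\<in>Y. \<Prod>i\<in>UNIV. lazy1 (m i) (y $ i)) \<le>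
      (2 / real s) ^ CARD('d) * (\<Prod>i\<in>UNIV. 1 + 7 * (real s)\<^sup>2 / (real (m i) + 1))" for m
  proof -
    have "(\<Sum>y\<in>Y. \<Prod>i\<in>UNIV. lazy1 (m i) (y $ i)) \<le>
       (\<Sum>y\<in>Y. \<Prod>i\<in>UNIV. (1 / real s) * (\<Sum>j\<in>{y $ i - int s..y $ i + int s}. h m i j))"
      using lazy1_le_local_average[OF s(1)] by (intro sum_mono prod_mono) (auto simp: h_def)
    also have "\<dots> = (1 / real s) ^ CARD('d) * (\<Sum>y\<in>Y. \<Sum>w\<in>bx y. \<Prod>i\<in>UNIV. h m i (w $ i))"
      unfolding bx_def by (subst prod_sum_vec[symmetric]) (simp_all add: prod.distrib sum_distrib_left power_one_over prod_dividef flip: sum_divide_distrib)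
    also have "(\<Sum>y\<in>Y. \<Sum>w\<in>bx y. \<Prod>i\<in>UNIV. h m i (w $ i)) = (\<Sum>w\<in>(\<Union>y\<in>Y. bx y). \<Prod>i\<in>UNIV. h m i (w $ i))"
      using disj fin Y(1) by (intro sum.UNION_disjoint[symmetric]) auto
    also have "\<dots> \<le> (\<Prod>i\<in>UNIV. 1 + (4 * real s + 1) / sqrt (real (m i) + 1))"
    proof (intro sum_prod_vec_le h0)
      show "finite (\<Union>y\<in>Y. bx y)" using Y fin by auto
      fix i and W :: "int set" assume W: "finite W"
      let ?c = "1 / sqrt (real (m i) + 1)"
      have "(\<Sum>j\<in>W. if \<bar>j\<bar> \<le> 2 * int s then ?c else 0) = (\<Sum>j\<in>W \<inter> {j. \<bar>j\<bar> \<le> 2 * int s}. ?c)"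
        using W by (subst sum.inter_restrict) simp_all
      also have "\<dots> \<le> (\<Sum>j\<in>{- (2 * int s)..2 * int s}. ?c)"
        by (intro sum_mono2) auto
      also have "\<dots> = (4 * real s + 1) / sqrt (real (m i) + 1)" by (simp add: nat_add_distrib)
      finally show "(\<Sum>j\<in>W. h m i j) \<le> 1 + (4 * real s + 1) / sqrt (real (m i) + 1)"
        using sum_lazy1_le_1[OF W, of "m i"] by (simp add: h_def sum.distrib)
    qed
    also have "(\<Prod>i\<in>UNIV. 1 + (4 * real s + 1) / sqrt (real (m i) + 1)) \<le>
       (\<Prod>i\<in>UNIV. 2 * (1 + 7 * (real s)\<^sup>2 / (real (m i) + 1)))"
    proof (intro prod_mono conjI)
      fix i
      define a where "a = real s / sqrt (real (m i) + 1)"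
      have a2: "7 * (real s)\<^sup>2 / (real (m i) + 1) = 7 * a\<^sup>2" by (simp add: a_def power_divide)
      have "1 + (4 * real s + 1) / sqrt (real (m i) + 1) \<le> 1 + 5 * a"
        unfolding a_def using s(1) by (simp add: divide_right_mono)
      \<comment> \<open>Trades the inverse square root of the count, linear in a, for the inverse
        count, which \<open>mexp_prod_le\<close> can average. The difference of the two sides is
        (3a-1)^2 + 5a^2 + a.\<close>
      also have "1 + 5 * a \<le> 2 * (1 + 7 * a\<^sup>2)"
      proof -
        have "0 \<le> (3 * a - 1)\<^sup>2 + 5 * a\<^sup>2 + a" by (intro add_nonneg_nonneg) (auto simp: a_def)
        thus ?thesis by (simp add: power2_eq_square algebra_simps)
      qed
      finally show "1 + (4 * real s + 1) / sqrt (real (m i) + 1) \<le> 2 * (1 + 7 * (real s)\<^sup>2 / (real (m i) + 1))"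
        by (simp only: a2)
    qed auto
    also have "\<dots> = 2 ^ CARD('d) * (\<Prod>i\<in>UNIV. 1 + 7 * (real s)\<^sup>2 / (real (m i) + 1))"
      by (simp only: prod.distrib prod_constant)
    finally have "(\<Sum>y\<in>Y. \<Prod>i\<in>UNIV. lazy1 (m i) (y $ i)) \<le>
       (1 / real s) ^ CARD('d) * (2 ^ CARD('d) * (\<Prod>i\<in>UNIV. 1 + 7 * (real s)\<^sup>2 / (real (m i) + 1)))"
      by (simp add: mult_left_mono)
    thus ?thesis by (simp add: power_divide)
  qed
  have "(\<Sum>y\<in>Y. kern n y) = mexp n (\<lambda>m. \<Sum>y\<in>Y. \<Prod>i\<in>UNIV. lazy1 (m i) (y $ i))"
    by (simp add: kern_eq_mexp mexp_sum)
  also have "\<dots> \<le> mexp n (\<lambda>m :: 'd \<Rightarrow> nat. (2 / real s) ^ CARD('d) * (\<Prod>i\<in>UNIV. 1 + 7 * (real s)\<^sup>2 / (real (m i) + 1)))"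
    by (intro mexp_mono pw)
  also have "\<dots> \<le> (2 / real s) ^ CARD('d) * (1 + 7 * (real s)\<^sup>2 * ?d / (real n + 1)) ^ CARD('d)"
    unfolding mexp_cmult by (intro mult_left_mono mexp_prod_le[where I = UNIV]) auto
  also have "\<dots> \<le> (2 / real s) ^ CARD('d) * (1 + 7 * ?d) ^ CARD('d)"
  proof (intro mult_left_mono power_mono)
    have "(real s)\<^sup>2 \<le> real n + 1" using s(2) by (metis of_nat_1 of_nat_add of_nat_le_iff of_nat_power)
    hence "7 * ?d * (real s)\<^sup>2 \<le> 7 * ?d * (real n + 1)" by (intro mult_left_mono) auto
    hence "7 * (real s)\<^sup>2 * ?d / (real n + 1) \<le> 7 * ?d"
      by (simp add: pos_divide_le_eq mult_ac)
    thus "1 + 7 * (real s)\<^sup>2 * ?d / (real n + 1) \<le> 1 + 7 * ?d" by simp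
  qed auto
  also have "\<dots> = ((2 + 14 * ?d) / real s) ^ CARD('d)"
    by (simp add: power_mult_distrib[symmetric] field_simps)
  finally show ?thesis .
qed

lemma sum_kern_separated:
  fixes Y :: "(int ^ 'd) set"
  assumes Y: "finite Y" "\<And>y y'. y \<in> Y \<Longrightarrow> y' \<in> Y \<Longrightarrow> y \<noteq> y' \<Longrightarrow> 2 * int s < linf (y - y')"
    and s: "s \<ge> 1" "s\<^sup>2 \<le> n + 1"
  shows "(\<Sum>y\<in>Y. kern n (y - x)) \<le> ((2 + 14 * real CARD('d)) / real s) ^ CARD('d)"
proof -
  have "(\<Sum>y\<in>Y. kern n (y - x)) = (\<Sum>y\<in>(\<lambda>y. y - x) ` Y. kern n y)"
    by (subst sum.reindex) (auto simp: inj_on_def)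
  also have "\<dots> \<le> ((2 + 14 * real CARD('d)) / real s) ^ CARD('d)"
    using Y by (intro sum_kern_separated_aux s) auto
  finally show ?thesis .
qed

lemma floor_sqrt_bounds:
  assumes "n \<ge> 1"
  shows "nat \<lfloor>sqrt (real n)\<rfloor> \<ge> 1" "(nat \<lfloor>sqrt (real n)\<rfloor>)\<^sup>2 \<le> n" "sqrt (real n) \<le> 2 * real (nat \<lfloor>sqrt (real n)\<rfloor>)"
proof -
  let ?s = "nat \<lfloor>sqrt (real n)\<rfloor>"
  have 1: "1 \<le> sqrt (real n)" using assms by simp
  thus a: "?s \<ge> 1" by (simp add: le_nat_iff le_floor_iff)
  have "real ?s \<le> sqrt (real n)" using 1 by (simp add: of_nat_floor)
  hence "(real ?s)\<^sup>2 \<le> real n" by (metis of_nat_0_le_iff power_mono real_sqrt_pow2)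
  thus "?s\<^sup>2 \<le> n" by (metis of_nat_le_iff of_nat_power)
  have "sqrt (real n) < real ?s + 1" using 1 by linarith
  thus "sqrt (real n) \<le> 2 * real ?s" using a by linarith
qed

text \<open>A single point is vacuously separated at the scale s = floor(sqrt(n+1)).\<close>

lemma kern_le: "kern n (v :: int ^ 'd) \<le> ((4 + 28 * real CARD('d)) / sqrt (real n + 1)) ^ CARD('d)"
proof -
  let ?s = "nat \<lfloor>sqrt (real (n + 1))\<rfloor>"
  note s = floor_sqrt_bounds[of "n + 1"]
  have "(\<Sum>y\<in>{v}. kern n (y - 0)) \<le> ((2 + 14 * real CARD('d)) / real ?s) ^ CARD('d)"
    using s by (intro sum_kern_separated) auto
  also have "\<dots> \<le> ((4 + 28 * real CARD('d)) / sqrt (real n + 1)) ^ CARD('d)"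
  proof (intro power_mono)
    have "(2 + 14 * real CARD('d)) / real ?s = (2 * (2 + 14 * real CARD('d))) / (2 * real ?s)"
      by (rule mult_divide_mult_cancel_left[symmetric]) simp
    also have "\<dots> = (4 + 28 * real CARD('d)) / (2 * real ?s)" by simp
    also have "\<dots> \<le> (4 + 28 * real CARD('d)) / sqrt (real n + 1)"
      using s by (intro divide_left_mono mult_pos_pos) (auto simp: add.commute)
    finally show "(2 + 14 * real CARD('d)) / real ?s \<le> (4 + 28 * real CARD('d)) / sqrt (real n + 1)" .
  qed auto
  finally show ?thesis by simp
qed

section \<open>Hitting probabilities up to a finite horizon\<close>

text \<open>Recursion on the first step lets inductions on the horizon play the role of the strong
  Markov property. \<open>measure_walk_law_hit\<close> and \<open>measure_walk_law_first_hit\<close>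
  identify this function and the next with probabilities under \<open>walk_law\<close>.\<close>

primrec hit :: "(int ^ 'd) set \<Rightarrow> nat \<Rightarrow> int ^ 'd \<Rightarrow> real" where
  "hit A 0 = (\<lambda>x. of_bool (x \<in> A))"
| "hit A (Suc n) = (\<lambda>x. if x \<in> A then 1 else avg (hit A n) x)"

primrec first_hit :: "(int ^ 'd) set \<Rightarrow> (int ^ 'd) set \<Rightarrow> nat \<Rightarrow> int ^ 'd \<Rightarrow> real" where
  "first_hit U B 0 = (\<lambda>x. of_bool (x \<in> U \<and> x \<in> B))"
| "first_hit U B (Suc n) = (\<lambda>x. if x \<in> U then of_bool (x \<in> B) else avg (first_hit U B n) x)"

text \<open>The Green function with a finite horizon: the expected number of visits to A at times 0
  to T. It is never expressed through \<open>walk_law\<close>; only the recursion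
  \<open>occ_Suc\<close>, parallel to that of \<open>hit\<close>, connects it with hitting
  probabilities.\<close>

definition occ :: "(int ^ 'd) set \<Rightarrow> nat \<Rightarrow> int ^ 'd \<Rightarrow> real" where
  "occ A T x = (\<Sum>n<Suc T. \<Sum>y\<in>A. kern n (y - x))"

lemma occ_nonneg [simp]: "0 \<le> occ A T x"
  unfolding occ_def by (intro sum_nonneg) auto

lemma occ_mono: "s \<le> t \<Longrightarrow> occ A s x \<le> occ A t x"
  unfolding occ_def by (intro sum_mono2 sum_nonneg) auto

lemma occ_0: "finite A \<Longrightarrow> occ A 0 x = of_bool (x \<in> A)"
proof -
  assume A: "finite A"
  have "(\<Sum>y\<in>A. of_bool (y = x)) = (\<Sum>y\<in>A. if y = x then 1 else (0::real))"
    by (intro sum.cong) auto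
  thus "occ A 0 x = of_bool (x \<in> A)" using A by (simp add: occ_def)
qed

lemma occ_Suc: "finite A \<Longrightarrow> occ A (Suc T) x = of_bool (x \<in> A) + avg (occ A T) x"
proof -
  assume A: "finite A"
  have "avg (occ A T) x = (\<Sum>n<Suc T. \<Sum>y\<in>A. kern (Suc n) (y - x))"
    unfolding occ_def by (simp only: avg_sum avg_kern)
  thus "occ A (Suc T) x = of_bool (x \<in> A) + avg (occ A T) x"
    using occ_0[OF A, of x]
    by (simp only: occ_def sum.lessThan_Suc_shift[of _ "Suc T"]) simp
qed

lemma hit_bounds: "0 \<le> hit A n x" "hit A n x \<le> 1"
proof -
  have "0 \<le> hit A n x \<and> hit A n x \<le> 1"
  proof (induction n arbitrary: x)
    case (Suc n)
    have "avg (\<lambda>_. 0) x \<le> avg (hit A n) x" "avg (hit A n) x \<le> avg (\<lambda>_. 1) x"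
      by (intro avg_mono; use Suc in blast)+
    thus ?case by auto
  qed auto
  thus "0 \<le> hit A n x" "hit A n x \<le> 1" by auto
qed

lemma hit_eq_1: "x \<in> A \<Longrightarrow> hit A n x = 1"
  by (cases n) auto

lemma hit_mono_time: "m \<le> n \<Longrightarrow> hit A m x \<le> hit A n x"
proof (induction m arbitrary: n x)
  case 0
  show ?case using hit_bounds(1)[of A n x] by (auto simp: hit_eq_1 of_bool_def)
next
  case (Suc m)
  then obtain k where k: "n = Suc k" "m \<le> k" by (cases n) auto
  have "avg (hit A m) x \<le> avg (hit A k) x" using k by (intro avg_mono Suc.IH) auto
  thus ?case by (simp add: k)
qed

lemma hit_mono_set: "A \<subseteq> A' \<Longrightarrow> hit A n x \<le> hit A' n x"
proof (induction n arbitrary: x)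
  case (Suc n)
  have "avg (hit A n) x \<le> avg (hit A' n) x" using Suc by (intro avg_mono) auto
  moreover have "avg (hit A n) x \<le> avg (\<lambda>_. 1) x" by (intro avg_mono hit_bounds)
  ultimately show ?case using Suc.prems by auto
qed auto

text \<open>From its first visit to A, at a time at most T, the walk makes at least m expected
  visits during the S steps that follow. Hence the horizon T + S on the right.\<close>

lemma hit_le_occ:
  assumes A: "finite A" and m: "\<And>z. z \<in> A \<Longrightarrow> m \<le> occ A S z"
  shows "m * hit A T x \<le> occ A (T + S) x"
proof (induction T arbitrary: x)
  case 0
  show ?case using m[of x] by (auto simp: of_bool_def)
next
  case (Suc T)
  show ?case
  proof (cases "x \<in> A")
    case True
    have "m \<le> occ A S x" by (rule m[OF True])
    also have "\<dots> \<le> occ A (Suc T + S) x" by (intro occ_mono) auto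
    finally show ?thesis using True by simp
  next
    case False
    have "m * avg (hit A T) x = avg (\<lambda>x. m * hit A T x) x" by (simp add: avg_cmult)
    also have "\<dots> \<le> avg (occ A (T + S)) x" by (intro avg_mono Suc)
    finally show ?thesis using False by (simp add: occ_Suc[OF A])
  qed
qed

text \<open>The converse estimate: all visits come after the first one, and from there at most M are
  expected.\<close>

lemma occ_le_hit:
  assumes A: "finite A" and M: "\<And>z. z \<in> A \<Longrightarrow> occ A T z \<le> M"
  shows "t \<le> T \<Longrightarrow> occ A t x \<le> M * hit A t x"
proof (induction t arbitrary: x)
  case 0
  show ?case using M[of x] occ_mono[of 0 T A x] by (auto simp: of_bool_def occ_0[OF A])
next
  case (Suc t)
  show ?case
  proof (cases "x \<in> A")
    case True
    have "occ A (Suc t) x \<le> occ A T x" by (intro occ_mono Suc.prems)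
    also have "\<dots> \<le> M" by (rule M[OF True])
    finally show ?thesis using True by simp
  next
    case False
    have "avg (occ A t) x \<le> avg (\<lambda>x. M * hit A t x) x" using Suc by (intro avg_mono) auto
    also have "\<dots> = M * avg (hit A t) x" by (simp add: avg_cmult)
    finally show ?thesis using False by (simp add: occ_Suc[OF A])
  qed
qed

text \<open>A visit to \<open>B\<close> is either the first visit to \<open>U\<close> or preceded by a visit to some other \<open>\<B> i\<close>,
  from which \<open>B\<close> still has to be reached.\<close>

lemma hit_le_first_hit:
  assumes fin: "finite I" and M: "\<And>i w. i \<in> I \<Longrightarrow> w \<in> \<B> i \<Longrightarrow> hit B T w \<le> M i"
    and M0: "\<And>i. i \<in> I \<Longrightarrow> 0 \<le> M i" and U: "U = B \<union> (\<Union>i\<in>I. \<B> i)"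
  shows "t \<le> T \<Longrightarrow> hit B t x \<le> first_hit U B t x + (\<Sum>i\<in>I. M i * hit (\<B> i) t x)"
proof (induction t arbitrary: x)
  case 0
  have "0 \<le> (\<Sum>i\<in>I. M i * hit (\<B> i) 0 x)" by (intro sum_nonneg mult_nonneg_nonneg M0 hit_bounds)
  thus ?case using U by (auto simp: of_bool_def)
next
  case (Suc t)
  have s0: "0 \<le> (\<Sum>i\<in>I. M i * hit (\<B> i) (Suc t) x)"
    by (intro sum_nonneg mult_nonneg_nonneg M0 hit_bounds)
  consider "x \<in> B" | j where "j \<in> I" "x \<in> \<B> j" "x \<notin> B" | "x \<notin> U" using U by auto
  thus ?case
  proof cases
    case 1
    thus ?thesis using s0 U by auto
  next
    case (2 j)
    have "hit B (Suc t) x \<le> hit B T x" by (intro hit_mono_time Suc.prems)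
    also have "\<dots> \<le> M j * hit (\<B> j) (Suc t) x" using M[OF 2(1,2)] 2 by simp
    also have "\<dots> \<le> (\<Sum>i\<in>I. M i * hit (\<B> i) (Suc t) x)"
      using 2 fin by (intro member_le_sum[where f = "\<lambda>i. M i * hit (\<B> i) (Suc t) x"] mult_nonneg_nonneg M0 hit_bounds) auto
    also have "\<dots> \<le> first_hit U B (Suc t) x + (\<Sum>i\<in>I. M i * hit (\<B> i) (Suc t) x)"
      using 2 U by auto
    finally show ?thesis .
  next
    case 3
    have "avg (hit B t) x \<le> avg (\<lambda>x. first_hit U B t x + (\<Sum>i\<in>I. M i * hit (\<B> i) t x)) x"
      using Suc by (intro avg_mono) auto
    also have "\<dots> = avg (first_hit U B t) x + (\<Sum>i\<in>I. M i * avg (hit (\<B> i) t) x)"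
      by (simp only: avg_add avg_sum avg_cmult)
    also have "(\<Sum>i\<in>I. M i * avg (hit (\<B> i) t) x) = (\<Sum>i\<in>I. M i * hit (\<B> i) (Suc t) x)"
      using 3 U by (intro sum.cong) auto
    finally show ?thesis using 3 U by simp
  qed
qed

text \<open>The Markov property at time a. A step changes the position by at most 1 in the sup norm,
  so \<beta> has to be a bound only within distance a of x; obstacles fill only a bounded region,
  and no uniform bound over the lattice is available.\<close>

lemma survival_add_le:
  assumes "\<And>y. linf (y - x) \<le> int a \<Longrightarrow> 1 - hit U b y \<le> \<beta>"
  shows "1 - hit U (a + b) x \<le> \<beta> * (1 - hit U a x)"
  using assms
proof (induction a arbitrary: x)
  case 0
  have "1 - hit U b x \<le> \<beta>" by (rule 0) (auto simp: linf_le_iff)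
  thus ?case by (auto simp: hit_eq_1)
next
  case (Suc a)
  show ?case
  proof (cases "x \<in> U")
    case False
    have "1 - avg (hit U (a + b)) x = avg (\<lambda>y. 1 - hit U (a + b) y) x" by (simp add: avg_diff)
    also have "\<dots> \<le> avg (\<lambda>y. \<beta> * (1 - hit U a y)) x"
    proof (intro avg_mono Suc.IH Suc.prems)
      fix y z assume "linf (y - x) \<le> 1" "linf (z - y) \<le> int a"
      thus "linf (z - x) \<le> int (Suc a)" using linf_triangle[of z x y] by simp
    qed
    also have "\<dots> = \<beta> * (1 - avg (hit U a) x)" by (simp add: avg_cmult avg_diff)
    finally show ?thesis using False by simp
  qed simp
qed

lemma survival_power_le:
  assumes "\<And>y. linf (y - x) \<le> int (k * T) \<Longrightarrow> c \<le> hit U T y"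
  shows "1 - hit U (k * T) x \<le> (1 - c) ^ k"
  using assms
proof (induction k)
  case 0
  show ?case using hit_bounds(1)[of U 0 x] by simp
next
  case (Suc k)
  have "linf (x - x) \<le> int (Suc k * T)" by (auto simp: linf_le_iff)
  hence c: "c \<le> 1" using Suc.prems[of x] hit_bounds(2)[of U T x] by linarith
  have "1 - hit U (k * T + T) x \<le> (1 - c) * (1 - hit U (k * T) x)"
  proof (rule survival_add_le)
    fix y assume "linf (y - x) \<le> int (k * T)"
    thus "1 - hit U T y \<le> 1 - c" using Suc.prems[of y] by simp
  qed
  also have "\<dots> \<le> (1 - c) * (1 - c) ^ k"
    using c by (intro mult_left_mono Suc.IH) (auto intro: Suc.prems)
  finally show ?case by (simp add: add.commute)
qed

section \<open>Identification of the recursions with the law of the walk\<close>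

lemma expectation_lazy_step:
  "(\<Sum>e\<in>set_pmf lazy_step. f (x + e) * pmf lazy_step e) = avg f (x :: int ^ 'd)"
proof -
  let ?N = "{e :: int ^ 'd. nearest_neighbor 0 e}" and ?d = "real CARD('d)"
  have fin: "finite ?N" unfolding neighbors_0_eq by simp
  have n0: "\<not> nearest_neighbor 0 (0 :: int ^ 'd)" by (simp add: nearest_neighbor_def)
  have sub: "set_pmf lazy_step \<subseteq> insert 0 ?N"
    by (auto simp: set_pmf_iff pmf_lazy_step split: if_splits)
  have "(\<Sum>e\<in>set_pmf lazy_step. f (x + e) * pmf lazy_step e) =
     (\<Sum>e\<in>insert 0 ?N. f (x + e) * pmf lazy_step e)"
    using fin sub by (intro sum.mono_neutral_left) (auto simp: set_pmf_iff)
  also have "\<dots> = f x / 2 + (\<Sum>e\<in>?N. f (x + e) / (4 * ?d))"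
    using fin n0 by (auto simp: pmf_lazy_step intro!: sum.cong)
  also have "(\<Sum>e\<in>?N. f (x + e) / (4 * ?d)) =
      (\<Sum>e\<in>range (\<lambda>i::'d. axis i 1). f (x + e) / (4 * ?d)) +
      (\<Sum>e\<in>range (\<lambda>i::'d. axis i (- 1)). f (x + e) / (4 * ?d))"
    unfolding neighbors_0_eq by (intro sum.union_disjoint) (auto simp: axis_eq_axis)
  also have "(\<Sum>e\<in>range (\<lambda>i::'d. axis i 1). f (x + e) / (4 * ?d)) = (\<Sum>i\<in>UNIV. f (x + axis i 1) / (4 * ?d))"
    by (subst sum.reindex) (auto simp: inj_on_def axis_eq_axis)
  also have "(\<Sum>e\<in>range (\<lambda>i::'d. axis i (- 1)). f (x + e) / (4 * ?d)) = (\<Sum>i\<in>UNIV. f (x - axis i 1) / (4 * ?d))"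
  proof -
    have "axis i (- 1 :: int) = - axis i 1" for i :: 'd by (auto simp: vec_eq_iff axis_def)
    thus ?thesis by (subst sum.reindex) (auto simp: inj_on_def axis_eq_axis)
  qed
  finally show ?thesis
    by (simp add: avg_def sum.distrib add_divide_distrib flip: sum_divide_distrib)
qed

text \<open>By \<open>PiM_iter\<close>, an i.i.d. sequence is an independent first term followed by
  an i.i.d. sequence. In terms of partial sums, a trajectory from x is x followed by a trajectory
  from x + s, with s the first increment.\<close>

lemma walk_law_first_step:
  fixes x :: "int ^ 'd"
  assumes E: "E \<in> sets (walk_law x)"
  shows "measure (walk_law x) E =
    (\<Sum>e\<in>set_pmf lazy_step. measure (walk_law (x + e)) {X. case_nat x X \<in> E} * pmf lazy_step e)"
proof -
  let ?M = "measure_pmf (lazy_step :: (int ^ 'd) pmf)"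
  let ?S = "\<Pi>\<^sub>M n\<in>(UNIV::nat set). ?M"
  let ?W = "\<Pi>\<^sub>M n\<in>(UNIV::nat set). count_space (UNIV :: (int ^ 'd) set)"
  let ?w = "\<lambda>x \<xi> n. x + (\<Sum>k<n. \<xi> k) :: int ^ 'd"
  interpret product_prob_space "\<lambda>_::nat. ?M" UNIV by unfold_locales
  interpret sequence_space ?M by unfold_locales
  have "prob_space ?S" by (rule prob_space_PiM) (rule prob_space_measure_pmf)
  hence sf: "sigma_finite_measure ?S" by (rule prob_space_imp_sigma_finite)
  have E': "E \<in> sets ?W" using E by (simp add: sets_walk_law)
  have wm: "?w x \<in> ?S \<rightarrow>\<^sub>M ?W" for x by (rule walk_map_measurable)
  have cm: "(\<lambda>(s, \<omega>). case_nat s \<omega>) \<in> (?M \<Otimes>\<^sub>M ?S) \<rightarrow>\<^sub>M ?S" by measurable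
  have w_eq: "?w x (case_nat s \<omega>) = case_nat x (?w (x + s) \<omega>)" for s \<omega>
  proof
    fix n
    show "?w x (case_nat s \<omega>) n = case_nat x (?w (x + s) \<omega>) n"
      by (cases n) (simp_all add: sum.lessThan_Suc_shift add.assoc del: sum.lessThan_Suc)
  qed
  have cn: "(\<lambda>X. case_nat x X) \<in> ?W \<rightarrow>\<^sub>M ?W"
  proof (rule measurable_PiM_single')
    fix n :: nat
    show "(\<lambda>X. case_nat x X n) \<in> ?W \<rightarrow>\<^sub>M count_space UNIV" by (cases n) simp_all
  qed auto
  have F: "{X. case_nat x X \<in> E} \<in> sets ?W"
    using measurable_sets[OF cn E'] by (simp add: space_PiM vimage_def)
  have "emeasure (walk_law x) E = emeasure ?S {\<xi>. ?w x \<xi> \<in> E}"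
    unfolding walk_law_def by (subst emeasure_distr[OF wm E']) (simp add: space_PiM vimage_def)
  also have "\<dots> = emeasure (distr (?M \<Otimes>\<^sub>M ?S) ?S (\<lambda>(s, \<omega>). case_nat s \<omega>)) {\<xi>. ?w x \<xi> \<in> E}"
    by (simp only: PiM_iter)
  also have "\<dots> = emeasure (?M \<Otimes>\<^sub>M ?S) {(s, \<omega>). ?w x (case_nat s \<omega>) \<in> E}"
  proof (subst emeasure_distr[OF cm])
    show "{\<xi>. ?w x \<xi> \<in> E} \<in> sets ?S"
      using measurable_sets[OF wm[of x] E'] by (simp add: space_PiM vimage_def)
    show "emeasure (?M \<Otimes>\<^sub>M ?S) ((\<lambda>(s, \<omega>). case_nat s \<omega>) -` {\<xi>. ?w x \<xi> \<in> E} \<inter> space (?M \<Otimes>\<^sub>M ?S)) =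
      emeasure (?M \<Otimes>\<^sub>M ?S) {(s, \<omega>). ?w x (case_nat s \<omega>) \<in> E}"
      by (intro arg_cong2[where f = emeasure]) (auto simp: space_pair_measure space_PiM)
  qed
  also have "\<dots> = (\<integral>\<^sup>+s. emeasure ?S (Pair s -` {(s, \<omega>). ?w x (case_nat s \<omega>) \<in> E}) \<partial>?M)"
  proof (rule sigma_finite_measure.emeasure_pair_measure_alt[OF sf])
    have "(\<lambda>p. ?w x (case p of (s, \<omega>) \<Rightarrow> case_nat s \<omega>)) \<in> (?M \<Otimes>\<^sub>M ?S) \<rightarrow>\<^sub>M ?W"
      by (rule measurable_compose[OF cm wm])
    from measurable_sets[OF this E']
    show "{(s, \<omega>). ?w x (case_nat s \<omega>) \<in> E} \<in> sets (?M \<Otimes>\<^sub>M ?S)"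
      by (simp add: space_pair_measure space_PiM vimage_def split_def)
  qed
  also have "\<dots> = (\<integral>\<^sup>+s. ennreal (measure (walk_law (x + s)) {X. case_nat x X \<in> E}) \<partial>?M)"
  proof (intro nn_integral_cong)
    fix s
    interpret W: prob_space "walk_law (x + s)" by (rule prob_space_walk_law)
    have "ennreal (measure (walk_law (x + s)) {X. case_nat x X \<in> E}) = emeasure (walk_law (x + s)) {X. case_nat x X \<in> E}"
      by (simp add: W.emeasure_eq_measure)
    also have "\<dots> = emeasure ?S {\<omega>. case_nat x (?w (x + s) \<omega>) \<in> E}"
      unfolding walk_law_def by (subst emeasure_distr[OF wm F]) (simp add: space_PiM vimage_def)
    finally show "emeasure ?S (Pair s -` {(s, \<omega>). ?w x (case_nat s \<omega>) \<in> E}) =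
       ennreal (measure (walk_law (x + s)) {X. case_nat x X \<in> E})"
      by (simp add: vimage_def w_eq)
  qed
  also have "\<dots> = (\<Sum>e\<in>set_pmf lazy_step. ennreal (measure (walk_law (x + e)) {X. case_nat x X \<in> E}) * ennreal (pmf lazy_step e))"
  proof (rule nn_integral_measure_pmf_finite)
    have "set_pmf lazy_step \<subseteq> insert 0 {e :: int ^ 'd. nearest_neighbor 0 e}"
      by (auto simp: set_pmf_iff pmf_lazy_step split: if_splits)
    thus "finite (set_pmf (lazy_step :: (int ^ 'd) pmf))"
      by (rule finite_subset) (simp add: neighbors_0_eq)
  qed simp
  also have "\<dots> = ennreal (\<Sum>e\<in>set_pmf lazy_step. measure (walk_law (x + e)) {X. case_nat x X \<in> E} * pmf lazy_step e)"
    by (subst sum_ennreal[symmetric]) (auto simp: ennreal_mult)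
  finally show ?thesis
    by (simp add: measure_def sum_nonneg)
qed

lemma measure_walk_law_hit:
  "measure (walk_law x) {X. \<exists>k\<le>n. X k \<in> A} = hit A n x"
proof (induction n arbitrary: x)
  have meas: "{X. \<exists>k\<le>n. X k \<in> A} \<in> sets (walk_law x)" for n x
  proof -
    have "Measurable.pred (walk_law x) (\<lambda>X. \<exists>k\<le>n. X k \<in> A)" by measurable
    thus ?thesis by (simp add: pred_def)
  qed
  have sum1: "(\<Sum>e\<in>set_pmf (lazy_step :: (int ^ 'a) pmf). pmf lazy_step e) = 1"
    using expectation_lazy_step[of "\<lambda>_. 1"] by simp
  have UN: "measure (walk_law y) UNIV = 1" for y :: "int ^ 'a"
    using prob_space.prob_space[OF prob_space_walk_law[of y]] by simp
  {
    case 0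
    have "{X. case_nat x X \<in> {X. \<exists>k\<le>0. X k \<in> A}} = (if x \<in> A then UNIV else {})" by auto
    thus ?case using sum1 by (subst walk_law_first_step[OF meas]) (simp add: UN)
  next
    case (Suc n)
    have eq: "{X. case_nat x X \<in> {X. \<exists>k\<le>Suc n. X k \<in> A}} = (if x \<in> A then UNIV else {X. \<exists>k\<le>n. X k \<in> A})"
    proof -
      have "(\<exists>k\<le>Suc n. case_nat x X k \<in> A) \<longleftrightarrow> x \<in> A \<or> (\<exists>k\<le>n. X k \<in> A)" for X
        by (metis Suc_le_mono bot_nat_0.extremum not0_implies_Suc old.nat.simps(4) old.nat.simps(5))
      thus ?thesis by auto
    qed
    show ?case
      using sum1 expectation_lazy_step[of "hit A n" x]
      unfolding walk_law_first_step[OF meas] eq by (simp add: UN Suc)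
  }
qed

lemma measure_walk_law_first_hit:
  "measure (walk_law x) {X. \<exists>k\<le>n. X k \<in> U \<inter> B \<and> (\<forall>j<k. X j \<notin> U)} = first_hit U B n x"
proof (induction n arbitrary: x)
  have meas: "{X. \<exists>k\<le>n. X k \<in> U \<inter> B \<and> (\<forall>j<k. X j \<notin> U)} \<in> sets (walk_law x)" for n x
  proof -
    have "Measurable.pred (walk_law x) (\<lambda>X. \<exists>k\<le>n. X k \<in> U \<inter> B \<and> (\<forall>j<k. X j \<notin> U))" by measurable
    thus ?thesis by (simp add: pred_def)
  qed
  have sum1: "(\<Sum>e\<in>set_pmf (lazy_step :: (int ^ 'a) pmf). pmf lazy_step e) = 1"
    using expectation_lazy_step[of "\<lambda>_. 1"] by simp
  have UN: "measure (walk_law y) UNIV = 1" for y :: "int ^ 'a"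
    using prob_space.prob_space[OF prob_space_walk_law[of y]] by simp
  {
    case 0
    have "{X. case_nat x X \<in> {X. \<exists>k\<le>0. X k \<in> U \<inter> B \<and> (\<forall>j<k. X j \<notin> U)}} =
       (if x \<in> U \<and> x \<in> B then UNIV else {})" by auto
    thus ?case using sum1 by (subst walk_law_first_step[OF meas]) (auto simp: UN)
  next
    case (Suc n)
    have eq: "{X. case_nat x X \<in> {X. \<exists>k\<le>Suc n. X k \<in> U \<inter> B \<and> (\<forall>j<k. X j \<notin> U)}} =
       (if x \<in> U then (if x \<in> B then UNIV else {}) else {X. \<exists>k\<le>n. X k \<in> U \<inter> B \<and> (\<forall>j<k. X j \<notin> U)})"
    proof -
      have ex: "(\<exists>k\<le>Suc n. P k) \<longleftrightarrow> P 0 \<or> (\<exists>k\<le>n. P (Suc k))" for P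
        by (metis Suc_le_mono bot_nat_0.extremum not0_implies_Suc)
      have all: "(\<forall>j<Suc k. P j) \<longleftrightarrow> P 0 \<and> (\<forall>j<k. P (Suc j))" for P k
        by (metis Suc_less_eq less_Suc_eq_0_disj)
      show ?thesis unfolding mem_Collect_eq ex all by auto
    qed
    show ?case
      using sum1 expectation_lazy_step[of "first_hit U B n" x]
      unfolding walk_law_first_step[OF meas] eq by (simp add: UN Suc[simplified])
  }
qed

lemma hitting_time_le_iff: "hitting_time U X \<le> enat n \<longleftrightarrow> (\<exists>k\<le>n. X k \<in> U)"
proof
  assume h: "hitting_time U X \<le> enat n"
  show "\<exists>k\<le>n. X k \<in> U"
  proof (rule ccontr)
    assume "\<not> (\<exists>k\<le>n. X k \<in> U)"
    hence "enat (Suc n) \<le> hitting_time U X"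
      unfolding hitting_time_def by (intro Inf_greatest) (auto simp: not_le Suc_le_eq intro: leI)
    thus False using h by (metis Suc_n_not_le_n enat_ord_simps(1) order_trans)
  qed
next
  assume "\<exists>k\<le>n. X k \<in> U"
  then obtain k where k: "k \<le> n" "X k \<in> U" by blast
  have "hitting_time U X \<le> enat k" unfolding hitting_time_def using k by (intro Inf_lower) auto
  thus "hitting_time U X \<le> enat n" using k by (meson enat_ord_simps(1) order_trans)
qed

lemma hitting_time_eqI:
  assumes "X k \<in> U" "\<forall>j<k. X j \<notin> U" shows "hitting_time U X = enat k"
proof (rule antisym)
  show "hitting_time U X \<le> enat k" using assms hitting_time_le_iff by blast
  show "enat k \<le> hitting_time U X" unfolding hitting_time_def
    using assms(2) by (intro Inf_greatest) (auto simp: not_less)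
qed

lemma measure_hitting_time_gt_le:
  assumes "real T \<le> t"
  shows "measure (walk_law x) {X. ereal_of_enat (hitting_time U X) > ereal t} \<le> 1 - hit U T x"
proof -
  interpret prob_space "walk_law x" by (rule prob_space_walk_law)
  have meas: "{X. \<exists>k\<le>T. X k \<in> U} \<in> sets (walk_law x)"
  proof -
    have "Measurable.pred (walk_law x) (\<lambda>X. \<exists>k\<le>T. X k \<in> U)" by measurable
    thus ?thesis by (simp add: pred_def)
  qed
  have "\<not> (\<exists>k\<le>T. X k \<in> U)" if "ereal_of_enat (hitting_time U X) > ereal t" for X
  proof
    assume "\<exists>k\<le>T. X k \<in> U"
    hence "hitting_time U X \<le> enat T" by (simp add: hitting_time_le_iff)
    hence "ereal_of_enat (hitting_time U X) \<le> ereal (real T)"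
      by (metis ereal_of_enat_le_iff ereal_of_enat_simps(1))
    also have "\<dots> \<le> ereal t" using assms by simp
    finally show False using that by simp
  qed
  hence sub: "{X. ereal_of_enat (hitting_time U X) > ereal t} \<subseteq> space (walk_law x) - {X. \<exists>k\<le>T. X k \<in> U}"
    by auto
  have "measure (walk_law x) {X. ereal_of_enat (hitting_time U X) > ereal t} \<le>
     measure (walk_law x) (space (walk_law x) - {X. \<exists>k\<le>T. X k \<in> U})"
    by (rule finite_measure_mono[OF sub sets.compl_sets[OF meas]])
  also have "\<dots> = 1 - hit U T x"
    by (subst prob_compl[OF meas]) (simp add: measure_walk_law_hit)
  finally show ?thesis .
qed

lemma first_hit_le_measure:
  "first_hit U B T x \<le>
    measure (walk_law x) {X. hitting_time U X < \<infinity> \<and> X (the_enat (hitting_time U X)) \<in> B}"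
proof -
  interpret prob_space "walk_law x" by (rule prob_space_walk_law)
  show ?thesis unfolding measure_walk_law_first_hit[symmetric]
  proof (intro finite_measure_mono hitting_events_measurable subsetI)
    fix X assume "X \<in> {X. \<exists>k\<le>T. X k \<in> U \<inter> B \<and> (\<forall>j<k. X j \<notin> U)}"
    then obtain k where k: "X k \<in> U" "X k \<in> B" "\<forall>j<k. X j \<notin> U" by auto
    have "hitting_time U X = enat k" using k by (intro hitting_time_eqI)
    thus "X \<in> {X. hitting_time U X < \<infinity> \<and> X (the_enat (hitting_time U X)) \<in> B}"
      using k by simp
  qed
qed

section \<open>Occupation times of separated boxes\<close>

lemma mem_zbox_iff: "y \<in> zbox x r \<longleftrightarrow> linf (y - x) \<le> \<lfloor>r\<rfloor>"
  by (simp add: zbox_def le_floor_iff)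

lemma zbox_eq_vec_box: "zbox x r = {y. \<forall>i. y $ i \<in> {x $ i - \<lfloor>r\<rfloor>..x $ i + \<lfloor>r\<rfloor>}}"
  by (auto simp: mem_zbox_iff linf_le_iff abs_le_iff algebra_simps)

lemma finite_zbox [simp]: "finite (zbox x r)"
  unfolding zbox_eq_vec_box by (rule finite_vec_box) simp

lemma card_zbox: "r \<ge> 0 \<Longrightarrow> real (card (zbox (x :: int ^ 'd) r)) = (2 * of_int \<lfloor>r\<rfloor> + 1) ^ CARD('d)"
  unfolding zbox_eq_vec_box by (subst finite_vec_box(2)) (simp_all add: nat_add_distrib add.commute)

lemma card_zbox_bounds:
  assumes "r \<ge> 1"
  shows "r ^ CARD('d) \<le> real (card (zbox (x :: int ^ 'd) r))"
    "real (card (zbox (x :: int ^ 'd) r)) \<le> (3 * r) ^ CARD('d)"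
proof -
  have "r \<le> 2 * of_int \<lfloor>r\<rfloor> + 1" "2 * of_int \<lfloor>r\<rfloor> + 1 \<le> 3 * r"
    using assms by linarith+
  hence "r ^ CARD('d) \<le> (2 * of_int \<lfloor>r\<rfloor> + 1) ^ CARD('d)" "(2 * of_int \<lfloor>r\<rfloor> + 1) ^ CARD('d) \<le> (3 * r) ^ CARD('d)"
    using assms by (intro power_mono; linarith)+
  moreover have "real (card (zbox x r)) = (2 * of_int \<lfloor>r\<rfloor> + 1) ^ CARD('d)"
    using assms by (intro card_zbox) simp
  ultimately show "r ^ CARD('d) \<le> real (card (zbox x r))" "real (card (zbox x r)) \<le> (3 * r) ^ CARD('d)"
    by simp_all
qed

lemma zbox_translate: "zbox y r = (\<lambda>v. y + v) ` zbox 0 r"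
proof
  show "zbox y r \<subseteq> (\<lambda>v. y + v) ` zbox 0 r"
  proof
    fix w assume "w \<in> zbox y r"
    thus "w \<in> (\<lambda>v. y + v) ` zbox 0 r"
      by (intro image_eqI[of _ _ "w - y"]) (auto simp: mem_zbox_iff)
  qed
qed (auto simp: mem_zbox_iff)

text \<open>A telescoping substitute for the integral of x^(-3/2): with a < b the two roots, 2/a -
  2/b equals 2 / (a b (a + b)) because b^2 - a^2 = 1.\<close>

lemma inverse_sqrt_cube_le:
  assumes "n \<ge> 1"
  shows "1 / sqrt (real n + 1) ^ 3 \<le> 2 / sqrt (real n) - 2 / sqrt (real n + 1)"
proof -
  define a b where "a = sqrt (real n)" and "b = sqrt (real n + 1)"
  have ab: "0 < a" "a \<le> b" using assms by (auto simp: a_def b_def)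
  have "b\<^sup>2 - a\<^sup>2 = 1" by (simp add: a_def b_def)
  hence e: "(b - a) * (b + a) = 1" by (simp add: power2_eq_square algebra_simps)
  hence "b - a = 1 / (b + a)" using ab by (simp add: eq_divide_eq)
  hence "2 * b - 2 * a = 2 / (b + a)" by (simp add: field_simps)
  moreover have "2 / a - 2 / b = (2 * b - 2 * a) / (a * b)" using ab by (simp add: diff_frac_eq)
  ultimately have "2 / a - 2 / b = 2 / (a * b * (b + a))" by (simp add: mult.commute)
  moreover have "1 / b ^ 3 = 2 / (b * b * (b + b))" by (simp add: power3_eq_cube)
  moreover have "2 / (b * b * (b + b)) \<le> 2 / (a * b * (b + a))"
    using ab by (intro divide_left_mono mult_mono mult_pos_pos) auto
  ultimately show ?thesis by (simp add: a_def b_def)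
qed

lemma sum_inverse_sqrt_cube_le:
  assumes "N \<ge> 1"
  shows "(\<Sum>n\<in>{N..<N + M}. 1 / sqrt (real n + 1) ^ 3) \<le> 2 / sqrt (real N)"
proof -
  have "(\<Sum>n\<in>{N..<N + M}. 1 / sqrt (real n + 1) ^ 3) \<le> 2 / sqrt (real N) - 2 / sqrt (real (N + M))"
  proof (induction M)
    case (Suc M)
    have "1 / sqrt (real (N + M) + 1) ^ 3 \<le> 2 / sqrt (real (N + M)) - 2 / sqrt (real (N + M) + 1)"
      using assms by (intro inverse_sqrt_cube_le) auto
    thus ?case using Suc by (simp add: algebra_simps)
  qed simp
  moreover have "0 \<le> 2 / sqrt (real (N + M))" by simp
  ultimately show ?thesis by linarith
qed

text \<open>Up to time of order l^2 each time contributes at most 1. Later the contribution is of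
  order (l / sqrt n)^d, which is at most (l / sqrt n)^3 because l <= sqrt(n+1) and d >= 3; these
  terms sum to l^3 / l. Transience enters here.\<close>

lemma occ_zbox_le:
  assumes d: "CARD('d) \<ge> 3"
  obtains C where "C \<ge> 1"
    "\<And>l (y :: int ^ 'd) T z. l \<ge> 1 \<Longrightarrow> occ (zbox y l) T z \<le> C * l\<^sup>2"
proof (rule that)
  let ?d = "CARD('d)"
  define K where "K = (4 + 28 * real ?d) ^ ?d"
  have K0: "K \<ge> 0" by (simp add: K_def)
  show "2 + 2 * 3 ^ ?d * K \<ge> 1" using K0 by (simp add: add_increasing2)
  fix l :: real and y z :: "int ^ 'd" and T
  assume l: "l \<ge> 1"
  define a where "a n = (\<Sum>u\<in>zbox y l. kern n (u - z))" for n
  define N where "N = nat \<lceil>l\<^sup>2\<rceil>"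
  have l2: "1 \<le> l\<^sup>2" using l by simp
  have N: "l\<^sup>2 \<le> real N" "real N \<le> 2 * l\<^sup>2" "N \<ge> 1"
    using l2 unfolding N_def by linarith+
  have a0: "0 \<le> a n" for n unfolding a_def by (intro sum_nonneg) auto
  have a1: "a n \<le> 1" for n unfolding a_def by (intro sum_kern_translate_le_1) auto
  have a2: "a n \<le> 3 ^ ?d * K * l ^ 3 * (1 / sqrt (real n + 1) ^ 3)" if n: "n \<ge> N" for n
  proof -
    have sl: "l \<le> sqrt (real n + 1)" using n N l by (intro real_le_rsqrt) auto
    have "a n \<le> (\<Sum>u\<in>zbox y l. K / sqrt (real n + 1) ^ ?d)"
      unfolding a_def using kern_le by (intro sum_mono) (auto simp: K_def power_divide)
    also have "\<dots> = real (card (zbox y l)) * (K / sqrt (real n + 1) ^ ?d)" by simp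
    also have "\<dots> \<le> (3 * l) ^ ?d * (K / sqrt (real n + 1) ^ ?d)"
      using K0 l by (intro mult_right_mono card_zbox_bounds) auto
    also have "\<dots> = 3 ^ ?d * K * l ^ 3 * (l ^ (?d - 3) / (sqrt (real n + 1) ^ 3 * sqrt (real n + 1) ^ (?d - 3)))"
      using d by (simp add: power_mult_distrib flip: power_add)
    also have "\<dots> \<le> 3 ^ ?d * K * l ^ 3 * (1 / sqrt (real n + 1) ^ 3)"
    proof (intro mult_left_mono)
      have "l ^ (?d - 3) \<le> sqrt (real n + 1) ^ (?d - 3)" using sl l by (intro power_mono) auto
      moreover have "0 < sqrt (real n + 1) ^ (?d - 3)" "0 < sqrt (real n + 1) ^ 3" by simp_all
      ultimately show "l ^ (?d - 3) / (sqrt (real n + 1) ^ 3 * sqrt (real n + 1) ^ (?d - 3)) \<le> 1 / sqrt (real n + 1) ^ 3"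
        by (simp add: divide_le_eq)
    qed (use K0 l in auto)
    finally show ?thesis .
  qed
  have "occ (zbox y l) T z = (\<Sum>n<Suc T. a n)" by (simp add: occ_def a_def)
  also have "\<dots> \<le> (\<Sum>n\<in>{..<N} \<union> {N..<N + Suc T}. a n)" by (intro sum_mono2 a0) auto
  also have "\<dots> = (\<Sum>n<N. a n) + (\<Sum>n\<in>{N..<N + Suc T}. a n)" by (intro sum.union_disjoint) auto
  also have "\<dots> \<le> (\<Sum>n<N. 1) + (\<Sum>n\<in>{N..<N + Suc T}. 3 ^ ?d * K * l ^ 3 * (1 / sqrt (real n + 1) ^ 3))"
    using a1 a2 by (intro add_mono sum_mono) auto
  also have "\<dots> = real N + 3 ^ ?d * K * l ^ 3 * (\<Sum>n\<in>{N..<N + Suc T}. 1 / sqrt (real n + 1) ^ 3)"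
    by (simp only: sum_distrib_left) simp
  also have "\<dots> \<le> 2 * l\<^sup>2 + 3 ^ ?d * K * l ^ 3 * (2 / sqrt (real N))"
    using N K0 l by (intro add_mono mult_left_mono sum_inverse_sqrt_cube_le) auto
  also have "\<dots> \<le> 2 * l\<^sup>2 + 3 ^ ?d * K * l ^ 3 * (2 / l)"
  proof -
    have "l \<le> sqrt (real N)" using N(1) by (rule real_le_rsqrt)
    thus ?thesis using K0 l N(3) by (intro add_mono mult_left_mono divide_left_mono mult_pos_pos) auto
  qed
  also have "\<dots> = (2 + 2 * 3 ^ ?d * K) * l\<^sup>2"
    using l by (simp add: power2_eq_square power3_eq_cube algebra_simps)
  finally show "occ (zbox y l) T z \<le> (2 + 2 * 3 ^ ?d * K) * l\<^sup>2" .
qed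

lemma kern_ge_scale:
  fixes v :: "int ^ 'd"
  assumes v: "16 * (real CARD('d))\<^sup>2 * (of_int (linf v))\<^sup>2 \<le> real n"
    and r: "sqrt (real n + 1) \<le> r"
  shows "1 / (2 * 4 ^ CARD('d)) / r ^ CARD('d) \<le> kern n v"
proof -
  have s0: "0 < sqrt (real n + 1)" by simp
  hence "0 < r" using r by linarith
  hence "(1 / (4 * r)) ^ CARD('d) \<le> (1 / (4 * sqrt (real n + 1))) ^ CARD('d)"
    using r by (intro power_mono divide_left_mono mult_left_mono mult_pos_pos) auto
  hence "1 / 2 * (1 / (4 * r)) ^ CARD('d) \<le> kern n v" using kern_ge[OF v] by linarith
  thus ?thesis by (simp add: power_divide power_mult_distrib)
qed

text \<open>Points of the box are within distance 2l, so \<open>kern_ge\<close> applies from time a,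
  about 16 d^2 (2l)^2, onwards. Between a and 2a there are order l^2 times, each with about l^d
  points carrying at least c l^(-d).\<close>

lemma occ_zbox_ge:
  obtains c A where "c > 0" "A \<ge> 1"
    "\<And>l (y :: int ^ 'd) S z. l \<ge> 1 \<Longrightarrow> z \<in> zbox y l \<Longrightarrow> A * l\<^sup>2 \<le> real S \<Longrightarrow> c * l\<^sup>2 \<le> occ (zbox y l) S z"
proof (rule that)
  let ?d = "CARD('d)"
  define A where "A = 128 * (real ?d)\<^sup>2 + 2"
  define c where "c = 1 / (2 * 4 ^ ?d) / sqrt A ^ ?d"
  have A0: "A \<ge> 2" by (simp add: A_def)
  show "c > 0" using A0 by (simp add: c_def)
  show "A \<ge> 1" using A0 by simp
  fix l :: real and y z :: "int ^ 'd" and S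
  assume l: "l \<ge> 1" and z: "z \<in> zbox y l" and S: "A * l\<^sup>2 \<le> real S"
  have l2: "1 \<le> l\<^sup>2" using l by simp
  define a where "a = nat \<lceil>64 * (real ?d)\<^sup>2 * l\<^sup>2\<rceil>"
  have "0 \<le> 64 * (real ?d)\<^sup>2 * l\<^sup>2" by simp
  hence a: "64 * (real ?d)\<^sup>2 * l\<^sup>2 \<le> real a" "real a \<le> 64 * (real ?d)\<^sup>2 * l\<^sup>2 + 1"
    unfolding a_def by linarith+
  have "real a \<le> (A / 2) * l\<^sup>2" using a(2) l2 by (simp add: A_def algebra_simps)
  hence aA: "2 * real a \<le> A * l\<^sup>2" by simp
  have "1 \<le> (real ?d)\<^sup>2" by (simp add: Suc_leI)
  hence "1 * l\<^sup>2 \<le> 64 * (real ?d)\<^sup>2 * l\<^sup>2" by (intro mult_right_mono) (linarith, simp)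
  hence al: "l\<^sup>2 \<le> real a" using a(1) by linarith
  have k: "c / l ^ ?d \<le> kern n (u - z)" if n: "n \<in> {a..<2 * a}" and u: "u \<in> zbox y l" for n u
  proof -
    have "linf (u - z) \<le> linf (u - y) + linf (y - z)" by (rule linf_triangle)
    also have "\<dots> \<le> \<lfloor>l\<rfloor> + \<lfloor>l\<rfloor>" using u z by (intro add_mono) (auto simp: mem_zbox_iff linf_minus[of y z])
    finally have "real_of_int (linf (u - z)) \<le> 2 * l" by linarith
    hence "(real_of_int (linf (u - z)))\<^sup>2 \<le> (2 * l)\<^sup>2" by (intro power_mono) auto
    hence "16 * (real ?d)\<^sup>2 * (real_of_int (linf (u - z)))\<^sup>2 \<le> 16 * (real ?d)\<^sup>2 * (2 * l)\<^sup>2"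
      by (intro mult_left_mono) auto
    also have "\<dots> \<le> real n" using a(1) n by (simp add: power_mult_distrib)
    finally have 1: "16 * (real ?d)\<^sup>2 * (real_of_int (linf (u - z)))\<^sup>2 \<le> real n" .
    have "sqrt (real n + 1) \<le> sqrt (A * l\<^sup>2)" using n aA by (intro real_sqrt_le_mono) auto
    also have "\<dots> = sqrt A * l" using l by (simp add: real_sqrt_mult)
    finally have "1 / (2 * 4 ^ ?d) / (sqrt A * l) ^ ?d \<le> kern n (u - z)" by (rule kern_ge_scale[OF 1])
    thus ?thesis by (simp add: c_def power_mult_distrib mult.assoc)
  qed
  have c0: "c > 0" using A0 by (simp add: c_def)
  have "c * l\<^sup>2 \<le> c * real a" using al c0 by (intro mult_left_mono) auto
  also have "\<dots> = (\<Sum>n\<in>{a..<2 * a}. l ^ ?d * (c / l ^ ?d))" using l by simp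
  also have "\<dots> \<le> (\<Sum>n\<in>{a..<2 * a}. real (card (zbox y l)) * (c / l ^ ?d))"
    using l c0 by (intro sum_mono mult_right_mono card_zbox_bounds) auto
  also have "\<dots> = (\<Sum>n\<in>{a..<2 * a}. \<Sum>u\<in>zbox y l. c / l ^ ?d)" by simp
  also have "\<dots> \<le> (\<Sum>n\<in>{a..<2 * a}. \<Sum>u\<in>zbox y l. kern n (u - z))"
    using k by (intro sum_mono) auto
  also have "\<dots> \<le> occ (zbox y l) S z"
    unfolding occ_def using aA S by (intro sum_mono2 sum_nonneg) auto
  finally show "c * l\<^sup>2 \<le> occ (zbox y l) S z" .
qed

lemma eventually_ln_power_le:
  assumes "a > 0"
  shows "eventually (\<lambda>x::real. ln x ^ k \<le> x powr a) at_top"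
proof -
  have "eventually (\<lambda>x::real. ln x powr real k \<le> x powr a) at_top"
    using assms by real_asymp
  moreover have "eventually (\<lambda>x::real. ln x > 0) at_top" by real_asymp
  ultimately show ?thesis by eventually_elim (simp add: powr_realpow)
qed

text \<open>Three time ranges, with \<theta> = log D. Before (D / (16 \<theta>))^2 the exponential
  bound beats the number of reachable points. From then until about (D/8)^2, separation at the
  smaller scale costs a factor \<theta>^d at no more than D^2 times, which T >= D^2 \<theta>^d
  absorbs. Afterwards separation at scale D gives D^(-d) at each time. The factor 2 in the
  hypotheses leaves room for choosing points inside boxes whose centres are D apart.\<close>

lemma sum_kern_time_separated:
  obtains C D0 where "C \<ge> 1"
    "\<And>D T W (x :: int ^ 'd). D \<ge> D0 \<Longrightarrow> (real D)\<^sup>2 * ln (real D) ^ CARD('d) \<le> real T \<Longrightarrow> finite W \<Longrightarrow>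
      pairwise (\<lambda>w w'. int D \<le> 2 * linf (w - w')) W \<Longrightarrow> \<forall>w\<in>W. int D \<le> 2 * linf (w - x) \<Longrightarrow>
      (\<Sum>n<Suc T. \<Sum>w\<in>W. kern n (w - x)) \<le> C * real T / real D ^ CARD('d)"
proof -
  let ?d = "CARD('d)"
  define C1 where "C1 = 2 + 14 * real ?d"
  have C1: "C1 \<ge> 0" by (simp add: C1_def)
  define C where "C = 2 + (32 * C1) ^ ?d + 2 * (16 * C1) ^ ?d"
  have "eventually (\<lambda>x::real. ln x \<ge> real ?d) at_top" by real_asymp
  moreover have "eventually (\<lambda>x::real. 64 * (ln x)\<^sup>2 \<le> x) at_top" by real_asymp
  moreover have "eventually (\<lambda>x::real. 16 * ln x \<le> x) at_top" by real_asymp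
  ultimately have "eventually (\<lambda>x::real. ln x \<ge> real ?d \<and> 64 * (ln x)\<^sup>2 \<le> x \<and> 16 * ln x \<le> x) at_top"
    by eventually_elim auto
  then obtain x0 :: real where x0: "\<And>x. x \<ge> x0 \<Longrightarrow> ln x \<ge> real ?d \<and> 64 * (ln x)\<^sup>2 \<le> x \<and> 16 * ln x \<le> x"
    by (auto simp: eventually_at_top_linorder)
  show ?thesis
  proof (rule that[of C "max 16 (nat \<lceil>x0\<rceil>)"])
    have "0 \<le> (32 * C1) ^ ?d" "0 \<le> (16 * C1) ^ ?d" using C1 by auto
    thus "C \<ge> 1" by (simp add: C_def)
    fix D T W and x :: "int ^ 'd"
    assume D: "D \<ge> max 16 (nat \<lceil>x0\<rceil>)" and T: "(real D)\<^sup>2 * ln (real D) ^ ?d \<le> real T"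
      and W: "finite W" "pairwise (\<lambda>w w'. int D \<le> 2 * linf (w - w')) W"
      and Wx: "\<forall>w\<in>W. int D \<le> 2 * linf (w - x)"
    define \<theta> where "\<theta> = ln (real D)"
    have D16: "D \<ge> 16" using D by simp
    have "x0 \<le> real D" using D by linarith
    hence th: "\<theta> \<ge> real ?d" "64 * \<theta>\<^sup>2 \<le> real D" "16 * \<theta> \<le> real D"
      using x0 by (auto simp: \<theta>_def)
    have th1: "\<theta> \<ge> 1" using th(1) by (smt (verit) of_nat_1 of_nat_le_iff Suc_leI zero_less_card_finite One_nat_def)
    have Dth: "D = exp \<theta>" using D16 by (simp add: \<theta>_def)
    \<comment> \<open>Distinct points of W are at distance at least D/2 >= 4 s, more than the 2 s
      that \<open>sum_kern_separated\<close> asks for.\<close>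
    define s where "s = D div 8"
    have "D \<le> 8 * (D div 8) + 7" by presburger
    hence "D \<le> 16 * (D div 8)" using D16 by linarith
    hence s: "s \<ge> 1" "8 * s \<le> D" "real D \<le> 16 * real s" using D16 by (auto simp: s_def)
    define s1 where "s1 = nat \<lfloor>real D / (16 * \<theta>)\<rfloor>"
    have ge1: "1 \<le> real D / (16 * \<theta>)" using th th1 by (simp add: le_divide_eq)
    have s1: "s1 \<ge> 1" "real s1 \<le> real D / (16 * \<theta>)" "real D / (16 * \<theta>) \<le> 2 * real s1"
    proof -
      have "1 \<le> nat \<lfloor>r\<rfloor> \<and> real (nat \<lfloor>r\<rfloor>) \<le> r \<and> r \<le> 2 * real (nat \<lfloor>r\<rfloor>)" if "1 \<le> r" for r :: real
      proof -
        have f: "1 \<le> \<lfloor>r\<rfloor>" using that by (simp add: le_floor_iff)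
        hence "real (nat \<lfloor>r\<rfloor>) = of_int \<lfloor>r\<rfloor>" by simp
        thus ?thesis using f by linarith
      qed
      from this[OF ge1] show "s1 \<ge> 1" "real s1 \<le> real D / (16 * \<theta>)" "real D / (16 * \<theta>) \<le> 2 * real s1"
        unfolding s1_def by blast+
    qed
    have "real D / (16 * \<theta>) \<le> real D / 16" using th1 by (intro divide_left_mono) auto
    hence s1D: "16 * real s1 \<le> real D" using s1(2) by linarith
    define b where "b n = (\<Sum>w\<in>W. kern n (w - x))" for n
    have b0: "b n \<ge> 0" for n unfolding b_def by (intro sum_nonneg) auto
    define Y where "Y = (32 * C1) ^ ?d * (\<theta> ^ ?d / real D ^ ?d)"
    define Z where "Z = (16 * C1) ^ ?d / real D ^ ?d"
    have Y0: "Y \<ge> 0" and Z0: "Z \<ge> 0" using C1 th1 by (auto simp: Y_def Z_def)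
    have sep: "2 * int k < linf (w - w')" if "8 * k \<le> D" "w \<in> W" "w' \<in> W" "w \<noteq> w'" for k w w'
      using pairwiseD[OF W(2) that(2-4)] that(1) D16 by linarith
    have small: "b n \<le> 1 / real D ^ ?d" if n: "n < s1\<^sup>2" for n
    proof -
      \<comment> \<open>For n at most (D / (16 \<theta>))^2 and distance at least D/2, this t gives
        the exponent 16 \<theta>^2 - 32 \<theta>^2 = - 16 \<theta>^2.\<close>
      define t where "t = 64 * \<theta>\<^sup>2 / real D"
      have t: "0 \<le> t" "t \<le> 1" using th D16 by (auto simp: t_def)
      have n2: "real n \<le> (real D / (16 * \<theta>))\<^sup>2"
      proof -
        have "real n \<le> (real s1)\<^sup>2" using n by (metis less_imp_le of_nat_le_iff of_nat_power)
        also have "\<dots> \<le> (real D / (16 * \<theta>))\<^sup>2" using s1 by (intro power_mono) auto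
        finally show ?thesis .
      qed
      have kx: "kern n (w - x) \<le> exp (- 16 * \<theta>\<^sup>2)" if "w \<in> W" for w
      proof -
        have "kern n (w - x) \<le> exp (real n * t\<^sup>2 - t * of_int (linf (w - x)))" by (rule kern_exp_le[OF t])
        also have "\<dots> \<le> exp ((real D / (16 * \<theta>))\<^sup>2 * t\<^sup>2 - t * (real D / 2))"
        proof -
          have "real D / 2 \<le> of_int (linf (w - x))" using Wx that by fastforce
          thus ?thesis using t n2 by (simp only: exp_le_cancel_iff) (intro diff_mono mult_right_mono mult_left_mono, auto)
        qed
        also have "(real D / (16 * \<theta>))\<^sup>2 * t\<^sup>2 - t * (real D / 2) = - 16 * \<theta>\<^sup>2"
        proof -
          have "(real D / (16 * \<theta>))\<^sup>2 * t\<^sup>2 = (real D / (16 * \<theta>) * t)\<^sup>2" by (rule power_mult_distrib[symmetric])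
          also have "real D / (16 * \<theta>) * t = 4 * \<theta>" using th1 D16 by (simp add: t_def power2_eq_square)
          finally show ?thesis using D16 by (simp add: t_def power_mult_distrib)
        qed
        finally show ?thesis .
      qed
      \<comment> \<open>W may be arbitrarily large, but the walk cannot leave this box by time n <=
        D^2. The box has at most (3 D^2)^d points, a power of D that exp(- 16 \<theta>^2) overcomes
        since \<theta> >= d.\<close>
      define W' where "W' = W \<inter> zbox x (real D ^ 2)"
      have nD: "real n \<le> real D ^ 2"
      proof -
        have "real D / (16 * \<theta>) \<le> real D / 1" using th1 by (intro divide_left_mono) auto
        hence "(real D / (16 * \<theta>))\<^sup>2 \<le> (real D)\<^sup>2" using ge1 by (intro power_mono) auto
        thus ?thesis using n2 by linarith
      qed
      have "b n = (\<Sum>w\<in>W'. kern n (w - x))"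
        unfolding b_def
      proof (rule sum.mono_neutral_right)
        show "\<forall>w\<in>W - W'. kern n (w - x) = 0"
        proof
          fix w assume "w \<in> W - W'"
          hence "\<not> real_of_int (linf (w - x)) \<le> (real D)\<^sup>2" by (auto simp: W'_def zbox_def)
          hence "int n < linf (w - x)" using nD by linarith
          thus "kern n (w - x) = 0" by (rule kern_eq_0)
        qed
      qed (use W in \<open>auto simp: W'_def\<close>)
      also have "\<dots> \<le> (\<Sum>w\<in>W'. exp (- 16 * \<theta>\<^sup>2))" by (intro sum_mono kx) (simp add: W'_def)
      also have "\<dots> = real (card W') * exp (- 16 * \<theta>\<^sup>2)" by simp
      also have "\<dots> \<le> (3 * real D ^ 2) ^ ?d * exp (- 16 * \<theta>\<^sup>2)"
      proof (intro mult_right_mono)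
        have "real (card W') \<le> real (card (zbox x (real D ^ 2)))"
          unfolding W'_def by (simp add: card_mono)
        also have "\<dots> \<le> (3 * real D ^ 2) ^ ?d" using D16 by (intro card_zbox_bounds) auto
        finally show "real (card W') \<le> (3 * real D ^ 2) ^ ?d" .
      qed simp
      also have "\<dots> \<le> (exp 2 * exp \<theta> ^ 2) ^ ?d * exp (- 16 * \<theta>\<^sup>2)"
        using exp_ge_add_one_self[of 2] Dth
        by (intro mult_right_mono power_mono mult_mono) auto
      also have "\<dots> = exp (real ?d * (2 + 2 * \<theta>) - 16 * \<theta>\<^sup>2)"
        by (simp add: exp_of_nat_mult[symmetric] exp_add[symmetric] exp_diff[symmetric] algebra_simps)
      also have "\<dots> \<le> exp (- (real ?d * \<theta>))"
      proof -
        have "real ?d * (2 + 3 * \<theta>) \<le> \<theta> * (2 * \<theta> + 3 * \<theta>)"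
          using th th1 by (intro mult_mono add_mono) auto
        hence "real ?d * (2 + 2 * \<theta>) + real ?d * \<theta> \<le> 5 * \<theta>\<^sup>2"
          by (simp add: power2_eq_square algebra_simps)
        moreover have "0 \<le> \<theta>\<^sup>2" by (rule zero_le_power2)
        ultimately show ?thesis unfolding exp_le_cancel_iff by linarith
      qed
      also have "\<dots> = 1 / real D ^ ?d" by (simp add: Dth exp_minus exp_of_nat_mult inverse_eq_divide)
      finally show ?thesis .
    qed
    have middle: "b n \<le> Y" if n: "s1\<^sup>2 \<le> n" for n
    proof -
      have "b n \<le> (C1 / real s1) ^ ?d"
        unfolding b_def C1_def using n s1D sep s1 W
        by (intro sum_kern_separated) auto
      also have "\<dots> \<le> (32 * C1 * \<theta> / real D) ^ ?d"
      proof (intro power_mono)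
        have "C1 / real s1 = 2 * C1 / (2 * real s1)" by simp
        also have "\<dots> \<le> 2 * C1 / (real D / (16 * \<theta>))"
          using s1 C1 ge1 by (intro divide_left_mono mult_pos_pos) auto
        also have "\<dots> = 32 * C1 * \<theta> / real D" by simp
        finally show "C1 / real s1 \<le> 32 * C1 * \<theta> / real D" .
      qed (use C1 in auto)
      finally show ?thesis by (simp add: Y_def power_divide power_mult_distrib)
    qed
    have large: "b n \<le> Z" if n: "s\<^sup>2 \<le> n" for n
    proof -
      have "b n \<le> (C1 / real s) ^ ?d"
        unfolding b_def C1_def using n sep s W
        by (intro sum_kern_separated) auto
      also have "\<dots> \<le> (16 * C1 / real D) ^ ?d"
      proof (intro power_mono)
        have "C1 / real s = 16 * C1 / (16 * real s)" by simp
        also have "\<dots> \<le> 16 * C1 / real D"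
          using s C1 D16 by (intro divide_left_mono mult_pos_pos) auto
        finally show "C1 / real s \<le> 16 * C1 / real D" .
      qed (use C1 in auto)
      finally show ?thesis by (simp add: Z_def power_divide)
    qed
    have b_le: "b n \<le> 1 / real D ^ ?d + Z + (if n < s\<^sup>2 then Y else 0)" for n
    proof -
      have P0: "0 \<le> 1 / real D ^ ?d" by simp
      have if0: "0 \<le> (if n < s\<^sup>2 then Y else 0)" using Y0 by simp
      consider "n < s1\<^sup>2" | "s1\<^sup>2 \<le> n" "n < s\<^sup>2" | "s\<^sup>2 \<le> n" by linarith
      thus ?thesis
      proof cases
        case 1
        show ?thesis using small[OF 1] P0 Z0 if0 by linarith
      next
        case 2
        have "(if n < s\<^sup>2 then Y else 0) = Y" using 2 by simp
        thus ?thesis using middle[OF 2(1)] P0 Z0 by linarith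
      next
        case 3
        show ?thesis using large[OF 3] P0 if0 by linarith
      qed
    qed
    have "(\<Sum>n<Suc T. if n < s\<^sup>2 then Y else 0) \<le> (\<Sum>n<s\<^sup>2. Y)"
    proof -
      have "(\<Sum>n<Suc T. if n < s\<^sup>2 then Y else 0) = (\<Sum>n\<in>{..<Suc T} \<inter> {n. n < s\<^sup>2}. Y)"
        by (subst sum.inter_restrict) simp_all
      also have "\<dots> \<le> (\<Sum>n<s\<^sup>2. Y)" using Y0 by (intro sum_mono2) auto
      finally show ?thesis .
    qed
    also have "\<dots> = (real s)\<^sup>2 * Y" by simp
    also have "\<dots> \<le> (real D)\<^sup>2 * Y" using s Y0 by (intro mult_right_mono power_mono) auto
    also have "\<dots> = (32 * C1) ^ ?d * ((real D)\<^sup>2 * \<theta> ^ ?d) / real D ^ ?d" by (simp add: Y_def)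
    also have "\<dots> \<le> (32 * C1) ^ ?d * real T / real D ^ ?d"
      using T C1 by (intro divide_right_mono mult_left_mono) (auto simp: \<theta>_def)
    finally have 1: "(\<Sum>n<Suc T. if n < s\<^sup>2 then Y else 0) \<le> (32 * C1) ^ ?d * real T / real D ^ ?d" .
    have T1: "1 \<le> real T"
    proof -
      have "1 * 1 \<le> (real D)\<^sup>2 * \<theta> ^ ?d" using D16 th1 by (intro mult_mono one_le_power) auto
      thus ?thesis using T by (simp add: \<theta>_def)
    qed
    have "(\<Sum>n<Suc T. b n) \<le> (\<Sum>n<Suc T. (1 / real D ^ ?d + Z) + (if n < s\<^sup>2 then Y else 0))"
      by (intro sum_mono b_le)
    also have "\<dots> = (real T + 1) * (1 / real D ^ ?d + Z) + (\<Sum>n<Suc T. if n < s\<^sup>2 then Y else 0)"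
      by (simp only: sum.distrib sum_constant card_lessThan of_nat_Suc) (simp add: ring_distribs add_divide_distrib)
    also have "\<dots> \<le> (2 * real T) * (1 / real D ^ ?d + Z) + (32 * C1) ^ ?d * real T / real D ^ ?d"
      using T1 Z0 by (intro add_mono mult_right_mono 1) auto
    also have "\<dots> = C * real T / real D ^ ?d"
      by (simp add: C_def Z_def add_divide_distrib algebra_simps)
    finally show "(\<Sum>n<Suc T. \<Sum>w\<in>W. kern n (w - x)) \<le> C * real T / real D ^ ?d"
      by (simp add: b_def)
  qed
qed

section \<open>Density and visibility for separated boxes\<close>

lemma zbox_separated:
  assumes "8 * l \<le> real D" "int D \<le> linf (y - y')" "w \<in> zbox y l" "w' \<in> zbox y' l"
  shows "int D \<le> 2 * linf (w - w')"
proof -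
  have "linf (y - y') \<le> linf (y - w) + linf (w - y')" by (rule linf_triangle)
  also have "linf (w - y') \<le> linf (w - w') + linf (w' - y')" by (rule linf_triangle)
  finally have "linf (y - y') \<le> \<lfloor>l\<rfloor> + linf (w - w') + \<lfloor>l\<rfloor>"
    using assms(3,4) by (simp add: mem_zbox_iff linf_minus[of y w])
  moreover have "8 * \<lfloor>l\<rfloor> \<le> int D" using assms(1) by linarith
  ultimately show ?thesis using assms(2) by linarith
qed

lemma zbox_disjoint:
  assumes "8 * l \<le> real D" "int D \<le> linf (y - y')" "D \<ge> 1"
  shows "zbox y l \<inter> zbox y' l = {}"
proof (rule ccontr)
  assume "zbox y l \<inter> zbox y' l \<noteq> {}"
  then obtain w where "w \<in> zbox y l" "w \<in> zbox y' l" by auto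
  hence "int D \<le> 2 * linf (w - w)" by (rule zbox_separated[OF assms(1,2)])
  also have "linf (w - w) \<le> 0" by (simp add: linf_le_iff)
  finally show False using assms(3) by simp
qed

text \<open>Only the second half of the time interval is counted: there the kernel is at least of
  order T^(-d/2) at all the points of A.\<close>

lemma occ_ge_near:
  fixes x :: "int ^ 'd"
  assumes near: "\<And>u. u \<in> A \<Longrightarrow> 16 * (real CARD('d))\<^sup>2 * (of_int (linf (u - x)))\<^sup>2 \<le> real T / 2"
    and T: "T \<ge> 1"
  shows "real T / 2 * (real (card A) * (1 / (2 * 4 ^ CARD('d)) / sqrt (2 * real T) ^ CARD('d))) \<le> occ A T x"
proof -
  let ?k = "1 / (2 * 4 ^ CARD('d)) / sqrt (2 * real T) ^ CARD('d)"
  have k: "?k \<le> kern n (u - x)" if n: "n \<in> {T div 2 + 1..T}" and u: "u \<in> A" for n u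
  proof (rule kern_ge_scale)
    have "T \<le> 2 * n" using n by auto
    hence "real T / 2 \<le> real n" by linarith
    thus "16 * (real CARD('d))\<^sup>2 * (of_int (linf (u - x)))\<^sup>2 \<le> real n" using near[OF u] by linarith
    show "sqrt (real n + 1) \<le> sqrt (2 * real T)" using n T by (intro real_sqrt_le_mono) auto
  qed
  have "real T / 2 \<le> real (card {T div 2 + 1..T})"
  proof -
    have "T \<le> 2 * card {T div 2 + 1..T}" by simp
    thus ?thesis by linarith
  qed
  hence "real T / 2 * (real (card A) * ?k) \<le> real (card {T div 2 + 1..T}) * (real (card A) * ?k)"
    by (intro mult_right_mono) auto
  also have "\<dots> = (\<Sum>n\<in>{T div 2 + 1..T}. \<Sum>u\<in>A. ?k)" by simp
  also have "\<dots> \<le> (\<Sum>n\<in>{T div 2 + 1..T}. \<Sum>u\<in>A. kern n (u - x))"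
    using k by (intro sum_mono) auto
  also have "\<dots> \<le> occ A T x" unfolding occ_def by (intro sum_mono2 sum_nonneg) auto
  finally show ?thesis .
qed

text \<open>Time reversal: by symmetry of the kernel, summing over starting points is summing over
  end points, which gives at most 1 for each time and each point of A.\<close>

lemma sum_occ_le:
  assumes "finite V" "finite A"
  shows "(\<Sum>x\<in>V. occ A T x) \<le> (real T + 1) * real (card A)"
proof -
  have "(\<Sum>x\<in>V. occ A T x) = (\<Sum>n<Suc T. \<Sum>u\<in>A. \<Sum>x\<in>V. kern n (u - x))"
    unfolding occ_def by (subst sum.swap) (rule sum.cong[OF refl], rule sum.swap)
  also have "\<dots> \<le> (\<Sum>n<Suc T. \<Sum>u\<in>A. 1)"
    using assms by (intro sum_mono) (subst kern_sym, rule sum_kern_translate_le_1)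
  also have "\<dots> = (real T + 1) * real (card A)" by (simp add: algebra_simps)
  finally show ?thesis .
qed

lemma eight_mult_le_of_cube_le:
  fixes l X :: real
  assumes "l \<ge> 1" "l ^ 3 \<le> X" "24 \<le> X"
  shows "8 * l \<le> X"
proof (cases "l \<ge> 3")
  case True
  have "9 * l \<le> (l * l) * l" using True mult_mono[of 3 l 3 l] by (intro mult_right_mono) auto
  also have "\<dots> = l ^ 3" by (simp add: power3_eq_cube)
  finally show ?thesis using assms by linarith
qed (use assms in auto)

text \<open>With R = T l^(d-2), the gain is of order R and the loss is quadratic: visits to one
  other box have total mass O(R) over the starting points, and reaching B from there, summed over
  all other boxes, has probability O(R / D^d). As R <= e D^d, a small e leaves half of the gain. The
  hypothesis relating r to D lets a cube of side about sqrt T around b fit into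
  \<open>zbox 0 r\<close>.\<close>

lemma density_separated_boxes:
  assumes d: "CARD('d) \<ge> 3"
  obtains c D0 where "c > 0"
    "\<And>D l (Y :: (int ^ 'd) set) y0 r b. D \<ge> D0 \<Longrightarrow> l \<ge> 1 \<Longrightarrow> l ^ 3 \<le> real D \<Longrightarrow> finite Y \<Longrightarrow>
      pairwise (\<lambda>y y'. int D \<le> linf (y - y')) Y \<Longrightarrow>
      y0 \<in> Y \<Longrightarrow> b \<in> zbox y0 l \<Longrightarrow> b \<in> zbox 0 r \<Longrightarrow> r \<ge> 0 \<Longrightarrow>
      real D ^ CARD('d) \<le> r\<^sup>2 * l ^ (CARD('d) - 2) \<Longrightarrow>
      \<exists>T. c * real D ^ CARD('d) \<le>
        (\<Sum>x\<in>zbox 0 r. first_hit (\<Union>y\<in>Y. zbox y l) (zbox y0 l) T x)"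
proof -
  let ?d = "CARD('d)"
  define Kl where "Kl = 1 / (2 * 4 ^ ?d :: real)"
  have Kl: "Kl > 0" by (simp add: Kl_def)
  obtain C where C: "C \<ge> 1"
    "\<And>l (y :: int ^ 'd) T z. l \<ge> 1 \<Longrightarrow> occ (zbox y l) T z \<le> C * l\<^sup>2"
    by (rule occ_zbox_le[OF d]) (rule that)
  obtain co A where co: "co > 0" and A: "A \<ge> 1" and occ_ge:
    "\<And>l (y :: int ^ 'd) S z. l \<ge> 1 \<Longrightarrow> z \<in> zbox y l \<Longrightarrow> A * l\<^sup>2 \<le> real S \<Longrightarrow> co * l\<^sup>2 \<le> occ (zbox y l) S z"
    by (rule occ_zbox_ge[where 'd = 'd]) (rule that)
  obtain C2 D2 where C2: "C2 \<ge> 1" and far: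
    "\<And>D T W (x :: int ^ 'd). D \<ge> D2 \<Longrightarrow> (real D)\<^sup>2 * ln (real D) ^ ?d \<le> real T \<Longrightarrow> finite W \<Longrightarrow>
      pairwise (\<lambda>w w'. int D \<le> 2 * linf (w - w')) W \<Longrightarrow> \<forall>w\<in>W. int D \<le> 2 * linf (w - x) \<Longrightarrow>
      (\<Sum>n<Suc T. \<Sum>w\<in>W. kern n (w - x)) \<le> C2 * real T / real D ^ ?d"
    by (rule sum_kern_time_separated[where 'd = 'd]) (rule that)
  \<comment> \<open>The hitting mass will be at least 2 c1 R and the loss at most C3 R^2 / D^d; e is
    chosen so that the loss is at most c1 R.\<close>
  define c1 where "c1 = Kl / (4 * C * (16 * real ?d) ^ ?d)"
  define C3 where "C3 = (3 ^ ?d * 2 * C2 / co) * (3 * 3 ^ ?d / co)"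
  define e where "e = min 1 (c1 / C3)"
  have c1: "c1 > 0" using Kl C by (simp add: c1_def)
  have C3: "C3 > 0" using co C2 by (simp add: C3_def)
  have e: "0 < e" "e \<le> 1" using c1 C3 by (auto simp: e_def)
  have "C3 * e \<le> C3 * (c1 / C3)" using C3 by (intro mult_left_mono) (auto simp: e_def)
  hence e3: "C3 * e \<le> c1" using C3 by simp
  define a0 where "a0 = A + 72 * (16 * (real ?d)\<^sup>2)"
  have a0: "a0 \<ge> 1" using A by (simp add: a0_def add_increasing2)
  have "eventually (\<lambda>x::real. ln x ^ ?d \<le> x powr (1/4)) at_top"
    by (intro eventually_ln_power_le) auto
  moreover have "eventually (\<lambda>x::real. x\<^sup>2 * x powr (1/4) \<le> e * (x\<^sup>2 * sqrt x) - 1) at_top"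
    using e(1) by real_asymp
  moreover have "eventually (\<lambda>x::real. a0 * x \<le> e * (x\<^sup>2 * sqrt x) - 1) at_top"
    using e(1) by real_asymp
  ultimately have "eventually (\<lambda>x::real. x\<^sup>2 * ln x ^ ?d \<le> e * (x\<^sup>2 * sqrt x) - 1 \<and>
      a0 * x \<le> e * (x\<^sup>2 * sqrt x) - 1) at_top"
  proof eventually_elim
    case (elim x)
    have "x\<^sup>2 * ln x ^ ?d \<le> x\<^sup>2 * x powr (1/4)" by (intro mult_left_mono elim) auto
    thus ?case using elim by linarith
  qed
  then obtain x0 :: real where x0: "\<And>x. x \<ge> x0 \<Longrightarrow> x\<^sup>2 * ln x ^ ?d \<le> e * (x\<^sup>2 * sqrt x) - 1 \<and>
      a0 * x \<le> e * (x\<^sup>2 * sqrt x) - 1"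
    by (auto simp: eventually_at_top_linorder)
  show ?thesis
  proof (rule that[of "c1 * e / 2" "max (max 24 D2) (nat \<lceil>x0\<rceil>)"])
    show "c1 * e / 2 > 0" using c1 e by simp
    fix D l r and Y :: "(int ^ 'd) set" and y0 b
    assume D: "D \<ge> max (max 24 D2) (nat \<lceil>x0\<rceil>)" and l: "l \<ge> 1" and lD: "l ^ 3 \<le> real D"
      and Y: "finite Y" "pairwise (\<lambda>y y'. int D \<le> linf (y - y')) Y"
      and y0: "y0 \<in> Y" and b: "b \<in> zbox y0 l" "b \<in> zbox 0 r" and r: "r \<ge> 0"
      and rD: "real D ^ ?d \<le> r\<^sup>2 * l ^ (?d - 2)"
    have "D \<ge> 24 \<and> D \<ge> D2 \<and> real D \<ge> x0" using D by (simp add: nat_le_iff ceiling_le_iff)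
    hence D24: "D \<ge> 24" "D \<ge> D2" "real D \<ge> x0" by auto
    have l8: "8 * l \<le> real D" by (rule eight_mult_le_of_cube_le[OF l lD]) (use D24 in simp)
    have l2D: "l\<^sup>2 \<le> real D"
      using power_increasing[of 2 3 l] l lD by simp
    \<comment> \<open>One cell volume divided by the capacity order l^(d-2), which is the time after
      which the walk typically meets an obstacle. T is the fraction e of it. Since l^2 <= D and d >=
      3, q is at least D^2 sqrt(D), well beyond the time scale of
      \<open>sum_kern_time_separated\<close>.\<close>
    define q where "q = real D ^ ?d / l ^ (?d - 2)"
    have l0: "l ^ (?d - 2) > 0" using l by simp
    have q_ge: "(real D)\<^sup>2 * sqrt (real D) \<le> q"
    proof -
      have "l * sqrt (real D) \<le> sqrt (real D) * sqrt (real D)"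
        using l2D by (intro mult_right_mono real_le_rsqrt) auto
      hence sq: "sqrt (real D) \<le> real D / l" using l by (simp add: le_divide_eq mult.commute)
      have "1 \<le> real D / l" using l8 l by (simp add: le_divide_eq)
      hence "(real D / l) ^ 1 \<le> (real D / l) ^ (?d - 2)" using d by (intro power_increasing) auto
      hence "(real D)\<^sup>2 * sqrt (real D) \<le> (real D)\<^sup>2 * (real D / l) ^ (?d - 2)"
        using sq by (intro mult_left_mono) auto
      also have "\<dots> = real D ^ (2 + (?d - 2)) / l ^ (?d - 2)" by (simp only: power_add power_divide) simp
      also have "2 + (?d - 2) = ?d" using d by simp
      finally show ?thesis by (simp add: q_def)
    qed
    define T where "T = nat \<lfloor>e * q\<rfloor>"
    have q0: "q > 0" using l D24 by (simp add: q_def)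
    have Tle: "real T \<le> e * q" using e q0 by (simp add: T_def)
    have Tge: "e * ((real D)\<^sup>2 * sqrt (real D)) - 1 \<le> real T"
    proof -
      have "e * ((real D)\<^sup>2 * sqrt (real D)) \<le> e * q" using e q_ge by (intro mult_left_mono) auto
      thus ?thesis unfolding T_def by linarith
    qed
    have TD: "(real D)\<^sup>2 * ln (real D) ^ ?d \<le> real T" and Ta: "a0 * real D \<le> real T"
      using x0[OF D24(3)] Tge by linarith+
    have "1 * 24 \<le> a0 * real D" using a0 D24 by (intro mult_mono) auto
    hence T1: "real T \<ge> 1" using Ta by linarith
    hence Tgt: "e * q \<le> 2 * real T" unfolding T_def by linarith
    have Tl: "a0 * l\<^sup>2 \<le> real T"
    proof -
      have "a0 * l\<^sup>2 \<le> a0 * real D" using a0 l2D by (intro mult_left_mono) auto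
      thus ?thesis using Ta by simp
    qed
    have TA: "A * l\<^sup>2 \<le> real T"
    proof -
      have "A * l\<^sup>2 \<le> a0 * l\<^sup>2" by (intro mult_right_mono) (auto simp: a0_def)
      thus ?thesis using Tl by simp
    qed
    have Td: "72 * (16 * (real ?d)\<^sup>2) * l\<^sup>2 \<le> real T"
    proof -
      have "72 * (16 * (real ?d)\<^sup>2) * l\<^sup>2 \<le> a0 * l\<^sup>2" using A by (intro mult_right_mono) (auto simp: a0_def)
      thus ?thesis using Tl by simp
    qed
    \<comment> \<open>Then 16 d^2 (2 \<rho>r)^2 = T/2, the threshold of \<open>occ_ge_near\<close>
      for points at distance 2 \<rho>r. The lower bound on T makes \<rho>r at least 3 l, so the box
      radius is absorbed.\<close>
    define \<rho>r where "\<rho>r = sqrt (real T / (128 * (real ?d)\<^sup>2))"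
    define \<rho> where "\<rho> = \<lfloor>\<rho>r\<rfloor>"
    have \<rho>r2: "128 * (real ?d)\<^sup>2 * \<rho>r\<^sup>2 = real T" by (simp add: \<rho>r_def)
    have \<rho>r3: "3 * l \<le> \<rho>r"
    proof (rule power2_le_imp_le)
      have "128 * (real ?d)\<^sup>2 * (3 * l)\<^sup>2 \<le> 128 * (real ?d)\<^sup>2 * \<rho>r\<^sup>2"
        unfolding \<rho>r2 using Td by (simp add: power_mult_distrib)
      thus "(3 * l)\<^sup>2 \<le> \<rho>r\<^sup>2" by (rule mult_left_le_imp_le) simp
    qed (simp add: \<rho>r_def)
    have \<rho>: "0 \<le> \<rho>" "real_of_int \<rho> \<le> \<rho>r" "\<rho>r \<le> real_of_int \<rho> + 1" "2 * l \<le> real_of_int \<rho>"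
      using \<rho>r3 l unfolding \<rho>_def by linarith+
    \<comment> \<open>A cube with corner b, extended towards 0 in every coordinate: b may sit at a
      corner of \<open>zbox 0 r\<close>, and V must stay inside.\<close>
    define V where "V = {x. \<forall>i. x $ i \<in> (if b $ i \<ge> 0 then {b $ i - \<rho>..b $ i} else {b $ i..b $ i + \<rho>})}"
    have finV: "finite V" unfolding V_def by (rule finite_vec_box) auto
    have cardV: "real (card V) = (real_of_int \<rho> + 1) ^ ?d"
    proof -
      have "card V = (\<Prod>i\<in>(UNIV :: 'd set). card (if b $ i \<ge> 0 then {b $ i - \<rho>..b $ i} else {b $ i..b $ i + \<rho>}))"
        unfolding V_def by (rule finite_vec_box) auto
      also have "\<dots> = (\<Prod>i\<in>(UNIV :: 'd set). nat (\<rho> + 1))"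
        using \<rho>(1) by (intro prod.cong) auto
      finally show ?thesis using \<rho>(1) by simp
    qed
    have Vb: "linf (x - b) \<le> \<rho>" if "x \<in> V" for x
      unfolding linf_le_iff
    proof
      fix i
      have "x $ i \<in> (if b $ i \<ge> 0 then {b $ i - \<rho>..b $ i} else {b $ i..b $ i + \<rho>})"
        using that by (auto simp: V_def)
      thus "\<bar>(x - b) $ i\<bar> \<le> \<rho>" using \<rho>(1) by (auto split: if_splits)
    qed
    have Vr: "V \<subseteq> zbox 0 r"
    proof
      fix x assume x: "x \<in> V"
      have "\<rho>r \<le> r"
      proof (rule power2_le_imp_le)
        have "1 \<le> (real ?d)\<^sup>2" by (simp add: Suc_leI)
        hence "1 * \<rho>r\<^sup>2 \<le> 128 * (real ?d)\<^sup>2 * \<rho>r\<^sup>2" by (intro mult_right_mono) (linarith, simp)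
        also have "\<dots> \<le> 1 * q" unfolding \<rho>r2 using Tle mult_right_mono[OF e(2), of q] q0 by linarith
        also have "\<dots> \<le> r\<^sup>2" using rD l0 by (simp add: q_def divide_le_eq)
        finally show "\<rho>r\<^sup>2 \<le> r\<^sup>2" by simp
      qed (rule r)
      hence \<rho>_le: "\<rho> \<le> \<lfloor>r\<rfloor>" unfolding \<rho>_def by (rule floor_mono)
      have "\<bar>x $ i\<bar> \<le> \<lfloor>r\<rfloor>" for i
      proof -
        have "x $ i \<in> (if b $ i \<ge> 0 then {b $ i - \<rho>..b $ i} else {b $ i..b $ i + \<rho>})"
          using x by (auto simp: V_def)
        moreover have "\<bar>b $ i\<bar> \<le> \<lfloor>r\<rfloor>" using b(2) abs_le_linf[of b i] by (simp add: mem_zbox_iff)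
        ultimately show ?thesis using \<rho>_le by (auto split: if_splits)
      qed
      thus "x \<in> zbox 0 r" by (simp add: mem_zbox_iff linf_le_iff)
    qed
    define B where "B = zbox y0 l"
    define U where "U = (\<Union>y\<in>Y. zbox y l)"
    define R where "R = real T * l ^ (?d - 2)"
    have R0: "R \<ge> 0" using l by (simp add: R_def)
    have "2 + (?d - 2) = ?d" using d by simp
    hence ld: "l ^ ?d = l\<^sup>2 * l ^ (?d - 2)" by (metis power_add)

    have "2 * c1 * R \<le> (\<Sum>x\<in>V. hit B T x)"
    proof -
      let ?t = "sqrt (2 * real T)"
      have t0: "?t > 0" using T1 by simp
      have rt: "?t \<le> 16 * real ?d * (real_of_int \<rho> + 1)"
      proof -
        have "0 \<le> \<rho>r" using \<rho>r3 l by linarith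
        have "(16 * real ?d * \<rho>r)\<^sup>2 = 2 * (128 * (real ?d)\<^sup>2 * \<rho>r\<^sup>2)"
          by (simp add: power_mult_distrib)
        hence "?t = sqrt ((16 * real ?d * \<rho>r)\<^sup>2)" by (simp only: \<rho>r2)
        also have "\<dots> = 16 * real ?d * \<rho>r" using \<open>0 \<le> \<rho>r\<close> by (simp only: real_sqrt_abs) simp
        also have "\<dots> \<le> 16 * real ?d * (real_of_int \<rho> + 1)" using \<rho> by (intro mult_left_mono) auto
        finally show ?thesis .
      qed
      have occB: "real T / 2 * (l ^ ?d * (Kl / ?t ^ ?d)) \<le> C * l\<^sup>2 * hit B T x" if x: "x \<in> V" for x
      proof -
        have "real T / 2 * (l ^ ?d * (Kl / ?t ^ ?d)) \<le> real T / 2 * (real (card B) * (Kl / ?t ^ ?d))"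
          using l Kl unfolding B_def by (intro mult_left_mono mult_right_mono card_zbox_bounds) auto
        also have "\<dots> \<le> occ B T x"
          unfolding Kl_def
        proof (rule occ_ge_near)
          fix u assume u: "u \<in> B"
          have "linf (u - x) \<le> linf (u - y0) + linf (y0 - x)" by (rule linf_triangle)
          also have "linf (y0 - x) \<le> linf (y0 - b) + linf (b - x)" by (rule linf_triangle)
          finally have "linf (u - x) \<le> \<lfloor>l\<rfloor> + \<lfloor>l\<rfloor> + \<rho>"
            using u b(1) Vb[OF x] unfolding B_def mem_zbox_iff linf_minus[of y0 b] linf_minus[of b x]
            by linarith
          hence "real_of_int (linf (u - x)) \<le> 2 * \<rho>r" using \<rho> by linarith
          hence "(real_of_int (linf (u - x)))\<^sup>2 \<le> (2 * \<rho>r)\<^sup>2" by (intro power_mono) auto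
          hence "16 * (real ?d)\<^sup>2 * (real_of_int (linf (u - x)))\<^sup>2 \<le> 16 * (real ?d)\<^sup>2 * (2 * \<rho>r)\<^sup>2"
            by (intro mult_left_mono) auto
          also have "\<dots> = real T / 2" using \<rho>r2 by (simp add: power_mult_distrib)
          finally show "16 * (real ?d)\<^sup>2 * (real_of_int (linf (u - x)))\<^sup>2 \<le> real T / 2" .
        qed (use T1 in simp)
        also have "\<dots> \<le> C * l\<^sup>2 * hit B T x"
          by (rule occ_le_hit[of B T]) (auto simp: B_def intro: C(2)[OF l])
        finally show ?thesis .
      qed
      have "C * l\<^sup>2 * (2 * c1 * R) = real T / 2 * (l ^ ?d * Kl) * (1 / (16 * real ?d) ^ ?d)"
        using C(1) l by (simp add: c1_def R_def ld mult_ac)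
      also have "\<dots> \<le> real T / 2 * (l ^ ?d * Kl) * (real (card V) / ?t ^ ?d)"
      proof (intro mult_left_mono)
        have "?t ^ ?d \<le> (16 * real ?d * (real_of_int \<rho> + 1)) ^ ?d"
          using rt by (intro power_mono) auto
        also have "\<dots> = (16 * real ?d) ^ ?d * real (card V)" by (simp only: cardV power_mult_distrib)
        finally show "1 / (16 * real ?d) ^ ?d \<le> real (card V) / ?t ^ ?d"
          using t0 by (simp add: divide_le_eq le_divide_eq mult.commute)
      qed (use l Kl in auto)
      also have "\<dots> = (\<Sum>x\<in>V. real T / 2 * (l ^ ?d * (Kl / ?t ^ ?d)))" by simp
      also have "\<dots> \<le> (\<Sum>x\<in>V. C * l\<^sup>2 * hit B T x)" by (intro sum_mono occB)
      also have "\<dots> = C * l\<^sup>2 * (\<Sum>x\<in>V. hit B T x)" by (simp add: sum_distrib_left)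
      finally show ?thesis by (rule mult_left_le_imp_le) (use C l in auto)
    qed
    moreover have "(\<Sum>x\<in>V. hit B T x) \<le> (\<Sum>x\<in>V. first_hit U B T x) + c1 * R"
    proof -
      \<comment> \<open>The worst starting point w of each box serves as the bound required by
        \<open>hit_le_first_hit\<close>. One point per box keeps the family separated, so
        \<open>far\<close> applies to it.\<close>
      have "\<exists>w. w \<in> zbox y l \<and> (\<forall>w'\<in>zbox y l. hit B T w' \<le> hit B T w)" for y
      proof -
        have "y \<in> zbox y l" using l by (simp add: mem_zbox_iff linf_le_iff)
        hence ne: "hit B T ` zbox y l \<noteq> {}" by auto
        have "Max (hit B T ` zbox y l) \<in> hit B T ` zbox y l" using ne by (intro Max_in) auto
        then obtain w where w: "w \<in> zbox y l" "Max (hit B T ` zbox y l) = hit B T w" by auto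
        have "hit B T w' \<le> hit B T w" if "w' \<in> zbox y l" for w'
          unfolding w(2)[symmetric] using that by (intro Max_ge) auto
        thus ?thesis using w by blast
      qed
      then obtain w where w: "\<And>y. w y \<in> zbox y l" "\<And>y w'. w' \<in> zbox y l \<Longrightarrow> hit B T w' \<le> hit B T (w y)"
        by metis
      define I where "I = Y - {y0}"
      have finI: "finite I" using Y by (simp add: I_def)
      have sepI: "int D \<le> 2 * linf (v - v')" if "y \<in> Y" "y' \<in> Y" "y \<noteq> y'" "v \<in> zbox y l" "v' \<in> zbox y' l" for y y' v v'
        by (rule zbox_separated[OF l8 pairwiseD[OF Y(2) that(1-3)] that(4,5)])
      have injw: "inj_on w I"
      proof (rule inj_onI, rule ccontr)
        fix y y' assume y: "y \<in> I" "y' \<in> I" "w y = w y'" "y \<noteq> y'"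
        hence "int D \<le> 2 * linf (w y - w y')" using w(1)[of y] w(1)[of y'] by (intro sepI[of y y']) (auto simp: I_def)
        also have "linf (w y - w y') \<le> 0" using y by (simp add: linf_le_iff)
        finally show False using D24 by simp
      qed
      \<comment> \<open>The horizon doubles: T steps to reach the box and T more, at least A l^2, to
        collect order l^2 visits there.\<close>
      have hit_occ: "co * l\<^sup>2 * hit (zbox y l) T x \<le> occ (zbox y l) (2 * T) x" for y x :: "int ^ 'd"
        unfolding mult_2
      proof (rule hit_le_occ)
        fix z assume "z \<in> zbox y l"
        thus "co * l\<^sup>2 \<le> occ (zbox y l) T z" by (rule occ_ge[OF l _ TA])
      qed simp
      have "co * l\<^sup>2 * (\<Sum>y\<in>I. hit B T (w y)) = (\<Sum>y\<in>I. co * l\<^sup>2 * hit B T (w y))"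
        by (simp add: sum_distrib_left)
      also have "\<dots> \<le> (\<Sum>y\<in>I. occ B (2 * T) (w y))" unfolding B_def by (intro sum_mono hit_occ)
      \<comment> \<open>The sums are exchanged so that, for each u in B, symmetry of the kernel
        leaves a sum over the separated points \<open>w y\<close> seen from u.\<close>
      also have "\<dots> = (\<Sum>u\<in>B. \<Sum>n<Suc (2 * T). \<Sum>y\<in>I. kern n (u - w y))"
        unfolding occ_def
        by (subst sum.swap, subst sum.swap[of _ _ B], intro sum.cong refl, rule sum.swap)
      also have "\<dots> \<le> (\<Sum>u\<in>B. C2 * real (2 * T) / real D ^ ?d)"
      proof (rule sum_mono)
        fix u assume u: "u \<in> B"
        have "(\<Sum>n<Suc (2 * T). \<Sum>y\<in>I. kern n (u - w y)) = (\<Sum>n<Suc (2 * T). \<Sum>v\<in>w ` I. kern n (v - u))"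
          by (simp only: sum.reindex[OF injw] o_def kern_sym[of _ u])
        also have "\<dots> \<le> C2 * real (2 * T) / real D ^ ?d"
        proof (rule far)
          show "(real D)\<^sup>2 * ln (real D) ^ ?d \<le> real (2 * T)" using TD by simp
          show "pairwise (\<lambda>v v'. int D \<le> 2 * linf (v - v')) (w ` I)"
            by (auto simp: pairwise_def I_def intro: sepI w(1))
          show "\<forall>v\<in>w ` I. int D \<le> 2 * linf (v - u)"
            using u y0 by (auto simp: I_def B_def intro: sepI[of _ y0] w(1))
        qed (use D24 finI in auto)
        finally show "(\<Sum>n<Suc (2 * T). \<Sum>y\<in>I. kern n (u - w y)) \<le> C2 * real (2 * T) / real D ^ ?d" .
      qed
      also have "\<dots> = real (card B) * (C2 * real (2 * T) / real D ^ ?d)" by simp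
      also have "\<dots> \<le> (3 * l) ^ ?d * (C2 * real (2 * T) / real D ^ ?d)"
        unfolding B_def using l C2 by (intro mult_right_mono card_zbox_bounds) auto
      also have "\<dots> = co * l\<^sup>2 * ((3 ^ ?d * 2 * C2 / co) * (R / real D ^ ?d))"
        using co by (simp add: R_def ld power_mult_distrib)
      finally have SM: "(\<Sum>y\<in>I. hit B T (w y)) \<le> (3 ^ ?d * 2 * C2 / co) * (R / real D ^ ?d)"
        by (rule mult_left_le_imp_le) (use co l in auto)
      have SV: "(\<Sum>x\<in>V. hit (zbox y l) T x) \<le> (3 * 3 ^ ?d / co) * R" for y
      proof -
        have "co * l\<^sup>2 * (\<Sum>x\<in>V. hit (zbox y l) T x) \<le> (\<Sum>x\<in>V. occ (zbox y l) (2 * T) x)"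
          unfolding sum_distrib_left by (intro sum_mono hit_occ)
        also have "\<dots> \<le> (real (2 * T) + 1) * real (card (zbox y l))" by (intro sum_occ_le finV) simp
        also have "\<dots> \<le> (3 * real T) * (3 * l) ^ ?d"
          using T1 l by (intro mult_mono card_zbox_bounds) auto
        also have "\<dots> = co * l\<^sup>2 * ((3 * 3 ^ ?d / co) * R)"
          using co by (simp add: R_def ld power_mult_distrib)
        finally show ?thesis by (rule mult_left_le_imp_le) (use co l in auto)
      qed
      have "(\<Sum>x\<in>V. hit B T x) \<le> (\<Sum>x\<in>V. first_hit U B T x + (\<Sum>y\<in>I. hit B T (w y) * hit (zbox y l) T x))"
      proof (intro sum_mono hit_le_first_hit[where T = T])
        show "U = B \<union> (\<Union>y\<in>I. zbox y l)" using y0 by (auto simp: U_def B_def I_def)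
      qed (use finI w hit_bounds in auto)
      also have "\<dots> = (\<Sum>x\<in>V. first_hit U B T x) + (\<Sum>y\<in>I. hit B T (w y) * (\<Sum>x\<in>V. hit (zbox y l) T x))"
        by (subst sum.distrib, subst sum.swap) (simp add: sum_distrib_left)
      also have "\<dots> \<le> (\<Sum>x\<in>V. first_hit U B T x) + (\<Sum>y\<in>I. hit B T (w y) * ((3 * 3 ^ ?d / co) * R))"
        by (intro add_mono sum_mono mult_left_mono SV hit_bounds order.refl)
      also have "(\<Sum>y\<in>I. hit B T (w y) * ((3 * 3 ^ ?d / co) * R)) = (\<Sum>y\<in>I. hit B T (w y)) * ((3 * 3 ^ ?d / co) * R)"
        by (rule sum_distrib_right[symmetric])
      also have "\<dots> \<le> ((3 ^ ?d * 2 * C2 / co) * (R / real D ^ ?d)) * ((3 * 3 ^ ?d / co) * R)"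
        using R0 co by (intro mult_right_mono SM) auto
      also have "\<dots> = C3 * (R * (R / real D ^ ?d))" by (simp add: C3_def mult_ac)
      also have "\<dots> \<le> C3 * (R * e)"
      proof (intro mult_left_mono)
        have "R \<le> e * q * l ^ (?d - 2)" unfolding R_def using Tle l by (intro mult_right_mono) auto
        also have "\<dots> = e * real D ^ ?d" using l by (simp add: q_def)
        finally show "R / real D ^ ?d \<le> e" using D24 by (simp add: divide_le_eq)
      qed (use R0 C3 in auto)
      also have "\<dots> \<le> c1 * R" using mult_right_mono[OF e3 R0] by (simp add: mult_ac)
      finally show ?thesis by simp
    qed
    ultimately have "c1 * R \<le> (\<Sum>x\<in>V. first_hit U B T x)" by linarith
    moreover have "c1 * e / 2 * real D ^ ?d \<le> c1 * R"
    proof -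
      have "e * real D ^ ?d = e * q * l ^ (?d - 2)" using l by (simp add: q_def)
      also have "\<dots> \<le> 2 * real T * l ^ (?d - 2)" using Tgt l by (intro mult_right_mono) auto
      finally have "c1 * (e * real D ^ ?d) \<le> c1 * (2 * R)" using c1 by (intro mult_left_mono) (auto simp: R_def)
      thus ?thesis by simp
    qed
    moreover have "(\<Sum>x\<in>V. first_hit U B T x) \<le> (\<Sum>x\<in>zbox 0 r. first_hit U B T x)"
      by (intro sum_mono2 Vr) (auto simp flip: measure_walk_law_first_hit)
    ultimately show "\<exists>T. c1 * e / 2 * real D ^ ?d \<le>
        (\<Sum>x\<in>zbox 0 r. first_hit (\<Union>y\<in>Y. zbox y l) (zbox y0 l) T x)"
      unfolding U_def B_def by (intro exI[of _ T]) linarith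
  qed
qed

text \<open>With R = T (l/D)^d, the expected number of visits to the union is at least of order R,
  since at least a fixed fraction of all cells within 11 \<rho> is occupied and T is comparable to
  \<rho>^2. From a point of the union it is at most l^2 for its own box plus order R for the others,
  and D^d <= T l^(d-2) says that l^2 <= R. The quotient is a constant.\<close>

lemma visibility_separated_boxes:
  assumes d: "CARD('d) \<ge> 3"
  obtains c D0 where "c > 0"
    "\<And>D l (Y :: (int ^ 'd) set) x T \<rho>. D \<ge> D0 \<Longrightarrow> l \<ge> 1 \<Longrightarrow> 8 * l \<le> real D \<Longrightarrow> finite Y \<Longrightarrow>
      pairwise (\<lambda>y y'. int D \<le> linf (y - y')) Y \<Longrightarrow>
      (real D)\<^sup>2 * ln (real D) ^ CARD('d) \<le> real T \<Longrightarrow> real D ^ CARD('d) \<le> real T * l ^ (CARD('d) - 2) \<Longrightarrow>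
      T \<ge> 1 \<Longrightarrow> \<rho> > 0 \<Longrightarrow> \<rho> ^ CARD('d) \<le> real (card Y) * (6 * real D) ^ CARD('d) \<Longrightarrow>
      \<forall>y\<in>Y. real_of_int (linf (y - x)) + l \<le> 11 * \<rho> \<Longrightarrow>
      32 * (real CARD('d))\<^sup>2 * (11 * \<rho>)\<^sup>2 \<le> real T \<Longrightarrow> real T \<le> 64 * (real CARD('d))\<^sup>2 * (11 * \<rho>)\<^sup>2 \<Longrightarrow>
      c \<le> hit (\<Union>y\<in>Y. zbox y l) T x"
proof -
  let ?d = "CARD('d)"
  define Kl where "Kl = 1 / (2 * 4 ^ ?d :: real)"
  have Kl: "Kl > 0" by (simp add: Kl_def)
  obtain C where C: "C \<ge> 1"
    "\<And>l (y :: int ^ 'd) T z. l \<ge> 1 \<Longrightarrow> occ (zbox y l) T z \<le> C * l\<^sup>2"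
    by (rule occ_zbox_le[OF d]) (rule that)
  obtain C2 D2 where C2: "C2 \<ge> 1" and far:
    "\<And>D T W (x :: int ^ 'd). D \<ge> D2 \<Longrightarrow> (real D)\<^sup>2 * ln (real D) ^ ?d \<le> real T \<Longrightarrow> finite W \<Longrightarrow>
      pairwise (\<lambda>w w'. int D \<le> 2 * linf (w - w')) W \<Longrightarrow> \<forall>w\<in>W. int D \<le> 2 * linf (w - x) \<Longrightarrow>
      (\<Sum>n<Suc T. \<Sum>w\<in>W. kern n (w - x)) \<le> C2 * real T / real D ^ ?d"
    by (rule sum_kern_time_separated[where 'd = 'd]) (rule that)
  define c4 where "c4 = Kl / (2 * (6 * (16 * real ?d * 11)) ^ ?d)"
  define C5 where "C5 = C + 3 ^ ?d * C2"
  have c4: "c4 > 0" using Kl by (simp add: c4_def)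
  have C5: "C5 > 0" using C C2 by (simp add: C5_def add_pos_pos)
  show ?thesis
  proof (rule that[of "c4 / C5" "max 1 D2"])
    show "c4 / C5 > 0" using c4 C5 by simp
    fix D l \<rho> T and Y :: "(int ^ 'd) set" and x
    assume D: "D \<ge> max 1 D2" and l: "l \<ge> 1" and l8: "8 * l \<le> real D"
      and Y: "finite Y" "pairwise (\<lambda>y y'. int D \<le> linf (y - y')) Y"
      and TD: "(real D)\<^sup>2 * ln (real D) ^ ?d \<le> real T" and DT: "real D ^ ?d \<le> real T * l ^ (?d - 2)"
      and T1: "T \<ge> 1" and \<rho>: "\<rho> > 0" and cardY: "\<rho> ^ ?d \<le> real (card Y) * (6 * real D) ^ ?d"
      and near: "\<forall>y\<in>Y. real_of_int (linf (y - x)) + l \<le> 11 * \<rho>"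
      and T\<rho>: "32 * (real ?d)\<^sup>2 * (11 * \<rho>)\<^sup>2 \<le> real T" "real T \<le> 64 * (real ?d)\<^sup>2 * (11 * \<rho>)\<^sup>2"
    define U where "U = (\<Union>y\<in>Y. zbox y l)"
    have finU: "finite U" using Y by (simp add: U_def)
    define R where "R = real T * (l / real D) ^ ?d"
    have D1: "D \<ge> 1" "D \<ge> D2" using D by auto
    have R0: "R > 0" using T1 l D1 by (simp add: R_def)
    have disj: "zbox y l \<inter> zbox y' l = {}" if "y \<in> Y" "y' \<in> Y" "y \<noteq> y'" for y y'
      by (rule zbox_disjoint[OF l8 pairwiseD[OF Y(2) that] D1(1)])
    have "2 + (?d - 2) = ?d" using d by simp
    hence ld: "l ^ ?d = l\<^sup>2 * l ^ (?d - 2)" by (metis power_add)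
    have cardU: "real (card Y) * l ^ ?d \<le> real (card U)"
    proof -
      have "card U = (\<Sum>y\<in>Y. card (zbox y l))"
        unfolding U_def using Y(1) disj by (intro card_UN_disjoint) auto
      hence "real (card U) = (\<Sum>y\<in>Y. real (card (zbox y l)))" by simp
      also have "\<dots> \<ge> (\<Sum>y\<in>Y. l ^ ?d)" using l by (intro sum_mono card_zbox_bounds)
      finally show ?thesis by simp
    qed
    have lower: "c4 * R \<le> occ U T x"
    proof -
      let ?t = "sqrt (2 * real T)"
      have t0: "?t > 0" using T1 by simp
      have rt: "?t \<le> 16 * real ?d * 11 * \<rho>"
      proof -
        have "(16 * real ?d * 11 * \<rho>)\<^sup>2 = 4 * (64 * (real ?d)\<^sup>2 * (11 * \<rho>)\<^sup>2)"
          by (simp add: power_mult_distrib)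
        moreover have "0 \<le> 64 * (real ?d)\<^sup>2 * (11 * \<rho>)\<^sup>2" by simp
        ultimately have "?t \<le> sqrt ((16 * real ?d * 11 * \<rho>)\<^sup>2)"
          using T\<rho>(2) by (intro real_sqrt_le_mono) linarith
        thus ?thesis using \<rho> by simp
      qed
      have "c4 * R = real T / 2 * Kl * (1 / (16 * real ?d * 11)) ^ ?d * (l ^ ?d / (6 * real D) ^ ?d)"
      proof -
        define P where "P = (16 * real ?d * 11) ^ ?d"
        have "c4 = Kl / (2 * (6 ^ ?d * P))" unfolding c4_def P_def by (subst power_mult_distrib) simp
        moreover have "(1 / (16 * real ?d * 11)) ^ ?d = 1 / P" unfolding P_def by (rule power_one_over)
        moreover have "(6 * real D) ^ ?d = 6 ^ ?d * real D ^ ?d" by (rule power_mult_distrib)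
        moreover have "(l / real D) ^ ?d = l ^ ?d / real D ^ ?d" by (rule power_divide)
        ultimately show ?thesis by (simp add: R_def mult_ac)
      qed
      also have "\<dots> \<le> real T / 2 * Kl * (\<rho> / ?t) ^ ?d * (l ^ ?d / (6 * real D) ^ ?d)"
      proof (intro mult_right_mono mult_left_mono power_mono)
        show "1 / (16 * real ?d * 11) \<le> \<rho> / ?t"
          using rt t0 by (simp add: divide_le_eq le_divide_eq mult_ac)
      qed (use l Kl in auto)
      also have "\<dots> = real T / 2 * (\<rho> ^ ?d / (6 * real D) ^ ?d * l ^ ?d * (Kl / ?t ^ ?d))"
        by (simp add: power_divide mult_ac)
      also have "\<dots> \<le> real T / 2 * (real (card Y) * l ^ ?d * (Kl / ?t ^ ?d))"
        using cardY l Kl D1 by (intro mult_left_mono mult_right_mono) (auto simp: divide_le_eq)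
      also have "\<dots> \<le> real T / 2 * (real (card U) * (Kl / ?t ^ ?d))"
        using Kl by (intro mult_left_mono mult_right_mono cardU) auto
      also have "\<dots> \<le> occ U T x"
        unfolding Kl_def
      proof (rule occ_ge_near[OF _ T1])
        fix u assume "u \<in> U"
        then obtain y where y: "y \<in> Y" "u \<in> zbox y l" by (auto simp: U_def)
        have "real_of_int (linf (u - x)) \<le> real_of_int (linf (u - y) + linf (y - x))"
          by (simp only: of_int_le_iff linf_triangle)
        also have "\<dots> \<le> l + real_of_int (linf (y - x))" using y(2) by (simp add: zbox_def)
        also have "\<dots> \<le> 11 * \<rho>" using near y(1) by (simp add: add.commute)
        finally have "(real_of_int (linf (u - x)))\<^sup>2 \<le> (11 * \<rho>)\<^sup>2" by (intro power_mono) auto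
        hence "16 * (real ?d)\<^sup>2 * (real_of_int (linf (u - x)))\<^sup>2 \<le> 16 * (real ?d)\<^sup>2 * (11 * \<rho>)\<^sup>2"
          by (intro mult_left_mono) auto
        thus "16 * (real ?d)\<^sup>2 * (real_of_int (linf (u - x)))\<^sup>2 \<le> real T / 2" using T\<rho>(1) by linarith
      qed
      finally show ?thesis .
    qed
    have upper: "occ U T z \<le> C5 * R" if z: "z \<in> U" for z
    proof -
      obtain y1 where y1: "y1 \<in> Y" "z \<in> zbox y1 l" using z by (auto simp: U_def)
      let ?I = "Y - {y1}"
      \<comment> \<open>The other boxes are cut into translates of the set of centres, one for each
        offset v, because \<open>far\<close> handles one point per box.\<close>
      have split: "(\<Sum>u\<in>U. f u) = (\<Sum>u\<in>zbox y1 l. f u) + (\<Sum>v\<in>zbox 0 l. \<Sum>y\<in>?I. f (y + v))" for f :: "int ^ 'd \<Rightarrow> real"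
      proof -
        have "(\<Sum>u\<in>U. f u) = (\<Sum>y\<in>Y. \<Sum>u\<in>zbox y l. f u)"
          unfolding U_def using Y(1) disj by (intro sum.UNION_disjoint) auto
        also have "\<dots> = (\<Sum>u\<in>zbox y1 l. f u) + (\<Sum>y\<in>?I. \<Sum>u\<in>zbox y l. f u)"
          using Y(1) y1 by (subst sum.remove[of _ y1]) auto
        also have "(\<Sum>y\<in>?I. \<Sum>u\<in>zbox y l. f u) = (\<Sum>y\<in>?I. \<Sum>v\<in>zbox 0 l. f (y + v))"
        proof (rule sum.cong[OF refl])
          fix y
          show "(\<Sum>u\<in>zbox y l. f u) = (\<Sum>v\<in>zbox 0 l. f (y + v))"
            by (subst zbox_translate[of y], subst sum.reindex) (auto simp: inj_on_def)
        qed
        also have "\<dots> = (\<Sum>v\<in>zbox 0 l. \<Sum>y\<in>?I. f (y + v))" by (rule sum.swap)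
        finally show ?thesis .
      qed
      have "occ U T z = occ (zbox y1 l) T z + (\<Sum>n<Suc T. \<Sum>v\<in>zbox 0 l. \<Sum>y\<in>?I. kern n (y + v - z))"
        unfolding occ_def split sum.distrib ..
      also have "(\<Sum>n<Suc T. \<Sum>v\<in>zbox 0 l. \<Sum>y\<in>?I. kern n (y + v - z)) =
         (\<Sum>v\<in>zbox 0 l. \<Sum>n<Suc T. \<Sum>y\<in>?I. kern n (y + v - z))" by (rule sum.swap)
      also have "\<dots> \<le> (\<Sum>v\<in>zbox (0 :: int ^ 'd) l. C2 * real T / real D ^ ?d)"
      proof (rule sum_mono)
        fix v :: "int ^ 'd" assume v: "v \<in> zbox 0 l"
        have yv: "y + v \<in> zbox y l" for y using v by (simp add: mem_zbox_iff)
        have "(\<Sum>n<Suc T. \<Sum>y\<in>?I. kern n (y + v - z)) = (\<Sum>n<Suc T. \<Sum>w\<in>(\<lambda>y. y + v) ` ?I. kern n (w - z))"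
          by (rule sum.cong[OF refl], subst sum.reindex) (auto simp: inj_on_def)
        also have "\<dots> \<le> C2 * real T / real D ^ ?d"
        proof (rule far[OF D1(2) TD])
          show "finite ((\<lambda>y. y + v) ` ?I)" using Y by simp
          show "pairwise (\<lambda>w w'. int D \<le> 2 * linf (w - w')) ((\<lambda>y. y + v) ` ?I)"
          proof (rule pairwise_imageI)
            fix y y' assume "y \<in> ?I" "y' \<in> ?I" "y \<noteq> y'"
            thus "int D \<le> 2 * linf (y + v - (y' + v))"
              by (intro zbox_separated[OF l8 pairwiseD[OF Y(2)] yv yv]) auto
          qed
          show "\<forall>w\<in>(\<lambda>y. y + v) ` ?I. int D \<le> 2 * linf (w - z)"
          proof
            fix w assume "w \<in> (\<lambda>y. y + v) ` ?I"
            then obtain y where "y \<in> Y" "y \<noteq> y1" "w = y + v" by auto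
            thus "int D \<le> 2 * linf (w - z)"
              using zbox_separated[OF l8 pairwiseD[OF Y(2)] yv y1(2), of y] y1(1) by auto
          qed
        qed
        finally show "(\<Sum>n<Suc T. \<Sum>y\<in>?I. kern n (y + v - z)) \<le> C2 * real T / real D ^ ?d" .
      qed
      also have "\<dots> = real (card (zbox (0 :: int ^ 'd) l)) * (C2 * real T / real D ^ ?d)" by simp
      also have "\<dots> \<le> (3 * l) ^ ?d * (C2 * real T / real D ^ ?d)"
        using l C2 by (intro mult_right_mono card_zbox_bounds) auto
      also have "\<dots> = 3 ^ ?d * C2 * R" by (simp add: R_def power_mult_distrib power_divide)
      also have "occ (zbox y1 l) T z \<le> C * R"
      proof -
        have "l\<^sup>2 * real D ^ ?d \<le> l\<^sup>2 * (real T * l ^ (?d - 2))" by (intro mult_left_mono DT) auto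
        hence "l\<^sup>2 \<le> R" using D1 by (simp add: R_def power_divide ld le_divide_eq mult_ac)
        hence "C * l\<^sup>2 \<le> C * R" using C by (intro mult_left_mono) auto
        thus ?thesis using C(2)[OF l, of y1 T z] by linarith
      qed
      finally show ?thesis by (simp add: C5_def algebra_simps)
    qed
    have "c4 * R \<le> C5 * R * hit U T x"
      using lower occ_le_hit[OF finU upper order.refl, of x] by linarith
    hence "R * c4 \<le> R * (C5 * hit U T x)" by (simp add: mult_ac)
    hence "c4 \<le> C5 * hit U T x" by (rule mult_left_le_imp_le) (rule R0)
    thus "c4 / C5 \<le> hit (\<Union>y\<in>Y. zbox y l) T x"
      using C5 by (simp add: U_def divide_le_eq mult.commute)
  qed
qed

section \<open>Cells and scales\<close>

lemma inner_boundary_zbox_subset: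
  "inner_boundary (zbox c N) \<subseteq> {v. \<exists>i. v $ i = c $ i + \<lfloor>N\<rfloor> \<or> v $ i = c $ i - \<lfloor>N\<rfloor>}"
proof
  fix v assume "v \<in> inner_boundary (zbox c N)"
  then obtain u where v: "v \<in> zbox c N" and u: "u \<notin> zbox c N" "nearest_neighbor u v"
    by (auto simp: inner_boundary_def)
  then obtain i where i: "\<bar>u $ i - c $ i\<bar> > \<lfloor>N\<rfloor>"
    by (auto simp: mem_zbox_iff linf_le_iff not_le)
  have "\<bar>v $ i - c $ i\<bar> \<le> \<lfloor>N\<rfloor>" using v by (auto simp: mem_zbox_iff linf_le_iff)
  moreover have "\<bar>u $ i - v $ i\<bar> \<le> (\<Sum>j\<in>UNIV. \<bar>u $ j - v $ j\<bar>)"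
    by (intro member_le_sum[where f = "\<lambda>j. \<bar>u $ j - v $ j\<bar>"]) auto
  hence "\<bar>u $ i - v $ i\<bar> \<le> 1" using u(2) by (simp add: nearest_neighbor_def)
  ultimately have "v $ i = c $ i + \<lfloor>N\<rfloor> \<or> v $ i = c $ i - \<lfloor>N\<rfloor>" using i by linarith
  thus "v \<in> {v. \<exists>i. v $ i = c $ i + \<lfloor>N\<rfloor> \<or> v $ i = c $ i - \<lfloor>N\<rfloor>}" by blast
qed

text \<open>The candidates start at z, z + 4p and z + 8p. A point spoils a only if it lies strictly
  between a - p and a + 2p; these ranges are disjoint, so f and g spoil at most two
  candidates.\<close>

lemma interval_avoiding_two_points:
  fixes z f g m p :: int
  assumes "0 \<le> m" "m < p"
  shows "\<exists>a. z \<le> a \<and> a \<le> z + 8 * p \<and> (\<forall>t\<in>{a..a + p}. m < \<bar>t - f\<bar> \<and> m < \<bar>t - g\<bar>)"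
proof -
  define ok where "ok h a \<longleftrightarrow> h \<le> a - p \<or> a + 2 * p \<le> h" for h a
  have "\<forall>t\<in>{a..a + p}. m < \<bar>t - h\<bar>" if "ok h a" for h a
    using that assms by (auto simp: ok_def)
  hence *: ?thesis if "ok f a" "ok g a" "z \<le> a" "a \<le> z + 8 * p" for a
    using that by blast
  have "ok h z \<or> ok h (z + 4 * p)" "ok h z \<or> ok h (z + 8 * p)"
    "ok h (z + 4 * p) \<or> ok h (z + 8 * p)" for h
    using assms unfolding ok_def by linarith+
  thus ?thesis using *[of z] *[of "z + 4 * p"] *[of "z + 8 * p"] assms by fastforce
qed

lemma card_multiples_ge:
  fixes a e p :: int
  assumes "e > 0" "p \<ge> 0"
  shows "nat ((p + 1) div e) \<le> card {t \<in> {a..a + p}. e dvd t}"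
proof -
  \<comment> \<open>The least multiple of e that is at least a.\<close>
  define b where "b = a + (- a) mod e"
  have b: "e dvd b" "a \<le> b" "b < a + e"
    using assms by (auto simp: b_def mod_eq_0_iff_dvd[symmetric] mod_add_right_eq)
  let ?J = "{0..<(p + 1) div e}"
  have "(\<lambda>j. b + e * j) ` ?J \<subseteq> {t \<in> {a..a + p}. e dvd t}"
  proof
    fix t assume "t \<in> (\<lambda>j. b + e * j) ` ?J"
    then obtain j where j: "0 \<le> j" "j + 1 \<le> (p + 1) div e" "t = b + e * j" by auto
    have "e * (j + 1) \<le> e * ((p + 1) div e)" using assms j by (intro mult_left_mono) auto
    also have "\<dots> = p + 1 - (p + 1) mod e" by (rule minus_mod_eq_mult_div[symmetric])
    also have "\<dots> \<le> p + 1" using assms by simp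
    finally have "e * j + e \<le> p + 1" by (simp only: distrib_left mult_1_right)
    hence "t \<le> a + p" using b j by linarith
    moreover have "0 \<le> e * j" using j assms by simp
    hence "a \<le> t" using b j by linarith
    ultimately show "t \<in> {t \<in> {a..a + p}. e dvd t}" using b j by simp
  qed
  hence "card ((\<lambda>j. b + e * j) ` ?J) \<le> card {t \<in> {a..a + p}. e dvd t}"
    by (rule card_mono[rotated]) (rule finite_subset[of _ "{a..a + p}"], auto)
  moreover have "card ((\<lambda>j. b + e * j) ` ?J) = nat ((p + 1) div e)"
    using assms by (subst card_image) (auto simp: inj_on_def)
  ultimately show ?thesis by simp
qed

text \<open>The boundary of a box lies in two hyperplanes per coordinate direction, so among three
  well separated intervals of each coordinate at least one stays away from both.\<close>

lemma many_cells_off_boundary: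
  fixes \<Lambda> :: "(int ^ 'd) set" and z :: "int ^ 'd" and D p :: int
  assumes \<Lambda>: "(\<exists>x N. N \<ge> 0 \<and> \<Lambda> = zbox x N) \<or> \<Lambda> = {}" and D: "D \<ge> 1" "2 * D < p"
  obtains W where "finite W" "\<forall>w\<in>W. (\<forall>i. 3 * D dvd w $ i) \<and> linf (w - z) \<le> 9 * p \<and>
      zbox w (2 * of_int D) \<inter> inner_boundary \<Lambda> = {}"
    "nat ((p + 1) div (3 * D)) ^ CARD('d) \<le> card W"
proof -
  obtain f g :: "int ^ 'd" where fg: "inner_boundary \<Lambda> \<subseteq> {v. \<exists>i. v $ i = f $ i \<or> v $ i = g $ i}"
  proof (cases "\<Lambda> = {}")
    case True
    show ?thesis by (rule that[of 0 0]) (simp add: True inner_boundary_def)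
  next
    case False
    then obtain x N where "\<Lambda> = zbox x N" using \<Lambda> by blast
    thus ?thesis using inner_boundary_zbox_subset[of x N]
      by (intro that[of "\<chi> i. x $ i + \<lfloor>N\<rfloor>" "\<chi> i. x $ i - \<lfloor>N\<rfloor>"]) simp
  qed
  have "\<forall>i. \<exists>a. z $ i \<le> a \<and> a \<le> z $ i + 8 * p \<and>
      (\<forall>t\<in>{a..a + p}. 2 * D < \<bar>t - f $ i\<bar> \<and> 2 * D < \<bar>t - g $ i\<bar>)"
    using D by (intro allI interval_avoiding_two_points) auto
  then obtain a where a: "\<And>i. z $ i \<le> a i" "\<And>i. a i \<le> z $ i + 8 * p"
    "\<And>i t. t \<in> {a i..a i + p} \<Longrightarrow> 2 * D < \<bar>t - f $ i\<bar> \<and> 2 * D < \<bar>t - g $ i\<bar>" by metis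
  define M where "M i = {t \<in> {a i..a i + p}. 3 * D dvd t}" for i
  have finM: "finite (M i)" for i by (rule finite_subset[of _ "{a i..a i + p}"]) (auto simp: M_def)
  define W where "W = {w. \<forall>i. w $ i \<in> M i}"
  show ?thesis
  proof (rule that[of W])
    show "finite W" unfolding W_def by (rule finite_vec_box) (rule finM)
    show "\<forall>w\<in>W. (\<forall>i. 3 * D dvd w $ i) \<and> linf (w - z) \<le> 9 * p \<and>
      zbox w (2 * of_int D) \<inter> inner_boundary \<Lambda> = {}"
    proof (intro ballI conjI allI)
      fix w assume w: "w \<in> W"
      have wi: "w $ i \<in> {a i..a i + p}" for i using w by (auto simp: W_def M_def)
      show "3 * D dvd w $ i" for i using w by (auto simp: W_def M_def)
      show "linf (w - z) \<le> 9 * p"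
        unfolding linf_le_iff
      proof
        fix i show "\<bar>(w - z) $ i\<bar> \<le> 9 * p" using wi[of i] a(1,2)[of i] by simp
      qed
      show "zbox w (2 * of_int D) \<inter> inner_boundary \<Lambda> = {}"
      proof (rule ccontr)
        assume "zbox w (2 * of_int D) \<inter> inner_boundary \<Lambda> \<noteq> {}"
        then obtain v i where v: "v \<in> zbox w (2 * of_int D)" "v $ i = f $ i \<or> v $ i = g $ i"
          using fg by blast
        have "\<lfloor>2 * real_of_int D\<rfloor> = 2 * D" by linarith
        hence "\<bar>v $ i - w $ i\<bar> \<le> 2 * D" using v(1) by (auto simp: mem_zbox_iff linf_le_iff)
        thus False using a(3)[OF wi[of i]] v(2) by auto
      qed
    qed
    have "nat ((p + 1) div (3 * D)) ^ CARD('d) = (\<Prod>i\<in>(UNIV :: 'd set). nat ((p + 1) div (3 * D)))" by simp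
    also have "\<dots> \<le> (\<Prod>i\<in>UNIV. card (M i))"
      unfolding M_def using D by (intro prod_mono conjI card_multiples_ge) auto
    also have "\<dots> = card W" unfolding W_def by (rule finite_vec_box(2)[symmetric, OF finM])
    finally show "nat ((p + 1) div (3 * D)) ^ CARD('d) \<le> card W" .
  qed
qed

lemma linf_ge_of_dvd:
  assumes "\<forall>i. e dvd w $ i" "\<forall>i. e dvd w' $ i" "w \<noteq> w'"
  shows "e \<le> linf (w - w')"
proof -
  obtain i where i: "w $ i \<noteq> w' $ i" using assms(3) by (auto simp: vec_eq_iff)
  have "e dvd w $ i - w' $ i" using assms by auto
  hence "e \<le> \<bar>(w - w') $ i\<bar>" using i zdvd_imp_le[of e "\<bar>w $ i - w' $ i\<bar>"] by simp
  thus ?thesis using abs_le_linf order_trans by blast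
qed

text \<open>In the application D <= L^(2/5), so L^(4/5) bounds D^2, and the fourth condition makes
  one period L / u^11 longer than D^2 times any needed constant or logarithm. It holds because u^11
  <= L^(11/300) and log^k L <= L^(1/100). The exponent 1/(k+1) stays strictly below 1/d for k = d
  and makes D large.\<close>

lemma scale_conditions:
  assumes "\<gamma> > (0::real)"
  shows "eventually (\<lambda>L::nat. ln (real L) \<ge> 1 \<and> ln (real L) powr \<gamma> \<ge> U0 \<and>
    ln (real L) powr \<gamma> \<le> real L powr (1 / 300) \<and>
    (A + ln (real L) ^ k) * real L powr (4 / 5) + 1 \<le> real L / (ln (real L) powr \<gamma>) ^ 11 \<and>
    real L powr (1 / (real k + 1)) \<ge> D0 \<and> 8 * real L powr (2 / 5) \<le> real L \<and> 36 * sqrt (real L) \<le> real L) sequentially"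
proof -
  have "eventually (\<lambda>x::real. ln x ^ k \<le> x powr (1 / 100)) at_top"
    by (rule eventually_ln_power_le) simp
  moreover have "eventually (\<lambda>x::real. (A + x powr (1 / 100)) * x powr (4 / 5) + 1 \<le> x / x powr (11 / 300)) at_top"
    by real_asymp
  moreover have "eventually (\<lambda>x::real. ln x powr \<gamma> \<le> x powr (1 / 300)) at_top"
    using assms by real_asymp
  moreover have "eventually (\<lambda>x::real. ln x powr \<gamma> \<ge> max 1 U0) at_top"
    using assms by real_asymp
  moreover have "eventually (\<lambda>x::real. ln x \<ge> 1) at_top" by real_asymp
  moreover have "eventually (\<lambda>x::real. x powr (1 / (real k + 1)) \<ge> D0) at_top" by real_asymp
  moreover have "eventually (\<lambda>x::real. 8 * x powr (2 / 5) \<le> x) at_top" by real_asymp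
  moreover have "eventually (\<lambda>x::real. 36 * sqrt x \<le> x) at_top" by real_asymp
  moreover have "eventually (\<lambda>x::real. x > 0) at_top" by (rule eventually_gt_at_top)
  ultimately have "eventually (\<lambda>x::real. ln x \<ge> 1 \<and> ln x powr \<gamma> \<ge> U0 \<and> ln x powr \<gamma> \<le> x powr (1 / 300) \<and>
    (A + ln x ^ k) * x powr (4 / 5) + 1 \<le> x / (ln x powr \<gamma>) ^ 11 \<and>
    x powr (1 / (real k + 1)) \<ge> D0 \<and> 8 * x powr (2 / 5) \<le> x \<and> 36 * sqrt x \<le> x) at_top"
  proof eventually_elim
    case (elim x)
    have "(A + ln x ^ k) * x powr (4 / 5) + 1 \<le> (A + x powr (1 / 100)) * x powr (4 / 5) + 1"
      using elim by (intro add_mono mult_right_mono) auto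
    also have "\<dots> \<le> x / x powr (11 / 300)" by (rule elim)
    also have "\<dots> \<le> x / (ln x powr \<gamma>) ^ 11"
    proof (intro divide_left_mono mult_pos_pos)
      have "(ln x powr \<gamma>) ^ 11 \<le> (x powr (1 / 300)) ^ 11" using elim by (intro power_mono) auto
      also have "\<dots> = x powr (11 / 300)" using elim by (simp add: powr_powr flip: powr_realpow)
      finally show "(ln x powr \<gamma>) ^ 11 \<le> x powr (11 / 300)" .
    qed (use elim in auto)
    finally show ?case using elim by auto
  qed
  thus ?thesis using filterlim_real_sequentially unfolding filterlim_iff by blast
qed

theorem proposition6p1:
  assumes "CARD('d::finite) \<ge> 3"
  shows "\<exists>c::real. c > 0 \<and> (\<forall>\<gamma>::real. \<gamma> > 10 \<longrightarrow>
    (\<exists>L0::nat. \<forall>(L::nat) (K::nat) (\<Lambda> :: (int ^ 'd) set) (l::real) (Lt::int)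
        (y :: (int ^ 'd) set \<Rightarrow> int ^ 'd).
      L \<ge> 1 \<and> L \<ge> L0 \<and>
      ((\<exists>x N. N \<ge> 0 \<and> \<Lambda> = zbox x N) \<or> \<Lambda> = {}) \<and>
      ln (real L) powr (100 * \<gamma>) \<le> l \<and> l \<le> real L powr (1 / (3 * real CARD('d))) \<and>
      Lt = \<lfloor>(alpha \<gamma> L * real L * l powr ((real CARD('d) - 2) / 2)) powr (1 / real CARD('d))\<rfloor> \<and>
      (\<forall>C \<in> cells K L Lt \<Lambda>. y C \<in> C) \<longrightarrow>
      good_obstacle_set K L \<gamma>
        (exp (- c * ln (real L) powr \<gamma>)) (c * l powr ((real CARD('d) - 2) / 2))
        {zbox (y C) l | C. C \<in> cells K L Lt \<Lambda>} l
        (\<Union>C \<in> cells K L Lt \<Lambda>. zbox (y C) l)))"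
proof -
  let ?d = "CARD('d)"
  have d: "?d \<ge> 3" by (rule assms)
  obtain cd Dd where cd: "cd > 0" and density:
    "\<And>D l (Y :: (int ^ 'd) set) y0 r b. D \<ge> Dd \<Longrightarrow> l \<ge> 1 \<Longrightarrow> l ^ 3 \<le> real D \<Longrightarrow> finite Y \<Longrightarrow>
      pairwise (\<lambda>y y'. int D \<le> linf (y - y')) Y \<Longrightarrow>
      y0 \<in> Y \<Longrightarrow> b \<in> zbox y0 l \<Longrightarrow> b \<in> zbox 0 r \<Longrightarrow> r \<ge> 0 \<Longrightarrow>
      real D ^ ?d \<le> r\<^sup>2 * l ^ (?d - 2) \<Longrightarrow>
      \<exists>T. cd * real D ^ ?d \<le> (\<Sum>x\<in>zbox 0 r. first_hit (\<Union>y\<in>Y. zbox y l) (zbox y0 l) T x)"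
    by (rule density_separated_boxes[OF d]) (rule that)
  obtain cv Dv where cv: "cv > 0" and visibility:
    "\<And>D l (Y :: (int ^ 'd) set) x T \<rho>. D \<ge> Dv \<Longrightarrow> l \<ge> 1 \<Longrightarrow> 8 * l \<le> real D \<Longrightarrow> finite Y \<Longrightarrow>
      pairwise (\<lambda>y y'. int D \<le> linf (y - y')) Y \<Longrightarrow>
      (real D)\<^sup>2 * ln (real D) ^ ?d \<le> real T \<Longrightarrow> real D ^ ?d \<le> real T * l ^ (?d - 2) \<Longrightarrow>
      T \<ge> 1 \<Longrightarrow> \<rho> > 0 \<Longrightarrow> \<rho> ^ ?d \<le> real (card Y) * (6 * real D) ^ ?d \<Longrightarrow>
      \<forall>y\<in>Y. real_of_int (linf (y - x)) + l \<le> 11 * \<rho> \<Longrightarrow>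
      32 * (real ?d)\<^sup>2 * (11 * \<rho>)\<^sup>2 \<le> real T \<Longrightarrow> real T \<le> 64 * (real ?d)\<^sup>2 * (11 * \<rho>)\<^sup>2 \<Longrightarrow>
      cv \<le> hit (\<Union>y\<in>Y. zbox y l) T x"
    by (rule visibility_separated_boxes[OF d]) (rule that)
  \<comment> \<open>Both constants are fixed before \<gamma>, so c depends on d only. The factor 1/2
    in c pays for k >= u/2 periods; 2^d pays for rounding the cell size down, which loses at most a
    factor 2 in D.\<close>
  define c0 where "c0 = min cv (1 / 2)"
  define c where "c = min (c0 / 2) (cd / 2 ^ ?d)"
  have c0: "0 < c0" "c0 \<le> 1 / 2" "c0 \<le> cv" using cv by (auto simp: c0_def)
  have c: "0 < c" "c \<le> c0 / 2" "c \<le> cd / 2 ^ ?d" using c0 cd by (simp_all only: c_def) simp_all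
  show ?thesis
  proof (intro exI[of _ c] conjI allI impI)
    show "c > 0" by (rule c)
    fix \<gamma> :: real assume "\<gamma> > 10"
    hence \<gamma>: "\<gamma> > 0" by simp
    \<comment> \<open>u >= 2^d makes q at least 2 L^(1/d), so that the floor costs at most half; u
      >= 1/c gives c h >= 1.\<close>
    define U0 where "U0 = max (2 ^ ?d) (max (1 / c) 2)"
    \<comment> \<open>The constant 5808 = 48 * 121 lies between 32 * 121 and 64 * 121, as the
      conditions on T in \<open>visibility\<close> ask when T = 5808 d^2 \<rho>^2. The factor 36
      then makes \<rho> at least 6 D.\<close>
    define A where "A = 36 * 5808 * (real ?d)\<^sup>2"
    define D0 where "D0 = real (max 24 (max Dd Dv))"
    have dd1: "1 \<le> (real ?d)\<^sup>2" by (simp add: Suc_leI)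
    have A1: "A \<ge> 1" using dd1 unfolding A_def by linarith
    obtain L0 where L0: "\<And>L. L \<ge> L0 \<Longrightarrow> ln (real L) \<ge> 1 \<and> ln (real L) powr \<gamma> \<ge> U0 \<and>
      ln (real L) powr \<gamma> \<le> real L powr (1 / 300) \<and>
      (A + ln (real L) ^ ?d) * real L powr (4 / 5) + 1 \<le> real L / (ln (real L) powr \<gamma>) ^ 11 \<and>
      real L powr (1 / (real ?d + 1)) \<ge> D0 \<and> 8 * real L powr (2 / 5) \<le> real L \<and> 36 * sqrt (real L) \<le> real L"
      using scale_conditions[OF \<gamma>, of U0 A ?d D0] by (auto simp: eventually_sequentially)
    show "\<exists>L0::nat. \<forall>(L::nat) (K::nat) (\<Lambda> :: (int ^ 'd) set) (l::real) (Lt::int)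
        (y :: (int ^ 'd) set \<Rightarrow> int ^ 'd).
      L \<ge> 1 \<and> L \<ge> L0 \<and>
      ((\<exists>x N. N \<ge> 0 \<and> \<Lambda> = zbox x N) \<or> \<Lambda> = {}) \<and>
      ln (real L) powr (100 * \<gamma>) \<le> l \<and> l \<le> real L powr (1 / (3 * real ?d)) \<and>
      Lt = \<lfloor>(alpha \<gamma> L * real L * l powr ((real ?d - 2) / 2)) powr (1 / real ?d)\<rfloor> \<and>
      (\<forall>C \<in> cells K L Lt \<Lambda>. y C \<in> C) \<longrightarrow>
      good_obstacle_set K L \<gamma>
        (exp (- c * ln (real L) powr \<gamma>)) (c * l powr ((real ?d - 2) / 2))
        {zbox (y C) l | C. C \<in> cells K L Lt \<Lambda>} l
        (\<Union>C \<in> cells K L Lt \<Lambda>. zbox (y C) l)"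
    proof (intro exI[of _ L0] allI impI, elim conjE)
      fix L K :: nat and \<Lambda> :: "(int ^ 'd) set" and l Lt and y :: "(int ^ 'd) set \<Rightarrow> int ^ 'd"
      assume L1: "L \<ge> 1" and LL0: "L \<ge> L0" and \<Lambda>: "(\<exists>x N. N \<ge> 0 \<and> \<Lambda> = zbox x N) \<or> \<Lambda> = {}"
        and l_ge: "ln (real L) powr (100 * \<gamma>) \<le> l" and l_le: "l \<le> real L powr (1 / (3 * real ?d))"
        and Lt: "Lt = \<lfloor>(alpha \<gamma> L * real L * l powr ((real ?d - 2) / 2)) powr (1 / real ?d)\<rfloor>"
        and y: "\<forall>C \<in> cells K L Lt \<Lambda>. y C \<in> C"
      define x where "x = ln (real L)"
      define u where "u = x powr \<gamma>"
      have x1: "x \<ge> 1" and uU: "u \<ge> U0" and uL: "u \<le> real L powr (1 / 300)"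
        and LT: "(A + x ^ ?d) * real L powr (4 / 5) + 1 \<le> real L / u ^ 11"
        and LD0: "real L powr (1 / (real ?d + 1)) \<ge> D0" and L8: "8 * real L powr (2 / 5) \<le> real L"
        and L36: "36 * sqrt (real L) \<le> real L"
        using L0[OF LL0] by (simp_all add: x_def u_def)
      have Lr: "real L \<ge> 1" using L1 by simp
      have u: "u \<ge> 2 ^ ?d" "u \<ge> 1 / c" "u \<ge> 2" using uU by (auto simp: U0_def)
      have upow: "x powr (real n * \<gamma>) = u ^ n" for n
      proof -
        have "u ^ n = u powr real n" using u(3) by (simp add: powr_realpow)
        thus ?thesis by (simp add: u_def powr_powr mult.commute)
      qed
      have al: "alpha \<gamma> L = u ^ 10" using upow[of 10] by (simp add: alpha_def x_def)
      have lu: "u ^ 100 \<le> l" using upow[of 100] l_ge by (simp add: x_def)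
      have l1: "l \<ge> 1" using lu one_le_power[of u 100] u(3) by linarith
      define h where "h = l powr ((real ?d - 2) / 2)"
      have h2: "h\<^sup>2 = l ^ (?d - 2)"
      proof -
        have "h\<^sup>2 = l powr (real (?d - 2))"
          using l1 d by (simp add: h_def power2_eq_square of_nat_diff flip: powr_add)
        thus ?thesis using l1 by (simp add: powr_realpow)
      qed
      have hu: "u ^ 50 \<le> h"
      proof -
        have "u ^ 50 \<le> sqrt l" using lu by (intro real_le_rsqrt) (simp flip: power_mult)
        also have "\<dots> = l powr (1 / 2)" using l1 by (simp add: powr_half_sqrt)
        also have "\<dots> \<le> h" unfolding h_def using l1 d by (intro powr_mono) auto
        finally show ?thesis .
      qed
      have h0: "h > 0" using l1 by (simp add: h_def)
      have hL: "h \<le> real L powr (1 / 6)"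
      proof -
        have "h \<le> (real L powr (1 / (3 * real ?d))) powr ((real ?d - 2) / 2)"
          unfolding h_def using l_le l1 d by (intro powr_mono2) auto
        also have "\<dots> = real L powr ((1 / (3 * real ?d)) * ((real ?d - 2) / 2))" by (rule powr_powr)
        also have "\<dots> \<le> real L powr (1 / 6)"
          using Lr d by (intro powr_mono) (auto simp: field_simps)
        finally show ?thesis .
      qed
      define Q where "Q = u ^ 10 * real L * h"
      define q where "q = Q powr (1 / real ?d)"
      have Lt_q: "Lt = \<lfloor>q\<rfloor>" using Lt by (simp add: q_def Q_def al h_def)
      have u10: "2 ^ ?d \<le> u ^ 10"
      proof -
        have "u ^ 1 \<le> u ^ 10" using u(3) by (intro power_increasing) auto
        thus ?thesis using u(1) by simp
      qed
      have h1: "1 \<le> h" using hu one_le_power[of u 50] u(3) by linarith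
      have QL: "2 ^ ?d * real L \<le> Q"
      proof -
        have "2 ^ ?d * real L * 1 \<le> u ^ 10 * real L * h" using u10 h1 u(3) by (intro mult_mono) auto
        thus ?thesis by (simp add: Q_def)
      qed
      have "0 < 2 ^ ?d * real L" using Lr by simp
      hence Q0: "Q > 0" using QL by linarith
      have qd: "q ^ ?d = Q"
        using Q0 by (simp add: q_def powr_powr flip: powr_realpow)
      define Ld where "Ld = real L powr (1 / real ?d)"
      have Ld1: "Ld \<ge> 1" using Lr by (simp add: Ld_def ge_one_powr_ge_zero)
      have q2: "2 * Ld \<le> q"
      proof -
        have "2 * Ld = (2 ^ ?d * real L) powr (1 / real ?d)"
          by (simp add: Ld_def powr_mult powr_powr flip: powr_realpow)
        also have "\<dots> \<le> q" unfolding q_def using QL by (intro powr_mono2) auto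
        finally show ?thesis .
      qed
      define D where "D = nat Lt"
      have "1 \<le> Lt" using q2 Ld1 unfolding Lt_q by linarith
      hence LtD: "Lt = int D" "1 \<le> D" by (auto simp: D_def)
      have Dq: "real D \<le> q" "q / 2 \<le> real D" "Ld \<le> real D"
        using q2 Ld1 LtD(1) unfolding Lt_q by linarith+
      have DQ: "real D ^ ?d \<le> Q" unfolding qd[symmetric] using Dq by (intro power_mono) auto
      have QD: "Q \<le> 2 ^ ?d * real D ^ ?d"
      proof -
        have "q ^ ?d \<le> (2 * real D) ^ ?d" using Dq q2 Ld1 by (intro power_mono) auto
        thus ?thesis by (simp add: qd power_mult_distrib)
      qed
      have lD: "l ^ 3 \<le> real D"
      proof -
        have "l ^ 3 \<le> (real L powr (1 / (3 * real ?d))) ^ 3" using l_le l1 by (intro power_mono) auto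
        also have "\<dots> = Ld" using Lr by (simp add: Ld_def powr_powr flip: powr_realpow)
        finally show ?thesis using Dq(3) by linarith
      qed
      have DD0: "D0 \<le> real D"
      proof -
        have "real L powr (1 / (real ?d + 1)) \<le> Ld"
          unfolding Ld_def using Lr by (intro powr_mono) (auto simp: frac_le)
        thus ?thesis using LD0 Dq(3) by linarith
      qed
      hence D24: "D \<ge> 24" "D \<ge> Dd" "D \<ge> Dv" by (auto simp: D0_def)
      have l8: "8 * l \<le> real D" by (rule eight_mult_le_of_cube_le[OF l1 lD]) (use D24 in simp)
      \<comment> \<open>As d >= 3, D^3 <= D^d <= u^10 L h, and the three factors are at most
        L^(1/30), L and L^(1/6), together L^(6/5).\<close>
      have DL: "real D \<le> real L powr (2 / 5)"
      proof (rule power_le_imp_le_base)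
        have "real D ^ Suc 2 \<le> real D ^ ?d" using LtD d by (intro power_increasing) auto
        also have "\<dots> \<le> Q" by (rule DQ)
        also have "\<dots> \<le> real L powr (1 / 30) * real L powr 1 * real L powr (1 / 6)"
          unfolding Q_def
        proof (intro mult_mono hL)
          have "u ^ 10 \<le> (real L powr (1 / 300)) ^ 10" using uL u(3) by (intro power_mono) auto
          also have "\<dots> = real L powr (1 / 30)" using Lr by (simp add: powr_powr flip: powr_realpow)
          finally show "u ^ 10 \<le> real L powr (1 / 30)" .
        qed (use Lr u h0 in auto)
        also have "\<dots> = real L powr (6 / 5)" by (simp only: powr_add[symmetric]) simp
        also have "\<dots> = (real L powr (2 / 5)) ^ Suc 2" using Lr by (simp add: powr_powr flip: powr_realpow)
        finally show "real D ^ Suc 2 \<le> (real L powr (2 / 5)) ^ Suc 2" .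
      qed simp
      have D8: "8 * real D \<le> real L" using DL L8 by linarith

      define Z where "Z = {w \<in> cell_centers K L Lt. zbox w (2 * of_int Lt) \<inter> inner_boundary \<Lambda> = {}}"
      \<comment> \<open>Obstacles are indexed by the centres of the cells. Centres are at least 3 Lt
        apart and g moves each by at most Lt, so the obstacle centres stay D apart and g is
        injective.\<close>
      define g where "g w = y (zbox w (of_int Lt))" for w
      have cells_eq: "cells K L Lt \<Lambda> = (\<lambda>w. zbox w (of_int Lt)) ` Z"
        by (auto simp: cells_def Z_def)
      have finZ: "finite Z" by (rule finite_subset[of _ "zbox 0 (real K + 3 * real L / 2)"])
        (auto simp: Z_def cell_centers_def)
      have g: "linf (g w - w) \<le> int D" if "w \<in> Z" for w
      proof -
        have "g w \<in> zbox w (of_int Lt)" using y that unfolding cells_eq g_def by blast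
        thus ?thesis by (simp add: mem_zbox_iff LtD)
      qed
      have gsep: "int D \<le> linf (g w - g w')" if "w \<in> Z" "w' \<in> Z" "w \<noteq> w'" for w w'
      proof -
        have "3 * Lt \<le> linf (w - w')"
          using that by (intro linf_ge_of_dvd) (auto simp: Z_def cell_centers_def)
        also have "\<dots> \<le> linf (w - g w) + linf (g w - w')" by (rule linf_triangle)
        also have "linf (g w - w') \<le> linf (g w - g w') + linf (g w' - w')" by (rule linf_triangle)
        finally show ?thesis using g[OF that(1)] g[OF that(2)] linf_minus[of w "g w"] LtD(1) by linarith
      qed
      have ginj: "inj_on g Z"
      proof (rule inj_onI, rule ccontr)
        fix w w' assume w: "w \<in> Z" "w' \<in> Z" "g w = g w'" "w \<noteq> w'"
        have "linf (g w - g w') \<le> 0" using w(3) by (simp add: linf_le_iff)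
        thus False using gsep[OF w(1,2,4)] LtD(2) by linarith
      qed
      have pw: "pairwise (\<lambda>y y'. int D \<le> linf (y - y')) (g ` Z)"
        by (rule pairwise_imageI) (rule gsep)
      define U where "U = (\<Union>y\<in>g ` Z. zbox y l)"
      have U_eq: "(\<Union>C\<in>cells K L Lt \<Lambda>. zbox (y C) l) = U"
        by (simp add: cells_eq U_def g_def)
      have \<B>_eq: "{zbox (y C) l | C. C \<in> cells K L Lt \<Lambda>} = (\<lambda>y. zbox y l) ` g ` Z"
        by (auto simp: cells_eq g_def)

      \<comment> \<open>The period of length L / u^11; k of them take at most L / u^10 = L /
        \<alpha>, the time allowed for visibility.\<close>
      define T1 where "T1 = nat \<lfloor>real L / u ^ 11\<rfloor>"
      define k where "k = nat \<lfloor>u\<rfloor>"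
      define \<rho> where "\<rho> = sqrt (real T1 / (5808 * (real ?d)\<^sup>2))"
      have k: "real k \<le> u" "u / 2 \<le> real k" using u(3) unfolding k_def by linarith+
      have T1_le: "real T1 \<le> real L / u ^ 11" using u(3) by (simp add: T1_def)
      have T1_gt: "real L / u ^ 11 - 1 \<le> real T1" unfolding T1_def by linarith
      have kT: "real (k * T1) \<le> real L / u ^ 10"
      proof -
        have "real (k * T1) \<le> u * (real L / u ^ 11)"
          unfolding of_nat_mult using k(1) T1_le u(3) by (intro mult_mono) auto
        also have "u ^ 11 = u * u ^ 10" by (simp flip: power_Suc)
        also have "u * (real L / (u * u ^ 10)) = real L / u ^ 10" using u(3) by simp
        finally show ?thesis .
      qed
      have DT: "A * (real D)\<^sup>2 + (real D)\<^sup>2 * ln (real D) ^ ?d \<le> real T1"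
      proof -
        have "(real D)\<^sup>2 \<le> (real L powr (2 / 5))\<^sup>2" using DL by (intro power_mono) auto
        also have "\<dots> = real L powr (4 / 5)" using Lr by (simp add: powr_powr flip: powr_realpow)
        finally have D2: "(real D)\<^sup>2 \<le> real L powr (4 / 5)" .
        have "ln (real D) ^ ?d \<le> x ^ ?d"
          unfolding x_def using LtD(2) D8 by (intro power_mono) auto
        hence "(A + ln (real D) ^ ?d) * (real D)\<^sup>2 \<le> (A + x ^ ?d) * real L powr (4 / 5)"
          using D2 A1 x1 by (intro mult_mono) auto
        thus ?thesis using LT T1_gt by (simp add: algebra_simps)
      qed
      have lnD0: "0 \<le> (real D)\<^sup>2 * ln (real D) ^ ?d" using LtD(2) by simp
      have D2_1: "1 \<le> (real D)\<^sup>2" using LtD(2) by simp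
      have T1_1: "T1 \<ge> 1"
      proof -
        have "1 * 1 \<le> A * (real D)\<^sup>2" using A1 D2_1 by (intro mult_mono) auto
        thus ?thesis using DT lnD0 by linarith
      qed
      have \<rho>2: "5808 * (real ?d)\<^sup>2 * \<rho>\<^sup>2 = real T1" by (simp add: \<rho>_def)
      have \<rho>D: "6 * real D \<le> \<rho>"
      proof (rule power2_le_imp_le)
        have "5808 * (real ?d)\<^sup>2 * (6 * real D)\<^sup>2 = A * (real D)\<^sup>2" by (simp add: A_def power_mult_distrib)
        also have "\<dots> \<le> 5808 * (real ?d)\<^sup>2 * \<rho>\<^sup>2" unfolding \<rho>2 using DT lnD0 by linarith
        finally show "(6 * real D)\<^sup>2 \<le> \<rho>\<^sup>2" by (rule mult_left_le_imp_le) simp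
      qed (simp add: \<rho>_def)
      have \<rho>0: "\<rho> > 0" using \<rho>D LtD(2) by linarith
      have \<rho>L: "\<rho> \<le> sqrt (real L)"
      proof -
        have "1 * \<rho>\<^sup>2 \<le> 5808 * (real ?d)\<^sup>2 * \<rho>\<^sup>2" using dd1 by (intro mult_right_mono) (linarith, simp)
        also have "\<dots> \<le> real L / u ^ 11" unfolding \<rho>2 by (rule T1_le)
        also have "\<dots> \<le> real L / 1" using u(3) by (intro divide_left_mono one_le_power) auto
        finally show ?thesis by (intro real_le_rsqrt) simp
      qed
      have u4: "4 \<le> u ^ 10"
      proof -
        have "(2::real) ^ 2 \<le> u ^ 2" using u(3) by (intro power_mono) auto
        also have "\<dots> \<le> u ^ 10" using u(3) by (intro power_increasing) auto
        finally show ?thesis by simp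
      qed
      \<comment> \<open>Here the lower bound on l is used: up to rounding, T1 h^2 is L h^2 / u^11,
        and this exceeds D^d, at most u^10 L h, once h >= 2 u^21. The hypothesis gives h >=
        u^50.\<close>
      have DTl: "real D ^ ?d \<le> real T1 * l ^ (?d - 2)"
      proof -
        have "1 * 1 \<le> (A + x ^ ?d) * real L powr (4 / 5)"
          using A1 x1 Lr by (intro mult_mono) (auto simp: ge_one_powr_ge_zero add_increasing2)
        hence "2 \<le> real L / u ^ 11" using LT by linarith
        moreover have "r / 2 \<le> t" if "2 \<le> r" "r - 1 \<le> t" for r t :: real using that by linarith
        ultimately have T1half: "real L / u ^ 11 / 2 \<le> real T1" using T1_gt by blast
        have "2 * u ^ 21 \<le> u * u ^ 21" using u(3) by (intro mult_right_mono) auto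
        also have "\<dots> = u ^ 22" by (simp flip: power_Suc)
        also have "\<dots> \<le> u ^ 50" using u(3) by (intro power_increasing) auto
        also have "\<dots> \<le> h" by (rule hu)
        finally have uh: "2 * u ^ 21 \<le> h" .
        have "u ^ 21 = u ^ 11 * u ^ 10" by (simp flip: power_add)
        moreover have "b * r * h = (r / a / 2) * (2 * (a * b) * h)" if "a \<noteq> 0" for a b r :: real
          using that by simp
        ultimately have "u ^ 10 * real L * h = (real L / u ^ 11 / 2) * (2 * u ^ 21 * h)"
          using u(3) by (metis power_not_zero not_numeral_le_zero)
        also have "\<dots> \<le> real T1 * (h * h)"
          using T1half uh u(3) h0 by (intro mult_mono mult_right_mono) auto
        finally show ?thesis using DQ by (simp add: Q_def h2[symmetric] power2_eq_square)
      qed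
      \<comment> \<open>The margin L/4 covers the distance the walk can travel in all k periods. The
        cells used lie within a further 9 \<rho> <= 9 sqrt L <= L/4, hence inside the region of cell
        centres, of radius K + 3L/2.\<close>
      have hitU: "c0 \<le> hit U T1 z" if z: "real_of_int (linf z) \<le> real K + real L + real L / 4" for z :: "int ^ 'd"
      proof -
        define p where "p = \<lfloor>\<rho>\<rfloor>"
        have p: "real_of_int p \<le> \<rho>" "\<rho> < real_of_int p + 1" "6 * Lt \<le> p"
          using \<rho>D LtD(1) unfolding p_def by linarith+
        have Lt1: "1 \<le> Lt" "2 * Lt < p" using LtD p(3) by auto
        obtain W where W: "finite W" "\<forall>w\<in>W. (\<forall>i. 3 * Lt dvd w $ i) \<and> linf (w - z) \<le> 9 * p \<and>
            zbox w (2 * of_int Lt) \<inter> inner_boundary \<Lambda> = {}"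
          "nat ((p + 1) div (3 * Lt)) ^ ?d \<le> card W"
          by (rule many_cells_off_boundary[OF \<Lambda> Lt1, of z]) (rule that)
        have WZ: "W \<subseteq> Z"
        proof
          fix w assume w: "w \<in> W"
          have "linf (w - 0) \<le> linf (w - z) + linf (z - 0)" by (rule linf_triangle)
          hence "linf w \<le> 9 * p + linf z" using W(2) w by fastforce
          hence "real_of_int (linf w) \<le> 9 * \<rho> + real_of_int (linf z)" using p(1) by linarith
          also have "\<dots> \<le> real K + 3 * real L / 2" using z \<rho>L L36 by linarith
          finally show "w \<in> Z" using W(2) w by (simp add: Z_def cell_centers_def zbox_def)
        qed
        have cardW: "card (g ` W) = card W" using ginj WZ by (meson card_image inj_on_subset)
        have "cv \<le> hit (\<Union>y\<in>g ` W. zbox y l) T1 z"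
        proof (rule visibility[OF D24(3) l1 l8 _ _ _ DTl T1_1 \<rho>0])
          show "finite (g ` W)" using W by simp
          show "pairwise (\<lambda>y y'. int D \<le> linf (y - y')) (g ` W)"
            using pw WZ by (meson image_mono pairwise_subset)
          have "0 \<le> A * (real D)\<^sup>2" using A1 by simp
          thus "(real D)\<^sup>2 * ln (real D) ^ ?d \<le> real T1" using DT by linarith
          show "32 * (real ?d)\<^sup>2 * (11 * \<rho>)\<^sup>2 \<le> real T1" "real T1 \<le> 64 * (real ?d)\<^sup>2 * (11 * \<rho>)\<^sup>2"
            using zero_le_power2[of "real ?d * \<rho>"] unfolding \<rho>2[symmetric] by (simp_all add: power_mult_distrib)
          show "\<rho> ^ ?d \<le> real (card (g ` W)) * (6 * real D) ^ ?d"
          proof -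
            \<comment> \<open>The number of admissible centres guaranteed in each coordinate.
              Rounding costs at most 3 D, half of \<rho>, which gives \<rho> <= 6 D n.\<close>
            define n where "n = (p + 1) div (3 * Lt)"
            have n0: "0 \<le> n" using p(3) Lt1 by (simp add: n_def pos_imp_zdiv_nonneg_iff)
            have "3 * Lt * n = p + 1 - (p + 1) mod (3 * Lt)"
              unfolding n_def by (rule minus_mod_eq_mult_div[symmetric])
            moreover have "(p + 1) mod (3 * Lt) < 3 * Lt" using Lt1 by (intro pos_mod_bound) simp
            ultimately have "p + 1 \<le> 3 * Lt * n + 3 * Lt" by linarith
            hence "real_of_int (p + 1) \<le> real_of_int (3 * Lt * n + 3 * Lt)" by (simp only: of_int_le_iff)
            hence "\<rho> \<le> 3 * real D * of_int n + 3 * real D" using p(2) by (simp add: LtD)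
            hence "\<rho> \<le> 6 * real D * of_int n" using \<rho>D by linarith
            hence "\<rho> ^ ?d \<le> (6 * real D * of_int n) ^ ?d" using \<rho>0 by (intro power_mono) auto
            also have "\<dots> = real (nat n ^ ?d) * (6 * real D) ^ ?d" using n0 by (simp add: power_mult_distrib mult_ac)
            also have "\<dots> \<le> real (card W) * (6 * real D) ^ ?d"
              using W(3) by (intro mult_right_mono) (simp_all only: of_nat_le_iff n_def, simp)
            finally show ?thesis by (simp add: cardW)
          qed
          show "\<forall>y\<in>g ` W. real_of_int (linf (y - z)) + l \<le> 11 * \<rho>"
          proof
            fix v assume "v \<in> g ` W"
            then obtain w where w: "w \<in> W" "v = g w" by auto
            have "linf (v - z) \<le> linf (v - w) + linf (w - z)" by (rule linf_triangle)
            also have "\<dots> \<le> int D + 9 * p" using w W(2) WZ g by (intro add_mono) auto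
            finally have "real_of_int (linf (v - z)) \<le> real D + 9 * real_of_int p" by linarith
            thus "real_of_int (linf (v - z)) + l \<le> 11 * \<rho>" using p(1) \<rho>D l8 l1 by linarith
          qed
        qed
        also have "\<dots> \<le> hit U T1 z" unfolding U_def using WZ by (intro hit_mono_set) auto
        finally show ?thesis using c0 by linarith
      qed

      show "good_obstacle_set K L \<gamma> (exp (- c * ln (real L) powr \<gamma>)) (c * l powr ((real ?d - 2) / 2))
        {zbox (y C) l | C. C \<in> cells K L Lt \<Lambda>} l (\<Union>C \<in> cells K L Lt \<Lambda>. zbox (y C) l)"
        unfolding good_obstacle_set_def U_eq \<B>_eq
      proof (intro conjI ballI impI)
        show "0 < exp (- c * ln (real L) powr \<gamma>)" by simp
        have "0 < c * u" using c u(3) by simp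
        thus "exp (- c * ln (real L) powr \<gamma>) < 1" by (simp add: u_def x_def)
        show "1 \<le> c * l powr ((real ?d - 2) / 2)"
        proof -
          have "u ^ 1 \<le> u ^ 50" using u(3) by (intro power_increasing) auto
          hence "1 / c \<le> h" using hu u(2) by simp
          thus ?thesis using c by (simp add: h_def divide_le_eq mult.commute)
        qed
        show "obstacle_set ((\<lambda>y. zbox y l) ` g ` Z) l U"
          unfolding obstacle_set_def
        proof (intro conjI ballI)
          show "disjoint ((\<lambda>y. zbox y l) ` g ` Z)"
          proof (rule disjointI)
            fix B B' assume B: "B \<in> (\<lambda>y. zbox y l) ` g ` Z" "B' \<in> (\<lambda>y. zbox y l) ` g ` Z" "B \<noteq> B'"
            obtain v where v: "v \<in> g ` Z" "B = zbox v l" using B(1) by (rule imageE)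
            obtain v' where v': "v' \<in> g ` Z" "B' = zbox v' l" using B(2) by (rule imageE)
            have "v \<noteq> v'" using B(3) v(2) v'(2) by blast
            with v v' show "B \<inter> B' = {}" using zbox_disjoint[OF l8 pairwiseD[OF pw] LtD(2)] by auto
          qed
        qed (use l1 in \<open>auto simp: U_def\<close>)
        show "U \<subseteq> zbox 0 (real K + 2 * real L)"
        proof
          fix v assume "v \<in> U"
          then obtain w where w: "w \<in> Z" "v \<in> zbox (g w) l" by (auto simp: U_def)
          have "linf (v - 0) \<le> linf (v - g w) + linf (g w - 0)" by (rule linf_triangle)
          also have "linf (g w - 0) \<le> linf (g w - w) + linf (w - 0)" by (rule linf_triangle)
          finally have "linf v \<le> linf (v - g w) + int D + linf w" using g[OF w(1)] by simp
          hence "real_of_int (linf v) \<le> real_of_int (linf (v - g w)) + real D + real_of_int (linf w)" by linarith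
          moreover have "real_of_int (linf (v - g w)) \<le> l" using w(2) by (simp add: zbox_def)
          moreover have "real_of_int (linf w) \<le> real K + 3 * real L / 2"
            using w(1) by (auto simp: Z_def cell_centers_def zbox_def)
          ultimately have "real_of_int (linf v) \<le> real K + 2 * real L" using l8 D8 l1 by linarith
          thus "v \<in> zbox 0 (real K + 2 * real L)" by (simp add: zbox_def)
        qed
      next
        fix z :: "int ^ 'd" assume z: "z \<in> zbox 0 (real K + real L)"
        have "1 - hit U (k * T1) z \<le> (1 - c0) ^ k"
        proof (rule survival_power_le)
          fix v assume v: "linf (v - z) \<le> int (k * T1)"
          have "linf (v - 0) \<le> linf (v - z) + linf (z - 0)" by (rule linf_triangle)
          hence "linf v \<le> int (k * T1) + linf z" using v by (simp del: of_nat_mult)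
          hence "real_of_int (linf v) \<le> real_of_int (int (k * T1) + linf z)" by (simp only: of_int_le_iff)
          also have "\<dots> = real (k * T1) + real_of_int (linf z)" by (simp only: of_int_add of_int_of_nat_eq)
          also have "\<dots> \<le> real L / u ^ 10 + (real K + real L)" using kT z by (intro add_mono) (auto simp: zbox_def)
          also have "\<dots> \<le> real L / 4 + (real K + real L)"
            using u4 by (intro add_right_mono divide_left_mono) auto
          finally show "c0 \<le> hit U T1 v" by (intro hitU) simp
        qed
        also have "\<dots> \<le> exp (- c0) ^ k"
          using c0 exp_ge_add_one_self[of "- c0"] by (intro power_mono) auto
        also have "\<dots> = exp (- (c0 * real k))" by (simp flip: exp_of_nat_mult)
        also have "\<dots> \<le> exp (- c * u)"
        proof -
          have "c * u \<le> (c0 / 2) * u" using c u(3) by (intro mult_right_mono) auto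
          also have "\<dots> = c0 * (u / 2)" by simp
          also have "\<dots> \<le> c0 * real k" using k(2) c0 by (intro mult_left_mono) auto
          finally show ?thesis by simp
        qed
        finally have 1: "1 - hit U (k * T1) z \<le> exp (- c * ln (real L) powr \<gamma>)" by (simp add: u_def x_def)
        have "real L * ln (real L) powr (- 10 * \<gamma>) = real L / u ^ 10"
          using upow[of 10] by (simp add: x_def powr_minus divide_inverse)
        hence "real (k * T1) \<le> real L * ln (real L) powr (- 10 * \<gamma>)" using kT by simp
        from measure_hitting_time_gt_le[OF this, of z U] 1
        show "measure (walk_law z)
          {X. ereal (real L * ln (real L) powr (- 10 * \<gamma>)) < ereal_of_enat (hitting_time U X)}
          \<le> exp (- c * ln (real L) powr \<gamma>)" by linarith
      next
        fix B assume "B \<in> (\<lambda>y. zbox y l) ` g ` Z" "B \<inter> source_set K L \<gamma> \<noteq> {}"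
        then obtain y0 b where y0: "y0 \<in> g ` Z" "B = zbox y0 l" and b: "b \<in> zbox y0 l" "b \<in> source_set K L \<gamma>"
          by auto
        define r where "r = real K + sqrt (real L) * u"
        have src: "source_set K L \<gamma> = (zbox 0 r :: (int ^ 'd) set)" by (simp add: source_set_def r_def u_def x_def)
        have r: "sqrt (real L) * u \<le> r" "0 \<le> sqrt (real L) * u" using u(3) by (simp_all add: r_def)
        have "\<exists>T. cd * real D ^ ?d \<le> (\<Sum>x\<in>zbox 0 r. first_hit U B T x)"
          unfolding U_def y0(2)
        proof (rule density[OF D24(2) l1 lD _ pw y0(1) b(1)])
          show "finite (g ` Z)" using finZ by simp
          show "b \<in> zbox 0 r" using b(2) src by simp
          show "r \<ge> 0" using r by linarith
          \<comment> \<open>K may be 0, so only r >= sqrt(L) u is available; the comparison then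
            reduces to u^10 <= h.\<close>
          have "u ^ 10 * real L * h \<le> u\<^sup>2 * real L * (h * h)"
          proof -
            have "u ^ 10 \<le> u ^ 50" using u(3) by (intro power_increasing) auto
            hence "u ^ 10 \<le> h" using hu by linarith
            moreover have "1 \<le> u\<^sup>2" using u(3) by (simp add: one_le_power)
            ultimately have "u ^ 10 * (real L * h) \<le> h * (real L * h)" "1 * (h * (real L * h)) \<le> u\<^sup>2 * (h * (real L * h))"
              using h0 by (intro mult_right_mono; simp)+
            thus ?thesis by (simp add: mult_ac)
          qed
          also have "\<dots> = (sqrt (real L) * u)\<^sup>2 * (h * h)" by (simp add: power_mult_distrib mult_ac)
          also have "\<dots> \<le> r\<^sup>2 * (h * h)" using r by (intro mult_right_mono power_mono) auto
          finally show "real D ^ ?d \<le> r\<^sup>2 * l ^ (?d - 2)" using DQ by (simp add: Q_def h2[symmetric] power2_eq_square)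
        qed
        then obtain T where T: "cd * real D ^ ?d \<le> (\<Sum>x\<in>zbox 0 r. first_hit U B T x)" by blast
        let ?E = "{X. hitting_time U X < \<infinity> \<and> X (the_enat (hitting_time U X)) \<in> B}"
        \<comment> \<open>The choice of the cell size is tight here: h L = Q / u^10, and Q is at
          most 2^d D^d.\<close>
        have "c * l powr ((real ?d - 2) / 2) * real L \<le> cd / 2 ^ ?d * h * real L"
          unfolding h_def using c by (intro mult_right_mono) auto
        also have "\<dots> = inverse (u ^ 10) * (cd / 2 ^ ?d * Q)" using u(3) by (simp add: Q_def)
        also have "\<dots> \<le> inverse (u ^ 10) * (cd / 2 ^ ?d * (2 ^ ?d * real D ^ ?d))"
          using QD cd u(3) by (intro mult_left_mono) auto
        also have "\<dots> = inverse (u ^ 10) * (cd * real D ^ ?d)" by simp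
        also have "\<dots> \<le> inverse (u ^ 10) * (\<Sum>x\<in>zbox 0 r. first_hit U B T x)"
          using T u(3) by (intro mult_left_mono) auto
        also have "\<dots> \<le> inverse (u ^ 10) * (\<Sum>x\<in>zbox 0 r. measure (walk_law x) ?E)"
          using u(3) by (intro mult_left_mono sum_mono first_hit_le_measure) auto
        also have "\<dots> = walk_measure (source_measure K L \<gamma>) ?E"
        proof -
          have "walk_measure (source_measure K L \<gamma>) ?E =
             (\<Sum>\<^sub>\<infinity>x\<in>zbox 0 r. source_measure K L \<gamma> x * measure (walk_law x) ?E)"
            unfolding walk_measure_def by (rule infsum_cong_neutral) (auto simp: source_measure_def src)
          also have "\<dots> = (\<Sum>x\<in>zbox 0 r. source_measure K L \<gamma> x * measure (walk_law x) ?E)"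
            by (rule infsum_finite) simp
          also have "\<dots> = (\<Sum>x\<in>zbox 0 r. inverse (u ^ 10) * measure (walk_law x) ?E)"
            by (intro sum.cong) (auto simp: source_measure_def src al)
          finally show ?thesis by (simp add: sum_distrib_left)
        qed
        finally show "c * l powr ((real ?d - 2) / 2) * real L \<le> walk_measure (source_measure K L \<gamma>) ?E" .
      qed
    qed
  qed
qed

end
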